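(* For any $t\in\mathscr{W}$ such that $\hat\beta_{\mathrm{sat}}(t)>0$, there exist a constant $C=C(\hat\beta_{\mathrm{sat}}(t))>0$ and a strictly increasing sequence of positive integers $(n_k)_{k=1}^{\infty}$ such that for every $k\ge 1$ $$\sum_{x\in\Lambda_{n_k}} e^{t\cdot x}\,\Phi_{\hat\beta_{\mathrm{sat}}(t)}\bigl(0\xleftrightarrow{\Lambda_{n_k}}x\bigr)\ \ge\ Ck .$$ In particular, $\mathbb{G}_{\hat\beta_{\mathrm{sat}}(t)}(t)=\infty$. Moreover, if $\psi(x)=O(\rho(x)^{-d-1-\varepsilon})$ for some $\varepsilon>0$, one can choose $n_k=k$.
   Context: Let $d\ge1$, let $\|\cdot\|$ be the Euclidean norm on $\mathbb{R}^d$ and let $\rho$ be a norm on $\mathbb{R}^d$. The graph is the complete graph on $\mathbb{Z}^d$, with edge set $E_d$ consisting of all pairs $\{i,j\}\subset\mathbb{Z}^d$. Coupling constants: $J_{i,j}=J_{i-j}\ge 0$ with $J_x=\psi(x)e^{-\rho(x)}$ for $x\neq0$ and $J_0=0$, where $\lim_{\|x\|\to\infty}\log(\psi(x))/\|x\|=0$, and $J$ is invariant under rotation by $\pi/2$ around any coordinate axis. $\Lambda_N=\{-N,\dots,N\}^d$. FK-Ising model: for $\beta\ge0$, $\Phi_{\Lambda_N;\beta}$ is the probability measure on percolation configurations $\omega\in\{0,1\}^{E_{\Lambda_N}}$ ($E_{\Lambda_N}$ is the set of edges with both endpoints in $\Lambda_N$; an edge $\{i,j\}$ is open if $\omega_{i,j}=1$)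 with weight proportional to $2^{\kappa(\omega)}\prod_{\{i,j\}:\,\omega_{i,j}=1}(e^{\beta J_{ij}}-1)$, where $\kappa(\omega)$ is the number of connected components of the graph with vertex set $\Lambda_N$ and edges the open edges of $\omega$. $\Phi_\beta$ is the weak limit of $\Phi_{\Lambda_N;\beta}$ as $N\to\infty$. For $S\subset\mathbb{Z}^d$, $\{x\xleftrightarrow{S}y\}$ is the event that there is a path of open edges from $x$ to $y$ using only edges with both endpoints in $S$; for $S=\mathbb{Z}^d$ the superscript is omitted. Wulff shape: $\mathscr{W}=\{t\in\mathbb{R}^d:\ t\cdot x\le\rho(x)\ \forall x\in\mathbb{R}^d\}$. For $t\in\mathscr{W}$, $\mathbb{G}_\beta(t)=\sum_{x\in\mathbb{Z}^d}e^{t\cdot x}\Phi_\beta(0\leftrightarrow x)$ and $\hat\beta_{\mathrm{sat}}(t)=\sup\{\beta\ge0:\ \mathbb{G}_\beta(t)<\infty\}$. *)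

theory Defs
  imports "HOL-Probability.Probability" "HOL-Library.Landau_Symbols"
begin

text \<open>The lattice \<open>\<int>\<^sup>d\<close> is \<open>int ^ 'd\<close> and \<open>\<real>\<^sup>d\<close> is \<open>real ^ 'd\<close>, with \<open>d = CARD('d) \<ge> 1\<close>.\<close>

definition rvec :: "int ^ 'd \<Rightarrow> real ^ 'd" where
  "rvec x = (\<chi> k. real_of_int (x $ k))"

definition lattice_at_infinity :: "(int ^ 'd) filter" where
  "lattice_at_infinity = filtercomap (\<lambda>x. norm (rvec x)) at_top"

definition is_norm :: "('a::real_vector \<Rightarrow> real) \<Rightarrow> bool" where
  "is_norm \<rho> \<longleftrightarrow>
     (\<forall>x. \<rho> x \<ge> 0) \<and> (\<forall>x. \<rho> x = 0 \<longleftrightarrow> x = 0) \<and>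
     (\<forall>c x. \<rho> (c *\<^sub>R x) = \<bar>c\<bar> * \<rho> x) \<and> (\<forall>x y. \<rho> (x + y) \<le> \<rho> x + \<rho> y)"

definition wulff :: "(real ^ 'd \<Rightarrow> real) \<Rightarrow> (real ^ 'd) set" where
  "wulff \<rho> = {t. \<forall>x. t \<bullet> x \<le> \<rho> x}"

definition cube :: "nat \<Rightarrow> (int ^ 'd) set" where
  "cube N = {x. \<forall>k. - int N \<le> x $ k \<and> x $ k \<le> int N}"

text \<open>The rotation by \<open>\<pi>/2\<close> in the plane spanned by the coordinate directions \<open>a \<noteq> b\<close>; it fixes all
  other coordinates. For \<open>d = 3\<close> these are the rotations around the coordinate axes.\<close>

definition quarter_turn :: "'d \<Rightarrow> 'd \<Rightarrow> int ^ 'd \<Rightarrow> int ^ 'd" where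
  "quarter_turn a b x = (\<chi> k. if k = a then - (x $ b) else if k = b then x $ a else x $ k)"

text \<open>The clause \<open>J (- x) = J x\<close> makes \<open>J\<^sub>i\<^sub>j = J\<^sub>i\<^sub>-\<^sub>j\<close> a function of the unordered pair \<open>{i, j}\<close>.
  Since \<open>ln 0 = 0\<close> in HOL, positivity of \<open>\<psi>\<close> near infinity, implicit in the limit of
  \<open>log \<psi>(x) / \<parallel>x\<parallel>\<close>, is stated separately.\<close>

definition couplings ::
    "(real ^ 'd \<Rightarrow> real) \<Rightarrow> (int ^ 'd \<Rightarrow> real) \<Rightarrow> (int ^ 'd \<Rightarrow> real) \<Rightarrow> bool" where
  "couplings \<rho> \<psi> J \<longleftrightarrow>
     J 0 = 0 \<and>
     (\<forall>x. x \<noteq> 0 \<longrightarrow> J x = \<psi> x * exp (- \<rho> (rvec x))) \<and>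
     (\<forall>x. J x \<ge> 0) \<and>
     (\<forall>x. J (- x) = J x) \<and>
     (\<forall>a b x. a \<noteq> b \<longrightarrow> J (quarter_turn a b x) = J x) \<and>
     (\<forall>\<^sub>F x in lattice_at_infinity. \<psi> x > 0) \<and>
     ((\<lambda>x. ln (\<psi> x) / norm (rvec x)) \<longlongrightarrow> 0) lattice_at_infinity"

definition edges :: "'v set \<Rightarrow> 'v set set" where
  "edges S = {{i, j} | i j. i \<in> S \<and> j \<in> S \<and> i \<noteq> j}"

text \<open>\<open>edge_coupling J {i, j} = J (i - j)\<close>, well defined on edges when \<open>J\<close> is even.\<close>

definition edge_coupling :: "(int ^ 'd \<Rightarrow> real) \<Rightarrow> (int ^ 'd) set \<Rightarrow> real" where
  "edge_coupling J e = (THE c. \<exists>i j. e = {i, j} \<and> c = J (i - j))"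

definition linked :: "'v set \<Rightarrow> ('v set \<Rightarrow> bool) \<Rightarrow> 'v \<Rightarrow> 'v \<Rightarrow> bool" where
  "linked S \<omega> = (\<lambda>u v. u \<in> S \<and> v \<in> S \<and> u \<noteq> v \<and> \<omega> {u, v})\<^sup>*\<^sup>*"

definition num_clusters :: "'v set \<Rightarrow> ('v set \<Rightarrow> bool) \<Rightarrow> nat" where
  "num_clusters S \<omega> = card (S // {(x, y). x \<in> S \<and> y \<in> S \<and> linked S \<omega> x y})"

definition fk_weight ::
    "(int ^ 'd \<Rightarrow> real) \<Rightarrow> real \<Rightarrow> (int ^ 'd) set \<Rightarrow> ((int ^ 'd) set \<Rightarrow> bool) \<Rightarrow> real" where
  "fk_weight J \<beta> S \<omega> =
     2 ^ num_clusters S \<omega> * (\<Prod>e\<in>{e \<in> edges S. \<omega> e}. exp (\<beta> * edge_coupling J e) - 1)"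

definition fk_finite ::
    "(int ^ 'd \<Rightarrow> real) \<Rightarrow> real \<Rightarrow> (int ^ 'd) set \<Rightarrow> ((int ^ 'd) set \<Rightarrow> bool) measure" where
  "fk_finite J \<beta> S =
     point_measure (edges S \<rightarrow>\<^sub>E UNIV)
       (\<lambda>\<omega>. ennreal (fk_weight J \<beta> S \<omega> / (\<Sum>\<eta>\<in>edges S \<rightarrow>\<^sub>E UNIV. fk_weight J \<beta> S \<eta>)))"

text \<open>The configuration space \<open>{0,1}\<^sup>E\<close>, with \<open>E\<close> the edges of the complete graph on \<open>\<int>\<^sup>d\<close>, carries the
  product \<open>\<sigma>\<close>-algebra and the product of the discrete topologies.\<close>

definition config_space :: "((int ^ 'd) set \<Rightarrow> bool) measure" where
  "config_space = PiM (edges UNIV) (\<lambda>_. count_space UNIV)"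

definition config_topology :: "((int ^ 'd) set \<Rightarrow> bool) topology" where
  "config_topology = product_topology (\<lambda>_. discrete_topology UNIV) (edges UNIV)"

text \<open>The finite-volume measure as a measure on \<open>{0,1}\<^sup>E\<close>: every edge that is not an edge of \<open>S\<close>
  is closed.\<close>

definition fk_extended ::
    "(int ^ 'd \<Rightarrow> real) \<Rightarrow> real \<Rightarrow> (int ^ 'd) set \<Rightarrow> ((int ^ 'd) set \<Rightarrow> bool) measure" where
  "fk_extended J \<beta> S =
     distr (fk_finite J \<beta> S) config_space (\<lambda>\<omega>. \<lambda>e\<in>edges UNIV. e \<in> edges S \<and> \<omega> e)"

definition weakly_converges :: "'a topology \<Rightarrow> (nat \<Rightarrow> 'a measure) \<Rightarrow> 'a measure \<Rightarrow> bool" where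
  "weakly_converges X \<mu> M \<longleftrightarrow>
     (\<forall>f. continuous_map X euclideanreal f \<and> bounded (f ` topspace X) \<longrightarrow>
        (\<lambda>N. \<integral>\<omega>. f \<omega> \<partial>\<mu> N) \<longlonglongrightarrow> (\<integral>\<omega>. f \<omega> \<partial>M))"

definition fk :: "(int ^ 'd \<Rightarrow> real) \<Rightarrow> real \<Rightarrow> ((int ^ 'd) set \<Rightarrow> bool) measure" where
  "fk J \<beta> = (THE M. prob_space M \<and> sets M = sets config_space \<and>
     weakly_converges config_topology (\<lambda>N. fk_extended J \<beta> (cube N)) M)"

definition connection ::
    "(int ^ 'd) set \<Rightarrow> int ^ 'd \<Rightarrow> int ^ 'd \<Rightarrow> ((int ^ 'd) set \<Rightarrow> bool) set" where
  "connection S x y = {\<omega> \<in> space config_space. linked S \<omega> x y}"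

definition G_fun :: "(int ^ 'd \<Rightarrow> real) \<Rightarrow> real \<Rightarrow> real ^ 'd \<Rightarrow> ennreal" where
  "G_fun J \<beta> t =
     (\<Sum>\<^sub>\<infinity>x. ennreal (exp (t \<bullet> rvec x) * measure (fk J \<beta>) (connection UNIV 0 x)))"

text \<open>The supremum is taken in the extended reals, as the set may be unbounded
  (e.g. for \<open>d = 1\<close> and \<open>t = 0\<close>).\<close>

definition beta_sat :: "(int ^ 'd \<Rightarrow> real) \<Rightarrow> real ^ 'd \<Rightarrow> ereal" where
  "beta_sat J t = (SUP \<beta>\<in>{\<beta>. 0 \<le> \<beta> \<and> G_fun J \<beta> t < \<infinity>}. ereal \<beta>)"

end

theory Submission
  imports Defs
begin

text \<open>
  Let \<open>\<phi>\<^sub>\<beta>(S)\<close> be the tilted weight of connections from the origin to a point \<open>x\<close> in the random-cluster model on a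
  finite set \<open>S\<close>, followed by one jump from \<open>x\<close> out of \<open>S\<close> (\<open>boundary_sum\<close>). If \<open>\<phi>\<^sub>\<beta>(S) < 1\<close> for some finite \<open>S\<close>
  containing the origin, then a path that leaves \<open>S\<close> can be cut at its exit, the remaining path starts
  afresh, and the generating function is dominated by a convergent geometric series
  (\<open>simon_lieb\<close>, \<open>susceptibility_le\<close>, \<open>G_fun_finite_if_boundary_sum_less_1\<close>). Since \<open>S\<close> is finite,
  \<open>\<beta> \<mapsto> \<phi>\<^sub>\<beta>(S)\<close> is continuous, so the condition is open in \<open>\<beta>\<close>. At the saturation point it therefore has to
  fail: \<open>\<phi>(S) \<ge> 1\<close> for every finite \<open>S\<close> containing the origin (\<open>boundary_sum_ge_1_at_saturation\<close>).

  Averaging the lower bounds \<open>1 \<le> \<phi>(\<Lambda>\<^sub>n)\<close> over \<open>n = 1, \<dots>, N\<close> gives the theorem. A jump by \<open>z\<close> from a given point leaves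
  \<open>\<Lambda>\<^sub>n\<close> for at most \<open>min \<parallel>z\<parallel>\<^sub>\<infinity> N\<close> of the values \<open>n\<close>, so that \<open>N \<le> b \<chi>\<^sub>N \<Sum>\<^sub>z e\<^bsup>t\<cdot>z\<^esup> J\<^sub>z min \<parallel>z\<parallel>\<^sub>\<infinity> N\<close>, where
  \<open>\<chi>\<^sub>N\<close> is the sum over \<open>\<Lambda>\<^sub>N\<close> in the theorem (\<open>averaged_boundary_sum\<close>). The last factor is \<open>o(N)\<close>, because the tilted
  couplings are summable (\<open>tilted_coupling_summable\<close>); hence \<open>\<chi>\<^sub>N\<close> is unbounded, which yields the sequence
  and the divergence of the generating function. If \<open>\<psi>\<close> decays fast enough, then
  \<open>e\<^bsup>t\<cdot>z\<^esup> J\<^sub>z \<le> \<psi>(z)\<close> has a finite first moment, uniformly for \<open>t\<close> in the Wulff shape, and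
  \<open>\<chi>\<^sub>N\<close> grows linearly with a constant that depends on \<open>t\<close> only through \<open>b\<close>.

  Two facts about the random-cluster model carry the argument. Positive association
  (\<open>fk_positive_association\<close>) gives monotonicity in the volume, hence existence of the weak limit
  (\<open>fk_is_weak_limit\<close>) and the comparison of finite-volume with infinite-volume connection probabilities. The
  exact one-edge identity for cluster weight two (\<open>fk_two_insert\<close>), which is the Ising recursion for spin
  correlations, gives the Simon-Lieb inequality with the first factor computed in \<open>S\<close> alone; this is what
  makes \<open>\<phi>\<^sub>\<beta>(S)\<close> a continuous function of \<open>\<beta>\<close>.
\<close>

section \<open>Connections and clusters\<close>

lemma linked_refl [simp]: "linked S \<omega> x x"
  by (simp add: linked_def)

lemma linked_trans: "linked S \<omega> x y \<Longrightarrow> linked S \<omega> y z \<Longrightarrow> linked S \<omega> x z"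
  unfolding linked_def by (rule rtranclp_trans)

lemma linked_sym: "linked S \<omega> x y \<Longrightarrow> linked S \<omega> y x"
proof -
  have "symp (\<lambda>u v. u \<in> S \<and> v \<in> S \<and> u \<noteq> v \<and> \<omega> {u, v})"
    by (auto simp: symp_def insert_commute)
  then show "linked S \<omega> x y \<Longrightarrow> linked S \<omega> y x"
    unfolding linked_def by (meson symp_rtranclp sympD)
qed

lemma linked_commute: "linked S \<omega> x y \<longleftrightarrow> linked S \<omega> y x"
  using linked_sym by metis

lemma linked_left_cong: "linked S \<omega> x u \<Longrightarrow> linked S \<omega> x y \<longleftrightarrow> linked S \<omega> u y"
  using linked_trans linked_sym by metis

lemma linked_mono:
  assumes "linked S \<omega> x y" "S \<subseteq> T" "\<And>e. e \<in> edges S \<Longrightarrow> \<omega> e \<Longrightarrow> \<eta> e"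
  shows "linked T \<eta> x y"
  using assms(1) unfolding linked_def
  by (rule rtranclp_mono[THEN predicate2D, rotated]) (use assms(2,3) in \<open>auto simp: edges_def\<close>)

lemma linked_in_vertices:
  assumes "linked S \<omega> x y" "x \<noteq> y"
  shows "x \<in> S" "y \<in> S"
proof -
  show "x \<in> S" using assms unfolding linked_def by (metis (mono_tags, lifting) converse_rtranclpE)
  show "y \<in> S" using assms unfolding linked_def by (metis (mono_tags, lifting) rtranclp.cases)
qed

lemma linked_cong:
  assumes "\<And>e. e \<in> edges S \<Longrightarrow> \<omega> e = \<eta> e"
  shows "linked S \<omega> x y \<longleftrightarrow> linked S \<eta> x y"
  using linked_mono[of S \<omega> x y S \<eta>] linked_mono[of S \<eta> x y S \<omega>] assms by auto

lemma finite_edges [simp]: "finite V \<Longrightarrow> finite (edges V)"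
  by (rule finite_subset[of _ "Pow V"]) (auto simp: edges_def)

lemma edges_mono: "S \<subseteq> T \<Longrightarrow> edges S \<subseteq> edges T"
  by (auto simp: edges_def)

lemma edge_in_edges [simp]: "{u, v} \<in> edges V \<longleftrightarrow> u \<in> V \<and> v \<in> V \<and> u \<noteq> v"
  by (auto simp: edges_def doubleton_eq_iff)

lemma edgesE:
  assumes "e \<in> edges V"
  obtains u v where "e = {u, v}" "u \<in> V" "v \<in> V" "u \<noteq> v"
  using assms by (auto simp: edges_def)

text \<open>A configuration is handled below as the set of its open edges, because adding one edge and passing to
  a subset of the edges are then plain set operations.\<close>

definition joined :: "'v set \<Rightarrow> 'v set set \<Rightarrow> 'v \<Rightarrow> 'v \<Rightarrow> bool" where
  "joined V A = linked V (\<lambda>e. e \<in> A)"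

definition clusters :: "'v set \<Rightarrow> 'v set set \<Rightarrow> nat" where
  "clusters V A = num_clusters V (\<lambda>e. e \<in> A)"

lemma joined_refl [simp]: "joined V A x x"
  by (simp add: joined_def)

lemma joined_trans: "joined V A x y \<Longrightarrow> joined V A y z \<Longrightarrow> joined V A x z"
  unfolding joined_def by (rule linked_trans)

lemma joined_sym: "joined V A x y \<Longrightarrow> joined V A y x"
  unfolding joined_def by (rule linked_sym)

lemma joined_commute: "joined V A x y \<longleftrightarrow> joined V A y x"
  unfolding joined_def by (rule linked_commute)

lemma joined_left_cong: "joined V A x u \<Longrightarrow> joined V A x y \<longleftrightarrow> joined V A u y"
  unfolding joined_def by (rule linked_left_cong)

lemma joined_mono: "joined V A x y \<Longrightarrow> A \<subseteq> B \<Longrightarrow> V \<subseteq> W \<Longrightarrow> joined W B x y"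
  unfolding joined_def by (erule linked_mono) auto

text \<open>A path through the new edge can be taken to cross it once, so it splits into two old paths to the two
  endpoints.\<close>

lemma joined_insert:
  assumes "u \<in> V" "v \<in> V"
  shows "joined V (insert {u, v} A) x y \<longleftrightarrow>
    joined V A x y \<or> (joined V A x u \<and> joined V A v y) \<or> (joined V A x v \<and> joined V A u y)"
    (is "?L \<longleftrightarrow> ?R y")
proof
  note tr = joined_trans[of V A] and sy = joined_sym[of V A]
  assume ?L
  then show "?R y"
    unfolding joined_def[of V "insert {u, v} A"] linked_def[of V "\<lambda>e. e \<in> insert {u, v} A"]
  proof (induction rule: rtranclp_induct)
    case base
    then show ?case by simp
  next
    case (step y z)
    show ?case
    proof (cases "{y, z} \<in> A")
      case True
      then have "joined V A y z" using step.hyps(2) unfolding joined_def linked_def by auto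
      then show ?thesis using step.IH tr[of x y z] tr[of v y z] tr[of u y z] by blast
    next
      case False
      then have "{y, z} = {u, v}" using step.hyps(2) by auto
      then have "(y = u \<and> z = v) \<or> (y = v \<and> z = u)" by (auto simp: doubleton_eq_iff)
      then show ?thesis using step.IH joined_refl[of V A] tr[of x u v] tr[of x v u] sy[of u v] sy[of v u]
        by (elim disjE conjE) simp_all
    qed
  qed
next
  assume R: "?R y"
  have m: "joined V (insert {u, v} A) a b" if "joined V A a b" for a b
    using that by (rule joined_mono) auto
  have e: "joined V (insert {u, v} A) u v"
  proof (cases "u = v")
    case False
    then show ?thesis unfolding joined_def linked_def using assms by auto
  qed simp
  note tr = joined_trans[of V "insert {u, v} A"]
    and sy = joined_sym[of V "insert {u, v} A"]
  from R consider "joined V A x y" | "joined V A x u" "joined V A v y" | "joined V A x v" "joined V A u y"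
    by blast
  then show ?L
  proof cases
    case 1
    then show ?thesis by (rule m)
  next
    case 2
    then show ?thesis using tr[OF m[OF 2(1)] tr[OF e m[OF 2(2)]]] by simp
  next
    case 3
    then show ?thesis using tr[OF m[OF 3(1)] tr[OF sy[OF e] m[OF 3(2)]]] by simp
  qed
qed

lemma num_clusters_eq: "num_clusters V \<omega> = card ((\<lambda>x. {y\<in>V. linked V \<omega> x y}) ` V)"
proof -
  have "V // {(x, y). x \<in> V \<and> y \<in> V \<and> linked V \<omega> x y} = (\<lambda>x. {y\<in>V. linked V \<omega> x y}) ` V"
    by (auto simp: quotient_def Image_def)
  then show ?thesis by (simp add: num_clusters_def)
qed

lemma num_clusters_cong:
  assumes "\<And>e. e \<in> edges V \<Longrightarrow> \<omega> e = \<eta> e"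
  shows "num_clusters V \<omega> = num_clusters V \<eta>"
  unfolding num_clusters_eq using linked_cong[of V \<omega> \<eta>] assms by simp

lemma clusters_eq: "clusters V A = card ((\<lambda>x. {y\<in>V. joined V A x y}) ` V)"
  unfolding clusters_def num_clusters_eq joined_def ..

text \<open>A new edge merges two clusters exactly when its endpoints were not already connected. This is the only
  property of the factor \<open>2 ^ clusters\<close> that positive association uses.\<close>

lemma clusters_insert:
  assumes "finite V" "u \<in> V" "v \<in> V"
  shows "clusters V A = clusters V (insert {u, v} A) + (if joined V A u v then 0 else 1)"
proof (cases "joined V A u v")
  case True
  then have "joined V (insert {u, v} A) x y \<longleftrightarrow> joined V A x y" for x y
    using joined_insert[OF assms(2,3), of A x y] joined_left_cong[OF True, of x]
      joined_left_cong[of V _ x u y] joined_left_cong[of V _ x v y]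
      joined_left_cong[OF True, of y] joined_commute[of V A x]
    by (metis True)
  then show ?thesis using True by (simp add: clusters_eq)
next
  case False
  define C where "C x = {y\<in>V. joined V A x y}" for x
  define C' where "C' x = {y\<in>V. joined V (insert {u, v} A) x y}" for x
  have C': "C' x = (if joined V A x u \<or> joined V A x v then C u \<union> C v else C x)" for x
  proof -
    have "(joined V A x y \<or> (joined V A x u \<and> joined V A v y) \<or> (joined V A x v \<and> joined V A u y)) \<longleftrightarrow>
      (if joined V A x u \<or> joined V A x v then joined V A u y \<or> joined V A v y else joined V A x y)" for y
      using joined_left_cong[of V A x u y] joined_left_cong[of V A x v y]
      by (cases "joined V A x u"; cases "joined V A x v") (simp_all add: disj_commute)
    then show ?thesis
      unfolding C_def C'_def using joined_insert[OF assms(2,3), of A x] by auto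
  qed
  have Ceq: "C x = C y \<longleftrightarrow> joined V A x y" if "x \<in> V" "y \<in> V" for x y
  proof
    assume "C x = C y"
    moreover have "y \<in> C y" unfolding C_def using that by simp
    ultimately show "joined V A x y" unfolding C_def by blast
  next
    assume "joined V A x y"
    then have "joined V A x z \<longleftrightarrow> joined V A y z" for z
      by (rule joined_left_cong)
    then show "C x = C y" unfolding C_def by auto
  qed
  have ne: "C u \<union> C v \<noteq> C x" if "x \<in> V" for x
  proof
    assume "C u \<union> C v = C x"
    moreover have "u \<in> C u" "v \<in> C v" unfolding C_def using assms by simp_all
    ultimately have "u \<in> C x" "v \<in> C x" by blast+
    then have "joined V A u x" "joined V A x v" unfolding C_def by (simp_all add: joined_sym)
    then show False using False joined_trans[of V _ u x v] by blast
  qed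
  have img: "C' ` V = insert (C u \<union> C v) (C ` V - {C u, C v})"
  proof (intro set_eqI iffI)
    fix X assume "X \<in> C' ` V"
    then obtain x where x: "x \<in> V" "X = C' x" by blast
    show "X \<in> insert (C u \<union> C v) (C ` V - {C u, C v})"
    proof (cases "joined V A x u \<or> joined V A x v")
      case True
      then show ?thesis using x C'[of x] by simp
    next
      case False
      then show ?thesis
        using x C'[of x] Ceq[OF x(1) assms(2)] Ceq[OF x(1) assms(3)] by simp
    qed
  next
    fix X assume "X \<in> insert (C u \<union> C v) (C ` V - {C u, C v})"
    then consider "X = C u \<union> C v" | x where "x \<in> V" "X = C x" "C x \<noteq> C u" "C x \<noteq> C v" by auto
    then show "X \<in> C' ` V"
    proof cases
      case 1
      then have "X = C' u" using C'[of u] by simp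
      then show ?thesis using assms by blast
    next
      case 2
      then have "X = C' x"
        using C'[of x] Ceq[OF 2(1) assms(2)] Ceq[OF 2(1) assms(3)] by simp
      then show ?thesis using 2 by blast
    qed
  qed
  have "C u \<noteq> C v" using Ceq[OF assms(2,3)] False by simp
  then have c2: "card {C u, C v} = 2" by simp
  have sub: "{C u, C v} \<subseteq> C ` V" using assms by auto
  have "card (C ` V - {C u, C v}) + 2 = card (C ` V)"
    using card_Diff_subset[OF _ sub] card_mono[OF _ sub] c2 assms(1) by simp
  moreover have "card (C' ` V) = Suc (card (C ` V - {C u, C v}))"
    unfolding img using assms ne by (subst card_insert_disjoint) auto
  ultimately show ?thesis using False by (simp add: clusters_eq C_def[abs_def] C'_def[abs_def])
qed

section \<open>Positive association\<close>

text \<open>The unnormalised random-cluster sum over configurations \<open>A \<subseteq> E\<close>. The edges in \<open>D\<close> are kept open: they count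
  for the number of clusters, but carry no weight. They encode the conditioning on open edges in the
  inductions over \<open>E\<close>.\<close>

definition fk_sum :: "'v set \<Rightarrow> ('v set \<Rightarrow> real) \<Rightarrow> 'v set set \<Rightarrow> 'v set set \<Rightarrow> ('v set set \<Rightarrow> real) \<Rightarrow> real"
  where "fk_sum V w D E f = (\<Sum>A\<in>Pow E. 2 ^ clusters V (A \<union> D) * (\<Prod>e\<in>A. w e) * f A)"

text \<open>The two terms are the configurations in which \<open>e\<close> is closed and those in which it is open.\<close>

lemma fk_sum_insert:
  assumes "finite E" "e \<notin> E"
  shows "fk_sum V w D (insert e E) f =
    fk_sum V w D E f + w e * fk_sum V w (insert e D) E (\<lambda>A. f (insert e A))"
proof -
  have "fk_sum V w D (insert e E) f = fk_sum V w D E f +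
      (\<Sum>A\<in>insert e ` Pow E. 2 ^ clusters V (A \<union> D) * (\<Prod>e\<in>A. w e) * f A)"
    unfolding fk_sum_def Pow_insert using assms by (subst sum.union_disjoint) auto
  also have "(\<Sum>A\<in>insert e ` Pow E. 2 ^ clusters V (A \<union> D) * (\<Prod>e\<in>A. w e) * f A) =
      (\<Sum>A\<in>Pow E. 2 ^ clusters V (insert e A \<union> D) * (\<Prod>e\<in>insert e A. w e) * f (insert e A))"
    using assms(2) by (subst sum.reindex) (auto simp: inj_on_def)
  also have "\<dots> = (\<Sum>A\<in>Pow E. w e * (2 ^ clusters V (A \<union> insert e D) * (\<Prod>e\<in>A. w e) * f (insert e A)))"
  proof (intro sum.cong refl)
    fix A assume "A \<in> Pow E"
    then have "finite A" "e \<notin> A" using assms finite_subset by auto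
    then show "2 ^ clusters V (insert e A \<union> D) * (\<Prod>e\<in>insert e A. w e) * f (insert e A) =
      w e * (2 ^ clusters V (A \<union> insert e D) * (\<Prod>e\<in>A. w e) * f (insert e A))"
      by simp
  qed
  finally show ?thesis by (simp add: fk_sum_def sum_distrib_left)
qed

text \<open>Keeping \<open>{u, v}\<close> open amounts to tilting the measure by a function that is increasing in the
  configuration: connecting \<open>u\<close> and \<open>v\<close> saves the factor \<open>1 / 2\<close> for the lost cluster.\<close>

lemma fk_sum_wire:
  assumes "finite V" "u \<in> V" "v \<in> V"
  shows "fk_sum V w (insert {u, v} D) E f =
    fk_sum V w D E (\<lambda>A. f A * (if joined V (A \<union> D) u v then 1 else 1 / 2))"
proof -
  have "(2::real) ^ clusters V (A \<union> insert {u, v} D) =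
      2 ^ clusters V (A \<union> D) * (if joined V (A \<union> D) u v then 1 else 1 / 2)" for A
    unfolding clusters_insert[OF assms, of "A \<union> D"] by simp
  then show ?thesis unfolding fk_sum_def by (intro sum.cong refl) simp
qed

lemma fk_sum_add: "fk_sum V w D E (\<lambda>A. f A + g A) = fk_sum V w D E f + fk_sum V w D E g"
  by (simp add: fk_sum_def sum.distrib distrib_left)

lemma fk_sum_cmult: "fk_sum V w D E (\<lambda>A. c * f A) = c * fk_sum V w D E f"
  by (simp add: fk_sum_def sum_distrib_left mult_ac)

lemma fk_sum_cong: "(\<And>A. A \<subseteq> E \<Longrightarrow> f A = g A) \<Longrightarrow> fk_sum V w D E f = fk_sum V w D E g"
  by (auto simp: fk_sum_def)

lemma fk_sum_mono:
  assumes "\<And>e. e \<in> E \<Longrightarrow> 0 \<le> w e" "\<And>A. A \<subseteq> E \<Longrightarrow> f A \<le> g A"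
  shows "fk_sum V w D E f \<le> fk_sum V w D E g"
  unfolding fk_sum_def using assms
  by (intro sum_mono mult_left_mono) (auto intro!: mult_nonneg_nonneg prod_nonneg)

lemma fk_sum_pos:
  assumes "finite E" "\<And>e. e \<in> E \<Longrightarrow> 0 \<le> w e"
  shows "0 < fk_sum V w D E (\<lambda>_. 1)"
proof -
  have "0 < (2::real) ^ clusters V ({} \<union> D) * (\<Prod>e\<in>{}. w e) * 1" by simp
  also have "\<dots> \<le> fk_sum V w D E (\<lambda>_. 1)"
    unfolding fk_sum_def using assms
    by (intro member_le_sum) (auto intro!: mult_nonneg_nonneg prod_nonneg)
  finally show ?thesis .
qed

lemma mono_on_PowD: "mono_on (Pow E) f \<Longrightarrow> A \<subseteq> B \<Longrightarrow> B \<subseteq> E \<Longrightarrow> f A \<le> f B"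
  by (auto simp: mono_on_def)

lemma mono_on_PowI: "(\<And>A B. A \<subseteq> B \<Longrightarrow> B \<subseteq> E \<Longrightarrow> f A \<le> f B) \<Longrightarrow> mono_on (Pow E) f"
  by (auto simp: mono_on_def)

text \<open>The conditional mean of an increasing function is larger if \<open>{u, v}\<close> is open than if it is closed. Opening
  the edge raises \<open>f\<close> pointwise, and the remaining change of measure is a tilt by an increasing
  function, so positive association on \<open>E\<close> (assumption \<open>pa\<close>) applies.\<close>

lemma opening_edge_raises_mean:
  assumes "finite V" "u \<in> V" "v \<in> V" "\<And>e. e \<in> E \<Longrightarrow> 0 \<le> w e"
    and f: "mono_on (Pow (insert {u, v} E)) f"
    and pa: "\<And>g. mono_on (Pow E) g \<Longrightarrow>
      fk_sum V w D E f * fk_sum V w D E g \<le> fk_sum V w D E (\<lambda>_. 1) * fk_sum V w D E (\<lambda>A. f A * g A)"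
  shows "fk_sum V w D E f * fk_sum V w (insert {u, v} D) E (\<lambda>_. 1) \<le>
    fk_sum V w (insert {u, v} D) E (\<lambda>A. f (insert {u, v} A)) * fk_sum V w D E (\<lambda>_. 1)"
proof -
  define h :: "'a set set \<Rightarrow> real" where "h A = (if joined V (A \<union> D) u v then 1 else 1 / 2)" for A
  have h: "mono_on (Pow E) h"
  proof (rule mono_on_PowI)
    fix A B :: "'a set set" assume "A \<subseteq> B"
    then have "joined V (A \<union> D) u v \<Longrightarrow> joined V (B \<union> D) u v"
      by (rule_tac joined_mono) auto
    then show "h A \<le> h B" by (auto simp: h_def)
  qed
  have wire: "fk_sum V w (insert {u, v} D) E g = fk_sum V w D E (\<lambda>A. g A * h A)" for g
    unfolding h_def by (rule fk_sum_wire) fact+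
  have "fk_sum V w D E f * fk_sum V w (insert {u, v} D) E (\<lambda>_. 1) = fk_sum V w D E f * fk_sum V w D E h"
    by (simp add: wire)
  also have "\<dots> \<le> fk_sum V w D E (\<lambda>_. 1) * fk_sum V w D E (\<lambda>A. f A * h A)"
    by (rule pa[OF h])
  also have "\<dots> \<le> fk_sum V w D E (\<lambda>_. 1) * fk_sum V w D E (\<lambda>A. f (insert {u, v} A) * h A)"
  proof (rule mult_left_mono)
    show "fk_sum V w D E (\<lambda>A. f A * h A) \<le> fk_sum V w D E (\<lambda>A. f (insert {u, v} A) * h A)"
      by (intro fk_sum_mono assms mult_right_mono mono_on_PowD[OF f]) (auto simp: h_def)
    show "0 \<le> fk_sum V w D E (\<lambda>_. 1)"
      using fk_sum_mono[of E w "\<lambda>_. 0" "\<lambda>_. 1"] assms(4) by (simp add: fk_sum_def)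
  qed
  finally show ?thesis by (simp add: wire mult_ac)
qed

text \<open>The FKG inequality, by induction on the edges and simultaneously for all sets \<open>D\<close> of wired edges.
  Conditionally on the state of the edge \<open>e\<close>, the functions \<open>f\<close> and \<open>g\<close> are positively correlated by
  induction; their two conditional means increase together when \<open>e\<close> opens, so the
  covariance of the conditional means is non-negative as well.\<close>

lemma fk_positive_association:
  fixes w :: "'v set \<Rightarrow> real"
  assumes "finite E" "finite V" "E \<subseteq> edges V" "\<And>e. e \<in> E \<Longrightarrow> 0 \<le> w e"
    and "mono_on (Pow E) f" "mono_on (Pow E) g"
  shows "fk_sum V w D E f * fk_sum V w D E g \<le> fk_sum V w D E (\<lambda>_. 1) * fk_sum V w D E (\<lambda>A. f A * g A)"
  using assms(1,3-)
proof (induction E arbitrary: D f g rule: finite_induct)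
  case empty
  then show ?case by (simp add: fk_sum_def mult_ac)
next
  case (insert e E)
  obtain u v where e: "e = {u, v}" "u \<in> V" "v \<in> V" using insert.prems(1) by (auto elim: edgesE)
  have E: "E \<subseteq> edges V" "\<And>e. e \<in> E \<Longrightarrow> 0 \<le> w e" and we: "0 \<le> w e" using insert.prems by auto
  have sub: "mono_on (Pow E) k" "mono_on (Pow E) (\<lambda>A. k (insert e A))"
    if "mono_on (Pow (insert e E)) k" for k :: "'v set set \<Rightarrow> real"
    by (rule mono_on_PowI; use mono_on_PowD[OF that] in \<open>simp add: insert_mono subset_insertI2\<close>)+
  define p q f0 f1 g0 g1 a b where
    "p = fk_sum V w D E (\<lambda>_. 1)" and "q = fk_sum V w (insert e D) E (\<lambda>_. 1)" and
    "f0 = fk_sum V w D E f" and "f1 = fk_sum V w (insert e D) E (\<lambda>A. f (insert e A))" and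
    "g0 = fk_sum V w D E g" and "g1 = fk_sum V w (insert e D) E (\<lambda>A. g (insert e A))" and
    "a = fk_sum V w D E (\<lambda>A. f A * g A)" and
    "b = fk_sum V w (insert e D) E (\<lambda>A. f (insert e A) * g (insert e A))"
  note defs = p_def q_def f0_def f1_def g0_def g1_def a_def b_def
  have pos: "0 < p" "0 < q" unfolding defs using fk_sum_pos insert.hyps E by metis+
  have closed_open: "f0 * g0 \<le> p * a" "f1 * g1 \<le> q * b"
    unfolding defs
    using insert.IH[OF E sub(1)[OF insert.prems(3)] sub(1)[OF insert.prems(4)], of D]
      insert.IH[OF E sub(2)[OF insert.prems(3)] sub(2)[OF insert.prems(4)], of "insert e D"]
    by auto
  \<comment> \<open>The conditional means are \<open>f0 / p\<close> when \<open>e\<close> is closed and \<open>f1 / q\<close> when it is open, so this says that opening \<open>e\<close> raises the mean of \<open>f\<close>.\<close>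
  have "f0 * q \<le> f1 * p"
    unfolding defs e
    by (rule opening_edge_raises_mean) (use e assms E insert sub in auto)
  moreover have "g0 * q \<le> g1 * p"
    unfolding defs e
    by (rule opening_edge_raises_mean) (use e assms E insert sub in auto)
  ultimately have "0 \<le> (f1 * p - f0 * q) * (g1 * p - g0 * q)" by simp
  then have "0 \<le> f1 * g1 * p\<^sup>2 + f0 * g0 * q\<^sup>2 - (p * q) * (f0 * g1 + f1 * g0)"
    by (simp add: algebra_simps power2_eq_square)
  also have "\<dots> \<le> (q * b) * p\<^sup>2 + (p * a) * q\<^sup>2 - (p * q) * (f0 * g1 + f1 * g0)"
    using closed_open by (intro diff_mono add_mono mult_right_mono order_refl) auto
  also have "\<dots> = (p * q) * ((b * p + a * q) - (f0 * g1 + f1 * g0))"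
    by (simp add: algebra_simps power2_eq_square)
  finally have cross: "f0 * g1 + f1 * g0 \<le> b * p + a * q"
    using mult_pos_pos[OF pos] by (simp add: zero_le_mult_iff)
  have "(f0 + w e * f1) * (g0 + w e * g1) = f0 * g0 + w e * (f0 * g1 + f1 * g0) + (w e)\<^sup>2 * (f1 * g1)"
    by (simp add: algebra_simps power2_eq_square)
  also have "\<dots> \<le> p * a + w e * (b * p + a * q) + (w e)\<^sup>2 * (q * b)"
    using add_mono[OF add_mono[OF closed_open(1) mult_left_mono[OF cross we]]
        mult_left_mono[OF closed_open(2), of "(w e)\<^sup>2"]] by simp
  also have "\<dots> = (p + w e * q) * (a + w e * b)"
    by (simp add: algebra_simps power2_eq_square)
  finally show ?case
    unfolding fk_sum_insert[OF insert.hyps] defs .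
qed

definition fk_mean :: "'v set \<Rightarrow> ('v set \<Rightarrow> real) \<Rightarrow> 'v set set \<Rightarrow> ('v set set \<Rightarrow> real) \<Rightarrow> real" where
  "fk_mean V w E f = fk_sum V w {} E f / fk_sum V w {} E (\<lambda>_. 1)"

lemma fk_mean_mono:
  assumes "\<And>e. e \<in> E \<Longrightarrow> 0 \<le> w e" "\<And>A. A \<subseteq> E \<Longrightarrow> f A \<le> g A"
  shows "fk_mean V w E f \<le> fk_mean V w E g"
  unfolding fk_mean_def
  using fk_sum_mono[of E w "\<lambda>_. 0" "\<lambda>_. 1" V "{}"] fk_sum_mono[of E w f g V "{}"] assms
  by (intro divide_right_mono) (auto simp: fk_sum_def)

lemma fk_mean_const:
  assumes "finite E" "\<And>e. e \<in> E \<Longrightarrow> 0 \<le> w e"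
  shows "fk_mean V w E (\<lambda>_. c) = c"
  using fk_sum_pos[of E w V "{}"] assms fk_sum_cmult[of V w "{}" E c "\<lambda>_. 1"] by (simp add: fk_mean_def)

lemma fk_mean_add: "fk_mean V w E (\<lambda>A. f A + g A) = fk_mean V w E f + fk_mean V w E g"
  by (simp add: fk_mean_def fk_sum_add add_divide_distrib)

lemma fk_mean_cmult: "fk_mean V w E (\<lambda>A. c * f A) = c * fk_mean V w E f"
  by (simp add: fk_mean_def fk_sum_cmult)

lemma fk_mean_diff: "fk_mean V w E (\<lambda>A. f A - g A) = fk_mean V w E f - fk_mean V w E g"
  using fk_mean_add[of V w E f "\<lambda>A. -1 * g A"] fk_mean_cmult[of V w E "-1" g] by simp

lemma fk_mean_cong: "(\<And>A. A \<subseteq> E \<Longrightarrow> f A = g A) \<Longrightarrow> fk_mean V w E f = fk_mean V w E g"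
  unfolding fk_mean_def by (metis fk_sum_cong)

lemma fk_mean_le_insert:
  assumes "finite V" "u \<in> V" "v \<in> V" "{u, v} \<notin> E" "E \<subseteq> edges V" "u \<noteq> v"
    and w: "\<And>e. e \<in> insert {u, v} E \<Longrightarrow> 0 \<le> w e" and f: "mono_on (Pow (insert {u, v} E)) f"
  shows "fk_mean V w E f \<le> fk_mean V w (insert {u, v} E) f"
proof -
  have fin: "finite E" using assms finite_edges finite_subset by metis
  have f': "mono_on (Pow E) f" using f by (rule mono_on_subset) auto
  define p q f0 f1 where
    "p = fk_sum V w {} E (\<lambda>_. 1)" and "q = fk_sum V w {{u, v}} E (\<lambda>_. 1)" and
    "f0 = fk_sum V w {} E f" and "f1 = fk_sum V w {{u, v}} E (\<lambda>A. f (insert {u, v} A))"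
  note defs = p_def q_def f0_def f1_def
  have pos: "0 < p" "0 < q" unfolding defs using fk_sum_pos[OF fin] w by (metis insertCI)+
  have we: "0 \<le> w {u, v}" using w by simp
  have "f0 * q \<le> f1 * p"
    unfolding defs
    by (rule opening_edge_raises_mean)
      (use assms f' fk_positive_association[OF fin assms(1,5)] in auto)
  then have "f0 * (p + w {u, v} * q) \<le> (f0 + w {u, v} * f1) * p"
    using mult_left_mono[OF _ we, of "f0 * q" "f1 * p"] by (simp add: algebra_simps)
  then show ?thesis
    unfolding fk_mean_def fk_sum_insert[OF fin assms(4)] defs[symmetric]
    using pos we by (simp add: frac_le_eq divide_le_eq pos_le_divide_eq field_simps add_pos_nonneg)
qed

text \<open>Making more edges available stochastically increases the configuration: a closed edge that becomes
  available turns the mean into an average of the old mean and of a larger one.\<close>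

lemma fk_mean_mono_edges:
  assumes "finite V" "E \<subseteq> E'" "E' \<subseteq> edges V" "\<And>e. e \<in> E' \<Longrightarrow> 0 \<le> w e" "mono_on (Pow E') f"
  shows "fk_mean V w E f \<le> fk_mean V w E' f"
proof -
  have "fk_mean V w E f \<le> fk_mean V w (E \<union> X) f"
    if "finite X" "X \<inter> E = {}" "E \<union> X \<subseteq> E'" for X
    using that
  proof (induction X rule: finite_induct)
    case empty
    then show ?case by simp
  next
    case (insert e X)
    have "e \<in> edges V" using insert.prems assms(3) by auto
    then obtain u v where e: "e = {u, v}" "u \<in> V" "v \<in> V" "u \<noteq> v" by (rule edgesE)
    have "mono_on (Pow (insert e (E \<union> X))) f"
      using assms(5) by (rule mono_on_subset) (use insert.prems in auto)
    then have "fk_mean V w (E \<union> X) f \<le> fk_mean V w (insert e (E \<union> X)) f"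
      unfolding e(1) by (intro fk_mean_le_insert) (use e insert assms in auto)
    then show ?case using insert by simp
  qed
  from this[of "E' - E"] show ?thesis
    using assms finite_edges finite_subset by (metis Diff_disjoint Int_commute Un_Diff_cancel Un_absorb1 finite_Diff order_refl)
qed

section \<open>Isolated vertices and relabelling\<close>

lemma joined_enlarge_vertices:
  assumes "A \<subseteq> edges V" "V \<subseteq> W"
  shows "joined W A x y \<longleftrightarrow> joined V A x y"
proof -
  have "(\<lambda>u v. u \<in> W \<and> v \<in> W \<and> u \<noteq> v \<and> {u, v} \<in> A) = (\<lambda>u v. u \<in> V \<and> v \<in> V \<and> u \<noteq> v \<and> {u, v} \<in> A)"
    using assms edge_in_edges[of _ _ V] by (intro ext) blast
  then show ?thesis by (simp add: joined_def linked_def)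
qed

lemma joined_in_vertices: "joined V A x y \<Longrightarrow> x \<noteq> y \<Longrightarrow> x \<in> V \<and> y \<in> V"
  unfolding joined_def using linked_in_vertices by metis

lemma clusters_insert_vertex:
  assumes "finite V" "a \<notin> V" "A \<subseteq> edges V"
  shows "clusters (insert a V) A = Suc (clusters V A)"
proof -
  have j: "joined (insert a V) A x y \<longleftrightarrow> joined V A x y" for x y
    using joined_enlarge_vertices[OF assms(3)] by blast
  have isolated: "\<not> joined V A a y" "\<not> joined V A y a" if "y \<in> V" for y
    using joined_in_vertices[of V A] that assms(2) by metis+
  have "(\<lambda>x. {y \<in> insert a V. joined (insert a V) A x y}) ` insert a V =
      insert {a} ((\<lambda>x. {y \<in> V. joined V A x y}) ` V)"
    unfolding j image_insert
    by (intro arg_cong2[of _ _ _ _ insert] image_cong) (use isolated in auto)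
  moreover have "{a} \<notin> (\<lambda>x. {y \<in> V. joined V A x y}) ` V" using assms(2) by auto
  ultimately show ?thesis using assms(1) by (simp add: clusters_eq)
qed

text \<open>Isolated vertices multiply every weight by the same power of two.\<close>

lemma fk_mean_enlarge_vertices:
  assumes "finite W" "V \<subseteq> W" "E \<subseteq> edges V"
  shows "fk_mean W w E f = fk_mean V w E f"
proof -
  have "clusters (V \<union> X) A = clusters V A + card X"
    if "A \<subseteq> edges V" "finite X" "X \<inter> V = {}" for A X
    using that(2,3)
  proof (induction X rule: finite_induct)
    case empty
    then show ?case by simp
  next
    case (insert a X)
    have "A \<subseteq> edges (V \<union> X)" using that(1) edges_mono[of V "V \<union> X"] by auto
    then have "clusters (insert a (V \<union> X)) A = Suc (clusters (V \<union> X) A)"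
      using insert assms finite_subset by (intro clusters_insert_vertex) auto
    then show ?case using insert by simp
  qed
  from this[of _ "W - V"] have "clusters W A = clusters V A + card (W - V)" if "A \<subseteq> E" for A
    using assms that by (auto simp: Un_absorb1)
  then have "fk_sum W w {} E g = 2 ^ card (W - V) * fk_sum V w {} E g" for g
    unfolding fk_sum_def sum_distrib_left by (intro sum.cong) (auto simp: power_add)
  then show ?thesis by (simp add: fk_mean_def)
qed

lemma joined_image:
  assumes "inj \<pi>"
  shows "joined (\<pi> ` V) ((`) \<pi> ` A) (\<pi> x) (\<pi> y) \<longleftrightarrow> joined V A x y"
proof -
  have edge: "{\<pi> u, \<pi> v} \<in> (`) \<pi> ` A \<longleftrightarrow> {u, v} \<in> A" for u v
  proof -
    have "inj ((`) \<pi>)" using assms by (simp add: inj_on_def inj_image_eq_iff)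
    from inj_image_mem_iff[OF this, of "{u, v}" A] show ?thesis by simp
  qed
  show ?thesis
  proof
    assume "joined V A x y"
    then show "joined (\<pi> ` V) ((`) \<pi> ` A) (\<pi> x) (\<pi> y)"
      unfolding joined_def linked_def
    proof (induction rule: rtranclp_induct)
      case (step u v)
      then have "\<pi> u \<in> \<pi> ` V \<and> \<pi> v \<in> \<pi> ` V \<and> \<pi> u \<noteq> \<pi> v \<and> {\<pi> u, \<pi> v} \<in> (`) \<pi> ` A"
        using edge assms by (auto dest: injD)
      then show ?case by (rule rtranclp.rtrancl_into_rtrancl[OF step.IH])
    qed simp
  next
    assume "joined (\<pi> ` V) ((`) \<pi> ` A) (\<pi> x) (\<pi> y)"
    then have "\<exists>z. \<pi> y = \<pi> z \<and> joined V A x z"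
      unfolding joined_def[of "\<pi> ` V"] linked_def[of "\<pi> ` V"]
    proof (induction rule: rtranclp_induct)
      case base
      show ?case by (rule exI[of _ x]) simp
    next
      case (step u v)
      then obtain a b where ab: "u = \<pi> a" "joined V A x a" "v = \<pi> b" "b \<in> V" by blast
      then have "a \<in> V" "a \<noteq> b" "{a, b} \<in> A" using step.hyps edge assms by (auto dest: injD)
      then have "joined V A a b" using ab unfolding joined_def linked_def by auto
      then show ?case using ab joined_trans by metis
    qed
    then show "joined V A x y" using assms by (auto dest: injD)
  qed
qed

lemma clusters_image:
  assumes "inj \<pi>"
  shows "clusters (\<pi> ` V) ((`) \<pi> ` A) = clusters V A"
proof -
  have "{y \<in> \<pi> ` V. joined (\<pi> ` V) ((`) \<pi> ` A) (\<pi> x) y} = \<pi> ` {y \<in> V. joined V A x y}" for x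
    using joined_image[OF assms] by auto
  then have "(\<lambda>x. {y \<in> \<pi> ` V. joined (\<pi> ` V) ((`) \<pi> ` A) x y}) ` \<pi> ` V =
      (`) \<pi> ` (\<lambda>x. {y \<in> V. joined V A x y}) ` V"
    by (simp add: image_image)
  then show ?thesis
    unfolding clusters_eq by (simp add: card_image inj_on_def inj_image_eq_iff[OF assms])
qed

lemma fk_mean_image:
  assumes "inj \<pi>" "\<And>e. e \<in> E \<Longrightarrow> w (\<pi> ` e) = w e"
  shows "fk_mean (\<pi> ` V) w ((`) \<pi> ` E) f = fk_mean V w E (\<lambda>A. f ((`) \<pi> ` A))"
proof -
  have inj: "inj ((`) \<pi>)" "inj ((`) ((`) \<pi>))"
    using assms(1) by (simp_all add: inj_on_def inj_image_eq_iff)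
  have "fk_sum (\<pi> ` V) w {} ((`) \<pi> ` E) g = fk_sum V w {} E (\<lambda>A. g ((`) \<pi> ` A))" for g
  proof -
    have "Pow ((`) \<pi> ` E) = (`) ((`) \<pi>) ` Pow E" by (simp add: image_Pow_surj)
    then have "fk_sum (\<pi> ` V) w {} ((`) \<pi> ` E) g =
        (\<Sum>A\<in>Pow E. 2 ^ clusters (\<pi> ` V) ((`) \<pi> ` A) * (\<Prod>e\<in>(`) \<pi> ` A. w e) * g ((`) \<pi> ` A))"
      unfolding fk_sum_def
      by (simp add: sum.reindex[OF inj_on_subset[OF inj(2) subset_UNIV]])
    also have "\<dots> = (\<Sum>A\<in>Pow E. 2 ^ clusters V A * (\<Prod>e\<in>A. w e) * g ((`) \<pi> ` A))"
    proof (intro sum.cong refl)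
      fix A assume "A \<in> Pow E"
      then have "(\<Prod>e\<in>(`) \<pi> ` A. w e) = (\<Prod>e\<in>A. w e)"
        using assms(2) by (subst prod.reindex[OF inj_on_subset[OF inj(1) subset_UNIV]]) (auto intro: prod.cong)
      then show "2 ^ clusters (\<pi> ` V) ((`) \<pi> ` A) * (\<Prod>e\<in>(`) \<pi> ` A. w e) * g ((`) \<pi> ` A) =
          2 ^ clusters V A * (\<Prod>e\<in>A. w e) * g ((`) \<pi> ` A)"
        by (simp add: clusters_image[OF assms(1)])
    qed
    finally show ?thesis by (simp add: fk_sum_def)
  qed
  then show ?thesis by (simp add: fk_mean_def)
qed

section \<open>The Simon-Lieb inequality\<close>

definition fk_two :: "'v set \<Rightarrow> ('v set \<Rightarrow> real) \<Rightarrow> 'v set set \<Rightarrow> 'v \<Rightarrow> 'v \<Rightarrow> real" where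
  "fk_two V w E x y = fk_mean V w E (\<lambda>A. of_bool (joined V A x y))"

lemma mono_on_joined: "mono_on (Pow E) (\<lambda>A. of_bool (joined V A x y) :: real)"
  using joined_mono by (intro mono_on_PowI) (fastforce simp: of_bool_def)

lemma fk_two_nonneg:
  assumes "finite E" "\<And>e. e \<in> E \<Longrightarrow> 0 \<le> w e"
  shows "0 \<le> fk_two V w E x y"
  using fk_mean_mono[of E w "\<lambda>_. 0" "\<lambda>A. of_bool (joined V A x y)" V] fk_mean_const[of E w V 0] assms
  by (simp add: fk_two_def)

lemma fk_two_le_1:
  assumes "finite E" "\<And>e. e \<in> E \<Longrightarrow> 0 \<le> w e"
  shows "fk_two V w E x y \<le> 1"
  using fk_mean_mono[of E w "\<lambda>A. of_bool (joined V A x y)" "\<lambda>_. 1" V] fk_mean_const[of E w V 1] assms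
  by (simp add: fk_two_def)

lemma fk_two_self:
  assumes "finite E" "\<And>e. e \<in> E \<Longrightarrow> 0 \<le> w e"
  shows "fk_two V w E x x = 1"
  using fk_mean_const[of E w V 1] assms by (simp add: fk_two_def)

lemma fk_two_mono_edges:
  assumes "finite V" "E \<subseteq> E'" "E' \<subseteq> edges V" "\<And>e. e \<in> E' \<Longrightarrow> 0 \<le> w e"
  shows "fk_two V w E x y \<le> fk_two V w E' x y"
  unfolding fk_two_def by (rule fk_mean_mono_edges) (use assms mono_on_joined in auto)

lemma fk_two_enlarge_vertices:
  assumes "finite W" "V \<subseteq> W" "E \<subseteq> edges V"
  shows "fk_two W w E x y = fk_two V w E x y"
  unfolding fk_two_def fk_mean_enlarge_vertices[OF assms]
  using joined_enlarge_vertices[OF _ assms(2)] assms(3) by (intro fk_mean_cong) auto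

lemma fk_two_image:
  assumes "inj \<pi>" "\<And>e. e \<in> E \<Longrightarrow> w (\<pi> ` e) = w e"
  shows "fk_two (\<pi> ` V) w ((`) \<pi> ` E) (\<pi> x) (\<pi> y) = fk_two V w E x y"
  unfolding fk_two_def by (simp add: fk_mean_image assms joined_image)

text \<open>This identity is special to cluster weight two; it is the rule
  \<open>\<langle>\<sigma>\<^sub>u \<sigma>\<^sub>y\<rangle>' (1 + \<tau> \<langle>\<sigma>\<^sub>u \<sigma>\<^sub>v\<rangle>) = \<langle>\<sigma>\<^sub>u \<sigma>\<^sub>y\<rangle> + \<tau> \<langle>\<sigma>\<^sub>v \<sigma>\<^sub>y\<rangle>\<close> for adding a coupling with hyperbolic tangent \<open>\<tau>\<close> to an
  Ising model. In random-cluster terms: if \<open>u\<close> and \<open>v\<close> are not connected, opening \<open>{u, v}\<close>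
  costs a factor \<open>1 / 2\<close>, and this is exactly the factor that makes the contributions of
  \<open>u \<leftrightarrow> y\<close> and \<open>v \<leftrightarrow> y\<close> additive.\<close>

lemma fk_two_insert:
  assumes "finite V" "u \<in> V" "v \<in> V" "{u, v} \<notin> E" "E \<subseteq> edges V"
    and w: "\<And>e. e \<in> insert {u, v} E \<Longrightarrow> 0 \<le> w e"
  defines "\<tau> \<equiv> w {u, v} / (2 + w {u, v})"
  shows "fk_two V w (insert {u, v} E) u y * (1 + \<tau> * fk_two V w E u v) =
    fk_two V w E u y + \<tau> * fk_two V w E v y"
proof -
  have fin: "finite E" using assms finite_edges finite_subset by metis
  define c Z where "c = w {u, v}" and "Z = fk_sum V w {} E (\<lambda>_. 1)"
  have c: "0 \<le> c" using w by (simp add: c_def)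
  have Z: "0 < Z" unfolding Z_def using fin w by (intro fk_sum_pos) auto
  have two: "fk_sum V w {} E (\<lambda>A. of_bool (joined V A x y)) = Z * fk_two V w E x y" for x y
    using Z by (simp add: fk_two_def fk_mean_def Z_def)
  have wire: "fk_sum V w {{u, v}} E g =
      fk_sum V w {} E (\<lambda>A. g A * (if joined V A u v then 1 else 1 / 2))" for g
    using fk_sum_wire[OF assms(1-3), of w "{}" E g] by simp
  have half: "of_bool (joined V (insert {u, v} A) u y) * (if joined V A u v then 1 else 1 / 2) =
      1 / 2 * of_bool (joined V A u y) + 1 / 2 * (of_bool (joined V A v y) :: real)" for A
    using joined_insert[OF assms(2,3), of A u y] joined_left_cong[of V A u v y] joined_sym[of V A v y]
      joined_trans[of V A u y v]
    by (cases "joined V A u v"; cases "joined V A u y"; cases "joined V A v y") simp_all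
  have half1: "1 * (if joined V A u v then 1 else 1 / 2) =
      1 / 2 * 1 + 1 / 2 * (of_bool (joined V A u v) :: real)" for A
    by simp
  have num: "fk_sum V w {} (insert {u, v} E) (\<lambda>A. of_bool (joined V A u y)) =
      Z * (fk_two V w E u y + c / 2 * (fk_two V w E u y + fk_two V w E v y))"
    unfolding fk_sum_insert[OF fin assms(4)] wire half fk_sum_add fk_sum_cmult two c_def
    by (simp add: algebra_simps)
  have den: "fk_sum V w {} (insert {u, v} E) (\<lambda>_. 1) = Z * (1 + c / 2 * (1 + fk_two V w E u v))"
    unfolding fk_sum_insert[OF fin assms(4)] wire half1 fk_sum_add fk_sum_cmult two c_def
    by (simp add: algebra_simps Z_def[symmetric] fk_sum_cmult[of V w "{}" E "1/2" "\<lambda>_. 1", simplified])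
  have p: "0 \<le> fk_two V w E u v" using fin w by (intro fk_two_nonneg) auto
  have "fk_two V w (insert {u, v} E) u y =
      (fk_two V w E u y + c / 2 * (fk_two V w E u y + fk_two V w E v y)) / (1 + c / 2 * (1 + fk_two V w E u v))"
    unfolding fk_two_def[of V w "insert {u, v} E"] fk_mean_def num den using Z by simp
  moreover have "0 < 1 + c / 2 * (1 + fk_two V w E u v)" using c p by (intro add_pos_nonneg) auto
  ultimately have "fk_two V w (insert {u, v} E) u y * (1 + c / 2 * (1 + fk_two V w E u v)) =
      fk_two V w E u y + c / 2 * (fk_two V w E u y + fk_two V w E v y)"
    by simp
  then show ?thesis
    using c unfolding \<tau>_def c_def[symmetric] by (simp add: divide_simps) (simp add: algebra_simps)
qed

text \<open>The Simon-Lieb inequality, with the connection inside \<open>S\<close> measured in the model on \<open>S\<close> alone. The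
  induction removes one edge at \<open>o'\<close> at a time with the help of the identity above. If the edge leaves
  \<open>S\<close>, it produces one new term of the right-hand side. If it stays inside \<open>S\<close>, the same identity holds
  in the model on \<open>S\<close>, and the normalising factor there is the smaller one by monotonicity in the
  edges.\<close>

lemma simon_lieb:
  fixes w :: "'v set \<Rightarrow> real"
  assumes "finite V" "E \<subseteq> edges V" "\<And>e. e \<in> E \<Longrightarrow> 0 \<le> w e" "S \<subseteq> V" "o' \<in> S" "y \<in> V - S"
  defines "\<tau> \<equiv> \<lambda>e. w e / (2 + w e)"
  shows "fk_two V w E o' y \<le> (\<Sum>x\<in>S. \<Sum>z\<in>V - S.
    fk_two V w (E \<inter> edges S) o' x * (of_bool ({x, z} \<in> E) * \<tau> {x, z}) * fk_two V w E z y)"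
proof -
  have "finite E" using assms finite_edges finite_subset by metis
  then show ?thesis using assms(2,3,5)
  proof (induction E arbitrary: o' rule: finite_psubset_induct)
    case (psubset E)
    let ?b = "\<lambda>E E' o'. \<Sum>x\<in>S. \<Sum>z\<in>V - S.
      fk_two V w (E \<inter> edges S) o' x * (of_bool ({x, z} \<in> E) * \<tau> {x, z}) * fk_two V w E' z y"
    have fin: "finite E" using psubset by simp
    have \<tau>0: "0 \<le> \<tau> e" if "e \<in> E" for e using psubset.prems(2)[OF that] by (simp add: \<tau>_def)
    have \<tau>0': "0 \<le> of_bool (e \<in> E) * \<tau> e" for e using \<tau>0 by auto
    show ?case
    proof (cases "\<exists>v. {o', v} \<in> E")
      case False
      have "\<not> joined V A o' y" if "A \<subseteq> E" for A
      proof
        assume "joined V A o' y"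
        then show False
          unfolding joined_def linked_def
          by (cases rule: converse_rtranclpE) (use False that assms psubset in auto)
      qed
      then have "fk_two V w E o' y = fk_mean V w E (\<lambda>_. 0)"
        unfolding fk_two_def by (intro fk_mean_cong) auto
      also have "\<dots> = 0" using fin psubset by (intro fk_mean_const) auto
      also have "0 \<le> ?b E E o'"
        using fin psubset.prems
          by (intro sum_nonneg mult_nonneg_nonneg[OF mult_nonneg_nonneg[OF _ \<tau>0']] fk_two_nonneg) auto
      finally show ?thesis .
    next
      case True
      then obtain v where e: "{o', v} \<in> E" by blast
      define E0 where "E0 = E - {{o', v}}"
      define t where "t = \<tau> {o', v}"
      have E: "E = insert {o', v} E0" "{o', v} \<notin> E0" "E0 \<subset> E" using e by (auto simp: E0_def)
      have "{o', v} \<in> edges V" using e psubset.prems by blast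
      then have V: "o' \<in> V" "v \<in> V" "o' \<noteq> v" by simp_all
      have E0: "E0 \<subseteq> edges V" "\<And>e. e \<in> E0 \<Longrightarrow> 0 \<le> w e" "finite E0"
        using E psubset.prems fin finite_subset by auto
      have t: "0 \<le> t" using \<tau>0 e by (simp add: t_def)
      have rec: "fk_two V w E o' y * (1 + t * fk_two V w E0 o' v) = fk_two V w E0 o' y + t * fk_two V w E0 v y"
        unfolding t_def \<tau>_def E(1)
        by (rule fk_two_insert) (use V E E0 psubset.prems assms in auto)
      have IH: "fk_two V w E0 a y \<le> ?b E0 E0 a" if "a \<in> S" for a
        using psubset.IH[OF E(3) E0(1,2) that] by simp
      have le: "fk_two V w E0 a y \<le> fk_two V w E a y" for a
        by (rule fk_two_mono_edges) (use E psubset.prems assms in auto)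
      have bE: "?b E0 E0 a \<le> ?b E0 E a" for a
      proof -
        have "0 \<le> of_bool (e \<in> E0) * \<tau> e" for e using \<tau>0 E by auto
        note nonneg = mult_nonneg_nonneg[OF _ this]
        show ?thesis
          using E0 by (intro sum_mono mult_left_mono le nonneg fk_two_nonneg) auto
      qed
      have p0: "0 \<le> fk_two V w E0 o' v" "0 \<le> fk_two V w E o' y"
        using E0 fin psubset.prems by (auto intro!: fk_two_nonneg)
      show ?thesis
      proof (cases "v \<in> S")
        case False
        \<comment> \<open>A crossing edge contributes the term \<open>x = o'\<close>, \<open>z = v\<close>; the factor \<open>1 + t p\<close> is simply dropped.\<close>
        have ES: "E0 \<inter> edges S = E \<inter> edges S" using False E by auto
        have "fk_two V w E o' y \<le> fk_two V w E o' y * (1 + t * fk_two V w E0 o' v)"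
          using p0 t by (simp add: algebra_simps)
        also have "\<dots> = fk_two V w E0 o' y + t * fk_two V w E0 v y" by (rule rec)
        also have "\<dots> \<le> ?b E0 E o' + t * fk_two V w E v y"
          using IH[OF psubset.prems(3)] bE[of o'] mult_left_mono[OF le t] by (intro add_mono) linarith+
        also have "t * fk_two V w E v y = (\<Sum>x\<in>S. \<Sum>z\<in>V - S.
            fk_two V w (E \<inter> edges S) o' x * (of_bool ({x, z} = {o', v}) * \<tau> {x, z}) * fk_two V w E z y)"
        proof -
          have "(\<Sum>x\<in>S. \<Sum>z\<in>V - S.
              fk_two V w (E \<inter> edges S) o' x * (of_bool ({x, z} = {o', v}) * \<tau> {x, z}) * fk_two V w E z y) =
            (\<Sum>x\<in>S. \<Sum>z\<in>V - S. if x = o' then if z = v then t * fk_two V w E v y else 0 else 0)"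
            using False psubset.prems(3) fk_two_self[of "E \<inter> edges S" w V o'] fin psubset.prems(2)
            by (intro sum.cong refl) (auto simp: doubleton_eq_iff t_def)
          also have "\<dots> = t * fk_two V w E v y"
          proof -
            have "(\<Sum>z\<in>V - S. if x = o' then if z = v then t * fk_two V w E v y else 0 else 0) =
                (if x = o' then t * fk_two V w E v y else 0)" for x
              using False V assms(1) by simp
            then show ?thesis using psubset.prems(3) finite_subset[OF assms(4,1)] by simp
          qed
          finally show ?thesis ..
        qed
        also have "?b E0 E o' + \<dots> = ?b E E o'"
          unfolding ES sum.distrib[symmetric]
          using E by (intro sum.cong refl) (auto simp: algebra_simps)
        finally show ?thesis .
      next
        case True
        \<comment> \<open>An edge inside \<open>S\<close> is removed from both models, and \<open>1 + t pS \<le> 1 + t p\<close> compares the two normalisations.\<close>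
        have ES: "E \<inter> edges S = insert {o', v} (E0 \<inter> edges S)" using True E psubset.prems V by auto
        define pS where "pS = fk_two V w (E0 \<inter> edges S) o' v"
        have pS: "0 \<le> pS" "pS \<le> fk_two V w E0 o' v"
          unfolding pS_def using E0 assms(1) by (auto intro!: fk_two_nonneg fk_two_mono_edges)
        have recS: "fk_two V w (E0 \<inter> edges S) o' x + t * fk_two V w (E0 \<inter> edges S) v x =
            (1 + t * pS) * fk_two V w (E \<inter> edges S) o' x" for x
          unfolding t_def \<tau>_def ES pS_def
          by (subst fk_two_insert[symmetric]) (use V E E0 psubset.prems assms in auto)
        have split: "(\<Sum>x\<in>S. \<Sum>z\<in>V - S. a x * c x z * q z) + t * (\<Sum>x\<in>S. \<Sum>z\<in>V - S. b x * c x z * q z) =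
            (\<Sum>x\<in>S. \<Sum>z\<in>V - S. (a x + t * b x) * c x z * q z)"
          for a b q :: "'v \<Rightarrow> real" and c :: "'v \<Rightarrow> 'v \<Rightarrow> real"
          by (simp add: sum_distrib_left sum.distrib distrib_right mult.assoc)
        have "fk_two V w E o' y * (1 + t * pS) \<le> fk_two V w E o' y * (1 + t * fk_two V w E0 o' v)"
          using p0 t pS by (intro mult_left_mono add_left_mono) auto
        also have "\<dots> = fk_two V w E0 o' y + t * fk_two V w E0 v y" by (rule rec)
        also have "\<dots> \<le> ?b E0 E o' + t * ?b E0 E v"
          using IH[OF psubset.prems(3)] IH[OF True] bE[of o'] bE[of v] t
          by (intro add_mono mult_left_mono) linarith+
        also have "\<dots> = (\<Sum>x\<in>S. \<Sum>z\<in>V - S.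
            (fk_two V w (E0 \<inter> edges S) o' x + t * fk_two V w (E0 \<inter> edges S) v x) *
            (of_bool ({x, z} \<in> E0) * \<tau> {x, z}) * fk_two V w E z y)"
          by (rule split)
        also have "\<dots> = (\<Sum>x\<in>S. \<Sum>z\<in>V - S. (1 + t * pS) *
            (fk_two V w (E \<inter> edges S) o' x * (of_bool ({x, z} \<in> E) * \<tau> {x, z}) * fk_two V w E z y))"
        proof (intro sum.cong refl)
          fix x z assume "x \<in> S" "z \<in> V - S"
          then have "{x, z} \<noteq> {o', v}" using True psubset.prems(3) by (auto simp: doubleton_eq_iff)
          then have mem: "{x, z} \<in> E0 \<longleftrightarrow> {x, z} \<in> E" by (simp add: E0_def)
          show "(fk_two V w (E0 \<inter> edges S) o' x + t * fk_two V w (E0 \<inter> edges S) v x) *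
              (of_bool ({x, z} \<in> E0) * \<tau> {x, z}) * fk_two V w E z y =
            (1 + t * pS) *
              (fk_two V w (E \<inter> edges S) o' x * (of_bool ({x, z} \<in> E) * \<tau> {x, z}) * fk_two V w E z y)"
            unfolding recS mem by simp
        qed
        also have "\<dots> = ?b E E o' * (1 + t * pS)" by (simp add: sum_distrib_left mult_ac)
        finally show ?thesis using t pS by (simp add: mult_le_cancel_right add_pos_nonneg)
      qed
    qed
  qed
qed

section \<open>A finite-volume criterion for a finite susceptibility\<close>

lemma edge_coupling_pair:
  assumes "\<And>x. J (- x) = J x"
  shows "edge_coupling J {i, j} = J (i - j)"
proof -
  have "J (j - i) = J (i - j)" using assms[of "i - j"] by simp
  then show ?thesis unfolding edge_coupling_def by (intro the_equality) (auto simp: doubleton_eq_iff)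
qed

definition edge_weight :: "(int ^ 'd \<Rightarrow> real) \<Rightarrow> real \<Rightarrow> (int ^ 'd) set \<Rightarrow> real" where
  "edge_weight J \<beta> e = exp (\<beta> * edge_coupling J e) - 1"

definition two_point :: "(int ^ 'd \<Rightarrow> real) \<Rightarrow> real \<Rightarrow> (int ^ 'd) set \<Rightarrow> int ^ 'd \<Rightarrow> int ^ 'd \<Rightarrow> real" where
  "two_point J \<beta> S = fk_two S (edge_weight J \<beta>) (edges S)"

definition tilt :: "real ^ 'd \<Rightarrow> int ^ 'd \<Rightarrow> real" where
  "tilt t x = exp (t \<bullet> rvec x)"

text \<open>The weight of all jumps that start at \<open>x\<close> and end outside \<open>S\<close>.\<close>

definition escape :: "(int ^ 'd \<Rightarrow> real) \<Rightarrow> real ^ 'd \<Rightarrow> (int ^ 'd) set \<Rightarrow> int ^ 'd \<Rightarrow> real" where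
  "escape J t S x = (\<Sum>\<^sub>\<infinity>z\<in>{z. x + z \<notin> S}. tilt t z * J z)"

text \<open>The quantity \<open>\<phi>\<^sub>\<beta>(S)\<close> of Duminil-Copin and Tassion, tilted by \<open>t\<close>: the expected weight of connections
  from the origin to \<open>x\<close> inside \<open>S\<close> followed by one jump out of \<open>S\<close>. The tilt is multiplicative, so
  it can be distributed over the pieces of a path.\<close>

definition boundary_sum :: "(int ^ 'd \<Rightarrow> real) \<Rightarrow> real ^ 'd \<Rightarrow> real \<Rightarrow> (int ^ 'd) set \<Rightarrow> real" where
  "boundary_sum J t \<beta> S = \<beta> * (\<Sum>x\<in>S. tilt t x * two_point J \<beta> S 0 x * escape J t S x)"

lemma rvec_add [simp]: "rvec (x + y) = rvec x + rvec y"
  by (simp add: rvec_def vec_eq_iff)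

lemma rvec_minus [simp]: "rvec (- x) = - rvec x"
  by (simp add: rvec_def vec_eq_iff)

lemma rvec_0 [simp]: "rvec 0 = 0"
  by (simp add: rvec_def vec_eq_iff)

lemma tilt_pos [simp]: "0 < tilt t x" and tilt_nonneg [simp]: "0 \<le> tilt t x"
  by (simp_all add: tilt_def)

lemma tilt_add: "tilt t (x + y) = tilt t x * tilt t y"
  by (simp add: tilt_def inner_add_right exp_add)

lemma tilt_minus: "tilt t (- x) = 1 / tilt t x"
  by (simp add: tilt_def inner_minus_right exp_minus field_simps)

lemma edges_image:
  assumes "inj \<pi>"
  shows "edges (\<pi> ` S) = (`) \<pi> ` edges S"
proof (intro set_eqI iffI)
  fix e assume "e \<in> edges (\<pi> ` S)"
  then obtain u v where "e = \<pi> ` {u, v}" "u \<in> S" "v \<in> S" "u \<noteq> v"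
    by (auto elim!: edgesE)
  then show "e \<in> (`) \<pi> ` edges S" using edge_in_edges[of u v S] by blast
next
  fix e assume "e \<in> (`) \<pi> ` edges S"
  then obtain u v where "e = {\<pi> u, \<pi> v}" "u \<in> S" "v \<in> S" "u \<noteq> v"
    by (auto elim!: edgesE)
  then show "e \<in> edges (\<pi> ` S)" using assms by (auto dest: injD)
qed

locale ferromagnet =
  fixes J :: "int ^ 'd \<Rightarrow> real"
  assumes J_nonneg: "0 \<le> J x" and J_even: "J (- x) = J x"
begin

lemma edge_weight_pair: "edge_weight J \<beta> {x, y} = exp (\<beta> * J (y - x)) - 1"
  using edge_coupling_pair[of J y x] J_even by (simp add: edge_weight_def insert_commute)

lemma edge_weight_nonneg:
  assumes "0 \<le> \<beta>" "e \<in> edges V"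
  shows "0 \<le> edge_weight J \<beta> e"
  using assms(2) by (rule edgesE) (simp add: edge_weight_pair assms(1) J_nonneg)

text \<open>The ratio is \<open>tanh (\<beta> J / 2)\<close>; the bound \<open>tanh (s / 2) \<le> 1 - exp (- s) \<le> s\<close> loses a factor of two, which only
  affects the final constant.\<close>

lemma edge_ratio_le:
  assumes "0 \<le> \<beta>"
  shows "edge_weight J \<beta> {x, y} / (2 + edge_weight J \<beta> {x, y}) \<le> \<beta> * J (y - x)"
proof -
  define s where "s = \<beta> * J (y - x)"
  have s: "0 \<le> s" using assms J_nonneg by (simp add: s_def)
  have "(exp s - 1) / (2 + (exp s - 1)) \<le> (exp s - 1) / exp s"
    using s by (intro divide_left_mono) (auto intro!: mult_pos_pos add_pos_pos)
  also have "\<dots> = 1 - exp (- s)" by (simp add: exp_minus field_simps)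
  also have "\<dots> \<le> s" using exp_ge_add_one_self[of "- s"] by linarith
  finally show ?thesis by (simp add: edge_weight_pair s_def)
qed

lemma two_point_nonneg: "finite S \<Longrightarrow> 0 \<le> \<beta> \<Longrightarrow> 0 \<le> two_point J \<beta> S x y"
  unfolding two_point_def by (rule fk_two_nonneg) (auto intro: edge_weight_nonneg)

lemma two_point_le_1: "finite S \<Longrightarrow> 0 \<le> \<beta> \<Longrightarrow> two_point J \<beta> S x y \<le> 1"
  unfolding two_point_def by (rule fk_two_le_1) (auto intro: edge_weight_nonneg)

lemma fk_two_le_two_point:
  assumes "finite V" "finite S" "T \<subseteq> V" "T \<subseteq> S" "0 \<le> \<beta>"
  shows "fk_two V (edge_weight J \<beta>) (edges T) x y \<le> two_point J \<beta> S x y"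
proof -
  have "fk_two V (edge_weight J \<beta>) (edges T) x y = fk_two S (edge_weight J \<beta>) (edges T) x y"
    using assms by (simp add: fk_two_enlarge_vertices[of V T] fk_two_enlarge_vertices[of S T])
  also have "\<dots> \<le> two_point J \<beta> S x y"
    unfolding two_point_def using assms edge_weight_nonneg
    by (intro fk_two_mono_edges edges_mono) auto
  finally show ?thesis .
qed

lemma two_point_translate: "two_point J \<beta> ((+) u ` S) (u + x) (u + y) = two_point J \<beta> S x y"
proof -
  have inj: "inj ((+) u)" by simp
  show ?thesis
    unfolding two_point_def edges_image[OF inj]
  proof (rule fk_two_image[OF inj])
    fix e assume "e \<in> edges S"
    then obtain a b where "e = {a, b}" by (rule edgesE)
    then show "edge_weight J \<beta> ((+) u ` e) = edge_weight J \<beta> e" by (simp add: edge_weight_pair)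
  qed
qed

lemma tilted_sum_le_escape:
  assumes "(\<lambda>z. tilt t z * J z) summable_on UNIV" "finite Z" "\<And>z. z \<in> Z \<Longrightarrow> z - u \<notin> S"
  shows "(\<Sum>z\<in>Z. tilt t (z - x) * J (z - x)) \<le> escape J t S (x - u)"
proof -
  have "(\<Sum>z\<in>Z. tilt t (z - x) * J (z - x)) = (\<Sum>z\<in>(\<lambda>z. z - x) ` Z. tilt t z * J z)"
    by (subst sum.reindex) (auto simp: inj_on_def)
  also have "\<dots> \<le> escape J t S (x - u)"
    unfolding escape_def
    using assms J_nonneg
    by (intro finite_sum_le_infsum summable_on_subset_banach[OF assms(1)]) (auto simp: algebra_simps)
  finally show ?thesis .
qed

lemma escape_nonneg: "0 \<le> escape J t S x"
  unfolding escape_def using J_nonneg by (intro infsum_nonneg) auto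

text \<open>If \<open>boundary_sum J t \<beta> S < 1\<close>, the Simon-Lieb inequality bounds the tilted susceptibility seen from any point
  \<open>u\<close> by the contribution of \<open>u + S\<close> plus \<open>boundary_sum J t \<beta> S\<close> times the largest such susceptibility.
  In the finite volume \<open>\<Lambda>\<close> this maximum is finite and can be absorbed, and the
  result is uniform in \<open>\<Lambda>\<close>.\<close>

theorem susceptibility_le:
  assumes summ: "(\<lambda>z. tilt t z * J z) summable_on UNIV" and \<beta>: "0 \<le> \<beta>"
    and fin: "finite S" "finite \<Lambda>" and "0 \<in> S" "0 \<in> \<Lambda>" and lt: "boundary_sum J t \<beta> S < 1"
  shows "(\<Sum>x\<in>\<Lambda>. tilt t x * two_point J \<beta> \<Lambda> 0 x) \<le> (\<Sum>x\<in>S. tilt t x) / (1 - boundary_sum J t \<beta> S)"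
proof -
  let ?P = "two_point J \<beta> \<Lambda>"
  define susc where "susc u = (\<Sum>y\<in>\<Lambda>. tilt t (y - u) * ?P u y)" for u
  define M where "M = Max (susc ` \<Lambda>)"
  define K where "K = (\<Sum>x\<in>S. tilt t x)"
  have M: "susc u \<le> M" if "u \<in> \<Lambda>" for u unfolding M_def using that fin by auto
  have M0: "0 \<le> M"
  proof -
    have "0 \<le> susc 0" unfolding susc_def using two_point_nonneg fin \<beta> by (intro sum_nonneg) auto
    then show ?thesis using M[OF \<open>0 \<in> \<Lambda>\<close>] by linarith
  qed
  have step: "susc u \<le> K + boundary_sum J t \<beta> S * M" if u: "u \<in> \<Lambda>" for u
  proof -
    \<comment> \<open>The translate of \<open>S\<close> is cut off at the boundary of the volume; by monotonicity this only decreases the connection probabilities inside.\<close>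
    define T where "T = (+) u ` S \<inter> \<Lambda>"
    have T: "T \<subseteq> \<Lambda>" "finite T" "u \<in> T" using fin u \<open>0 \<in> S\<close> by (auto simp: T_def image_iff intro: bexI[of _ 0])
    have shift: "(\<lambda>x. x - u) ` T \<subseteq> S" by (auto simp: T_def)
    define c where "c x = tilt t (x - u) * two_point J \<beta> S 0 (x - u)" for x
    have c0: "0 \<le> c x" for x using two_point_nonneg fin \<beta> by (simp add: c_def)
    have inside: "(\<Sum>y\<in>T. tilt t (y - u) * ?P u y) \<le> K"
    proof -
      have "(\<Sum>y\<in>T. tilt t (y - u) * ?P u y) \<le> (\<Sum>y\<in>T. tilt t (y - u))"
        using two_point_le_1[OF fin(2) \<beta>] by (intro sum_mono) (simp add: mult_left_le)
      also have "\<dots> = (\<Sum>x\<in>(\<lambda>x. x - u) ` T. tilt t x)"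
        by (subst sum.reindex) (auto simp: inj_on_def)
      also have "\<dots> \<le> K" unfolding K_def using shift fin by (intro sum_mono2) auto
      finally show ?thesis .
    qed
    have outside: "tilt t (y - u) * ?P u y \<le>
        (\<Sum>x\<in>T. \<Sum>z\<in>\<Lambda> - T. c x * (\<beta> * (tilt t (z - x) * J (z - x))) * (tilt t (y - z) * ?P z y))"
      if y: "y \<in> \<Lambda> - T" for y
    proof -
      have "?P u y \<le> (\<Sum>x\<in>T. \<Sum>z\<in>\<Lambda> - T. fk_two \<Lambda> (edge_weight J \<beta>) (edges \<Lambda> \<inter> edges T) u x *
          (of_bool ({x, z} \<in> edges \<Lambda>) * (edge_weight J \<beta> {x, z} / (2 + edge_weight J \<beta> {x, z}))) * ?P z y)"
        unfolding two_point_def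
        by (rule simon_lieb) (use T y fin edge_weight_nonneg[OF \<beta>] in auto)
      also have "\<dots> \<le> (\<Sum>x\<in>T. \<Sum>z\<in>\<Lambda> - T. two_point J \<beta> S 0 (x - u) * (\<beta> * J (z - x)) * ?P z y)"
      proof (intro sum_mono mult_right_mono, rule mult_mono)
        fix x z assume x: "x \<in> T" and z: "z \<in> \<Lambda> - T"
        have "edges \<Lambda> \<inter> edges T = edges T" using T edges_mono by blast
        then have "fk_two \<Lambda> (edge_weight J \<beta>) (edges \<Lambda> \<inter> edges T) u x \<le> two_point J \<beta> ((+) u ` S) u x"
          using T fin \<beta> by (auto intro!: fk_two_le_two_point simp: T_def)
        also have "\<dots> = two_point J \<beta> S 0 (x - u)"
          using two_point_translate[of \<beta> u S 0 "x - u"] by simp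
        finally show "fk_two \<Lambda> (edge_weight J \<beta>) (edges \<Lambda> \<inter> edges T) u x \<le> two_point J \<beta> S 0 (x - u)" .
        have e: "{x, z} \<in> edges \<Lambda>" using x z T by auto
        show "of_bool ({x, z} \<in> edges \<Lambda>) * (edge_weight J \<beta> {x, z} / (2 + edge_weight J \<beta> {x, z})) \<le> \<beta> * J (z - x)"
          using edge_ratio_le[OF \<beta>] e by simp
        show "0 \<le> of_bool ({x, z} \<in> edges \<Lambda>) * (edge_weight J \<beta> {x, z} / (2 + edge_weight J \<beta> {x, z}))"
          using edge_weight_nonneg[OF \<beta> e] by simp
      qed (use two_point_nonneg fin \<beta> in auto)
      finally have "tilt t (y - u) * ?P u y \<le>
          tilt t (y - u) * (\<Sum>x\<in>T. \<Sum>z\<in>\<Lambda> - T. two_point J \<beta> S 0 (x - u) * (\<beta> * J (z - x)) * ?P z y)"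
        by (intro mult_left_mono) auto
      also have "\<dots> = (\<Sum>x\<in>T. \<Sum>z\<in>\<Lambda> - T. c x * (\<beta> * (tilt t (z - x) * J (z - x))) * (tilt t (y - z) * ?P z y))"
        unfolding sum_distrib_left
      proof (intro sum.cong refl)
        fix x z
        have "tilt t (y - u) = tilt t (x - u) * tilt t (z - x) * tilt t (y - z)"
          by (simp add: tilt_add[symmetric])
        then show "tilt t (y - u) * (two_point J \<beta> S 0 (x - u) * (\<beta> * J (z - x)) * ?P z y) =
            c x * (\<beta> * (tilt t (z - x) * J (z - x))) * (tilt t (y - z) * ?P z y)"
          by (simp add: c_def)
      qed
      finally show ?thesis .
    qed
    have "(\<Sum>y\<in>\<Lambda> - T. tilt t (y - u) * ?P u y) \<le> (\<Sum>y\<in>\<Lambda> - T. \<Sum>x\<in>T. \<Sum>z\<in>\<Lambda> - T.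
        c x * (\<beta> * (tilt t (z - x) * J (z - x))) * (tilt t (y - z) * ?P z y))"
      by (rule sum_mono) (rule outside)
    also have "\<dots> = (\<Sum>x\<in>T. \<Sum>z\<in>\<Lambda> - T. c x * (\<beta> * (tilt t (z - x) * J (z - x))) *
        (\<Sum>y\<in>\<Lambda> - T. tilt t (y - z) * ?P z y))"
      unfolding sum_distrib_left by (subst sum.swap) (rule sum.cong[OF refl sum.swap])
    also have "\<dots> \<le> (\<Sum>x\<in>T. \<Sum>z\<in>\<Lambda> - T. c x * (\<beta> * (tilt t (z - x) * J (z - x))) * M)"
    proof (intro sum_mono mult_left_mono)
      fix z assume z: "z \<in> \<Lambda> - T"
      have "(\<Sum>y\<in>\<Lambda> - T. tilt t (y - z) * ?P z y) \<le> susc z"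
        unfolding susc_def using fin two_point_nonneg \<beta> by (intro sum_mono2) auto
      then show "(\<Sum>y\<in>\<Lambda> - T. tilt t (y - z) * ?P z y) \<le> M" using M[of z] z by auto
    qed (use c0 \<beta> J_nonneg in auto)
    also have "\<dots> = (\<beta> * M) * (\<Sum>x\<in>T. c x * (\<Sum>z\<in>\<Lambda> - T. tilt t (z - x) * J (z - x)))"
      by (simp add: sum_distrib_left mult_ac)
    also have "\<dots> \<le> (\<beta> * M) * (\<Sum>x\<in>T. c x * escape J t S (x - u))"
    proof (intro mult_left_mono sum_mono c0 tilted_sum_le_escape[OF summ])
      fix z assume "z \<in> \<Lambda> - T"
      then show "z - u \<notin> S" by (auto simp: T_def image_iff algebra_simps)
    qed (use fin \<beta> M0 in auto)
    also have "(\<Sum>x\<in>T. c x * escape J t S (x - u)) =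
        (\<Sum>x\<in>(\<lambda>x. x - u) ` T. tilt t x * two_point J \<beta> S 0 x * escape J t S x)"
      by (subst sum.reindex) (auto simp: inj_on_def c_def)
    also have "(\<beta> * M) * \<dots> \<le> (\<beta> * M) * (\<Sum>x\<in>S. tilt t x * two_point J \<beta> S 0 x * escape J t S x)"
      using fin shift \<beta> M0 two_point_nonneg escape_nonneg by (intro mult_left_mono sum_mono2) auto
    also have "\<dots> = boundary_sum J t \<beta> S * M" by (simp add: boundary_sum_def)
    finally have "(\<Sum>y\<in>\<Lambda> - T. tilt t (y - u) * ?P u y) \<le> boundary_sum J t \<beta> S * M" .
    moreover have "susc u = (\<Sum>y\<in>\<Lambda> - T. tilt t (y - u) * ?P u y) + (\<Sum>y\<in>T. tilt t (y - u) * ?P u y)"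
      unfolding susc_def using T fin by (intro sum.subset_diff) auto
    ultimately show ?thesis using inside by linarith
  qed
  have "M \<in> susc ` \<Lambda>" unfolding M_def using fin \<open>0 \<in> \<Lambda>\<close> by (intro Max_in) auto
  then have "M \<le> K + boundary_sum J t \<beta> S * M" using step by auto
  then have "M * (1 - boundary_sum J t \<beta> S) \<le> K" by (simp add: algebra_simps)
  then have "M \<le> K / (1 - boundary_sum J t \<beta> S)" using lt by (simp add: pos_le_divide_eq)
  moreover have "susc 0 = (\<Sum>x\<in>\<Lambda>. tilt t x * ?P 0 x)" by (simp add: susc_def)
  ultimately show ?thesis using M[OF \<open>0 \<in> \<Lambda>\<close>] by (simp add: K_def)
qed

end

section \<open>Topology and measurability of configurations\<close>

lemma cube_mono: "N \<le> M \<Longrightarrow> cube N \<subseteq> cube M"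
proof
  fix x :: "int ^ 'd" assume "N \<le> M" and x: "x \<in> cube N"
  have "- int M \<le> x $ k \<and> x $ k \<le> int M" for k
  proof -
    have "- int N \<le> x $ k \<and> x $ k \<le> int N" using x by (simp add: cube_def)
    then show ?thesis using \<open>N \<le> M\<close> by linarith
  qed
  then show "x \<in> cube M" by (simp add: cube_def)
qed

lemma finite_cube [simp]: "finite (cube N :: (int ^ 'd) set)"
proof (rule finite_subset)
  show "(cube N :: (int ^ 'd) set) \<subseteq> vec_lambda ` (UNIV \<rightarrow>\<^sub>E {- int N..int N})"
  proof
    fix x :: "int ^ 'd" assume "x \<in> cube N"
    then have "vec_nth x \<in> UNIV \<rightarrow>\<^sub>E {- int N..int N}" by (auto simp: cube_def)
    then show "x \<in> vec_lambda ` (UNIV \<rightarrow>\<^sub>E {- int N..int N})"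
      by (intro image_eqI[of _ _ "vec_nth x"]) simp_all
  qed
  show "finite (vec_lambda ` (UNIV \<rightarrow>\<^sub>E {- int N..int N}) :: (int ^ 'd) set)"
    by (intro finite_imageI finite_PiE) auto
qed

lemma zero_in_cube [simp]: "0 \<in> cube N"
  by (simp add: cube_def)

lemma in_some_cube: "\<exists>N. x \<in> cube N"
proof
  show "x \<in> cube (\<Sum>k\<in>UNIV. nat \<bar>x $ k\<bar>)"
  proof (unfold cube_def, rule CollectI, rule allI)
    fix k
    have "nat \<bar>x $ k\<bar> \<le> (\<Sum>k\<in>UNIV. nat \<bar>x $ k\<bar>)" by (intro member_le_sum) auto
    then show "- int (\<Sum>k\<in>UNIV. nat \<bar>x $ k\<bar>) \<le> x $ k \<and> x $ k \<le> int (\<Sum>k\<in>UNIV. nat \<bar>x $ k\<bar>)"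
      by linarith
  qed
qed

lemma finite_subset_cube:
  assumes "finite X"
  shows "\<exists>N. X \<subseteq> cube N"
  using assms
proof (induction X rule: finite_induct)
  case (insert x X)
  then obtain N M where "X \<subseteq> cube N" "x \<in> cube M" using in_some_cube by blast
  then have "insert x X \<subseteq> cube (max N M)"
    using cube_mono[of N "max N M"] cube_mono[of M "max N M"] by auto
  then show ?case by blast
qed simp

definition open_edges :: "'v set set \<Rightarrow> ('v set \<Rightarrow> bool) \<Rightarrow> 'v set set" where
  "open_edges F \<omega> = {e \<in> F. \<omega> e}"

definition configuration :: "'v set set \<Rightarrow> 'v set \<Rightarrow> bool" where
  "configuration A = (\<lambda>e\<in>edges UNIV. e \<in> A)"

lemma open_edges_configuration: "F \<subseteq> edges UNIV \<Longrightarrow> open_edges F (configuration A) = A \<inter> F"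
  by (auto simp: open_edges_def configuration_def)

lemma space_config: "space config_space = edges UNIV \<rightarrow>\<^sub>E UNIV"
  by (simp add: config_space_def space_PiM)

lemma topspace_config: "topspace config_topology = edges UNIV \<rightarrow>\<^sub>E UNIV"
  by (simp add: config_topology_def)

lemma configuration_in_space: "configuration A \<in> edges UNIV \<rightarrow>\<^sub>E UNIV"
  by (simp add: configuration_def)

text \<open>The open sets are those in which membership is decided locally by finitely many edges; this is the
  form in which the product topology enters below.\<close>

lemma openin_config_topology:
  "openin config_topology W \<longleftrightarrow> W \<subseteq> edges UNIV \<rightarrow>\<^sub>E UNIV \<and>
    (\<forall>\<omega>\<in>W. \<exists>F. finite F \<and> F \<subseteq> edges UNIV \<and>
      (\<forall>\<omega>'\<in>edges UNIV \<rightarrow>\<^sub>E UNIV. open_edges F \<omega>' = open_edges F \<omega> \<longrightarrow> \<omega>' \<in> W))" (is "?L \<longleftrightarrow> ?R")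
proof
  assume L: ?L
  show ?R
  proof (intro conjI ballI)
    show "W \<subseteq> edges UNIV \<rightarrow>\<^sub>E UNIV" using openin_subset[OF L] by (simp add: topspace_config)
    fix \<omega> assume "\<omega> \<in> W"
    have "\<forall>x\<in>W. \<exists>U. finite {i \<in> edges UNIV. U i \<noteq> (UNIV :: bool set)} \<and> x \<in> Pi\<^sub>E (edges UNIV) U \<and>
        Pi\<^sub>E (edges UNIV) U \<subseteq> W"
    proof
      fix x assume "x \<in> W"
      from L[unfolded config_topology_def openin_product_topology_alt topspace_discrete_topology, THEN bspec, OF this]
      show "\<exists>U. finite {i \<in> edges UNIV. U i \<noteq> (UNIV :: bool set)} \<and> x \<in> Pi\<^sub>E (edges UNIV) U \<and>
        Pi\<^sub>E (edges UNIV) U \<subseteq> W"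
        by (elim exE conjE) (intro exI conjI)
    qed
    from bspec[OF this \<open>\<omega> \<in> W\<close>] obtain U where U: "finite {i \<in> edges UNIV. U i \<noteq> (UNIV :: bool set)}"
      "\<omega> \<in> Pi\<^sub>E (edges UNIV) U" "Pi\<^sub>E (edges UNIV) U \<subseteq> W"
      by (elim exE conjE)
    define F where "F = {i \<in> edges UNIV. U i \<noteq> (UNIV :: bool set)}"
    have "\<omega>' \<in> W" if "\<omega>' \<in> edges UNIV \<rightarrow>\<^sub>E UNIV" "open_edges F \<omega>' = open_edges F \<omega>" for \<omega>'
    proof -
      have "\<omega>' i \<in> U i" if "i \<in> edges UNIV" for i
      proof (cases "i \<in> F")
        case True
        then have "\<omega>' i = \<omega> i" using \<open>open_edges F \<omega>' = open_edges F \<omega>\<close> by (auto simp: open_edges_def)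
        then show ?thesis using U(2) that by (auto simp: PiE_iff)
      next
        case False
        then have "U i = UNIV" using that by (auto simp: F_def)
        then show ?thesis by simp
      qed
      then have "\<omega>' \<in> Pi\<^sub>E (edges UNIV) U" using that by (auto simp: PiE_iff)
      then show ?thesis using U(3) by blast
    qed
    then show "\<exists>F. finite F \<and> F \<subseteq> edges UNIV \<and>
      (\<forall>\<omega>'\<in>edges UNIV \<rightarrow>\<^sub>E UNIV. open_edges F \<omega>' = open_edges F \<omega> \<longrightarrow> \<omega>' \<in> W)"
      using U(1) by (intro exI[of _ F]) (auto simp: F_def)
  qed
next
  assume R: ?R
  show ?L
    unfolding config_topology_def openin_product_topology_alt
  proof
    fix \<omega> assume \<omega>: "\<omega> \<in> W"
    obtain F where F0: "finite F \<and> F \<subseteq> edges UNIV \<and>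
        (\<forall>\<omega>'\<in>edges UNIV \<rightarrow>\<^sub>E UNIV. open_edges F \<omega>' = open_edges F \<omega> \<longrightarrow> \<omega>' \<in> W)"
      using R[THEN conjunct2, THEN bspec, OF \<omega>] by (rule exE)
    then have F: "finite F" "F \<subseteq> edges UNIV"
      "\<And>\<omega>'. \<omega>' \<in> edges UNIV \<rightarrow>\<^sub>E UNIV \<Longrightarrow> open_edges F \<omega>' = open_edges F \<omega> \<Longrightarrow> \<omega>' \<in> W" by simp_all
    define U where "U i = (if i \<in> F then {\<omega> i} else UNIV)" for i
    have fin: "finite {i \<in> edges UNIV. U i \<noteq> UNIV}"
      by (rule finite_subset[OF _ F(1)]) (auto simp: U_def)
    have "\<omega> \<in> Pi\<^sub>E (edges UNIV) U" using \<omega> R by (auto simp: U_def PiE_iff)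
    moreover have "Pi\<^sub>E (edges UNIV) U \<subseteq> W"
    proof
      fix \<omega>' assume w': "\<omega>' \<in> Pi\<^sub>E (edges UNIV) U"
      have "\<omega>' i = \<omega> i" if "i \<in> F" for i
        using PiE_mem[OF w', of i] that F(2) by (auto simp: U_def)
      then have "open_edges F \<omega>' = open_edges F \<omega>" by (auto simp: open_edges_def)
      then show "\<omega>' \<in> W" using w' F(3) by (auto simp: PiE_iff)
    qed
    ultimately show "\<exists>U. finite {i \<in> edges UNIV. U i \<noteq> topspace (discrete_topology UNIV)} \<and>
        (\<forall>i\<in>edges UNIV. openin (discrete_topology UNIV) (U i)) \<and> \<omega> \<in> Pi\<^sub>E (edges UNIV) U \<and> Pi\<^sub>E (edges UNIV) U \<subseteq> W"
      using fin by (intro exI[of _ U]) auto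
  qed
qed

lemma continuous_map_local:
  fixes g :: "(int ^ 'd) set set \<Rightarrow> real"
  assumes "finite F" "F \<subseteq> edges UNIV"
  shows "continuous_map config_topology euclideanreal (\<lambda>\<omega>. g (open_edges F \<omega>))"
  unfolding continuous_map_def openin_config_topology topspace_config
proof (intro conjI allI impI ballI)
  fix U :: "real set" and \<omega> :: "(int ^ 'd) set \<Rightarrow> bool"
  assume "\<omega> \<in> {x \<in> edges UNIV \<rightarrow>\<^sub>E UNIV. g (open_edges F x) \<in> U}"
  then show "\<exists>F'. finite F' \<and> F' \<subseteq> edges UNIV \<and> (\<forall>\<omega>'\<in>edges UNIV \<rightarrow>\<^sub>E UNIV. open_edges F' \<omega>' = open_edges F' \<omega> \<longrightarrow>
      \<omega>' \<in> {x \<in> edges UNIV \<rightarrow>\<^sub>E UNIV. g (open_edges F x) \<in> U})"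
    using assms by (intro exI[of _ F]) auto
qed auto

text \<open>Compactness of \<open>{0,1}\<^sup>E\<close>: finitely many of the cylinders on which \<open>f\<close> is nearly constant cover the space.\<close>

lemma continuous_uniformly_local:
  fixes f :: "((int ^ 'd) set \<Rightarrow> bool) \<Rightarrow> real"
  assumes f: "continuous_map config_topology euclideanreal f" and \<epsilon>: "0 < \<epsilon>"
  shows "\<exists>F. finite F \<and> F \<subseteq> edges UNIV \<and> (\<forall>\<omega>\<in>edges UNIV \<rightarrow>\<^sub>E UNIV. \<forall>\<omega>'\<in>edges UNIV \<rightarrow>\<^sub>E UNIV.
    open_edges F \<omega> = open_edges F \<omega>' \<longrightarrow> \<bar>f \<omega> - f \<omega>'\<bar> < \<epsilon>)"
proof -
  let ?X = "edges (UNIV :: (int ^ 'd) set) \<rightarrow>\<^sub>E (UNIV :: bool set)"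
  have "\<exists>F. finite F \<and> F \<subseteq> edges UNIV \<and> (\<forall>\<omega>'\<in>?X. open_edges F \<omega>' = open_edges F \<omega> \<longrightarrow> \<bar>f \<omega>' - f \<omega>\<bar> < \<epsilon> / 2)"
    if "\<omega> \<in> ?X" for \<omega>
  proof -
    have "openin config_topology {x \<in> topspace config_topology. f x \<in> ball (f \<omega>) (\<epsilon> / 2)}"
      using f by (intro openin_continuous_map_preimage) auto
    moreover have "\<omega> \<in> {x \<in> topspace config_topology. f x \<in> ball (f \<omega>) (\<epsilon> / 2)}"
      using that \<epsilon> by (simp add: topspace_config)
    ultimately have "\<exists>F. finite F \<and> F \<subseteq> edges UNIV \<and> (\<forall>\<omega>'\<in>?X. open_edges F \<omega>' = open_edges F \<omega> \<longrightarrow>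
        \<omega>' \<in> {x \<in> topspace config_topology. f x \<in> ball (f \<omega>) (\<epsilon> / 2)})"
      unfolding openin_config_topology by blast
    then show ?thesis by (auto simp: dist_real_def abs_minus_commute)
  qed
  then obtain G where G: "\<And>\<omega>. \<omega> \<in> ?X \<Longrightarrow> finite (G \<omega>) \<and> G \<omega> \<subseteq> edges UNIV \<and>
      (\<forall>\<omega>'\<in>?X. open_edges (G \<omega>) \<omega>' = open_edges (G \<omega>) \<omega> \<longrightarrow> \<bar>f \<omega>' - f \<omega>\<bar> < \<epsilon> / 2)" by metis
  define U where "U \<omega> = {\<omega>' \<in> ?X. open_edges (G \<omega>) \<omega>' = open_edges (G \<omega>) \<omega>}" for \<omega>
  have "compact_space config_topology"
    unfolding config_topology_def
    by (subst compact_space_product_topology) (auto simp: compact_space_discrete_topology)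
  moreover have "openin config_topology (U \<omega>)" if "\<omega> \<in> ?X" for \<omega>
    unfolding openin_config_topology
  proof (intro conjI ballI)
    fix \<omega>' assume "\<omega>' \<in> U \<omega>"
    then show "\<exists>F. finite F \<and> F \<subseteq> edges UNIV \<and>
      (\<forall>\<omega>''\<in>?X. open_edges F \<omega>'' = open_edges F \<omega>' \<longrightarrow> \<omega>'' \<in> U \<omega>)"
      using G[OF that] by (intro exI[of _ "G \<omega>"]) (auto simp: U_def)
  qed (auto simp: U_def)
  moreover have "topspace config_topology \<subseteq> \<Union> (U ` ?X)" by (auto simp: topspace_config U_def)
  ultimately obtain T where T: "finite T" "T \<subseteq> U ` ?X" "topspace config_topology \<subseteq> \<Union> T"
    unfolding compact_space_alt by (smt (verit, best) imageE)
  then obtain Y where Y: "finite Y" "Y \<subseteq> ?X" "T = U ` Y"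
    by (meson finite_subset_image)
  show ?thesis
  proof (intro exI[of _ "\<Union> (G ` Y)"] conjI ballI impI)
    have "finite (G \<eta>) \<and> G \<eta> \<subseteq> edges UNIV" if "\<eta> \<in> Y" for \<eta> using G[of \<eta>] Y that by blast
    then show "finite (\<Union> (G ` Y))" "\<Union> (G ` Y) \<subseteq> edges UNIV"
      using Y(1) by (simp_all add: UN_subset_iff)
    fix \<omega> \<omega>' assume w: "\<omega> \<in> ?X" "\<omega>' \<in> ?X" "open_edges (\<Union> (G ` Y)) \<omega> = open_edges (\<Union> (G ` Y)) \<omega>'"
    have "\<omega> \<in> \<Union> (U ` Y)" using T(3) w(1) unfolding topspace_config Y(3) by (rule subsetD)
    then obtain \<eta> where \<eta>: "\<eta> \<in> Y" "\<omega> \<in> U \<eta>" by (rule UN_E)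
    have \<eta>X: "\<eta> \<in> ?X" using \<eta>(1) Y(2) by (rule rev_subsetD)
    have "open_edges (G \<eta>) \<omega>' = open_edges (G \<eta>) \<omega>"
    proof -
      have "open_edges (G \<eta>) \<zeta> = G \<eta> \<inter> open_edges (\<Union> (G ` Y)) \<zeta>" for \<zeta>
        using \<eta>(1) by (auto simp: open_edges_def)
      then show ?thesis using w(3) by simp
    qed
    moreover have "open_edges (G \<eta>) \<omega> = open_edges (G \<eta>) \<eta>" using \<eta>(2) by (simp add: U_def)
    ultimately have "\<bar>f \<omega>' - f \<eta>\<bar> < \<epsilon> / 2" "\<bar>f \<omega> - f \<eta>\<bar> < \<epsilon> / 2"
      using G[OF \<eta>X] w(1,2) by simp_all
    then show "\<bar>f \<omega> - f \<omega>'\<bar> < \<epsilon>" by linarith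
  qed
qed

lemma measurable_open_edges:
  assumes "finite F" "F \<subseteq> edges UNIV"
  shows "{\<omega> \<in> space config_space. open_edges F \<omega> \<in> X} \<in> sets config_space"
proof -
  have "{\<omega> \<in> space config_space. \<forall>e\<in>F. \<omega> e = (e \<in> B)} \<in> sets config_space" for B
    unfolding config_space_def
  proof (rule sets.sets_Collect_finite_All[OF _ assms(1)])
    fix e assume "e \<in> F"
    then have "(\<lambda>\<omega>. \<omega> e) \<in> measurable (PiM (edges UNIV) (\<lambda>_. count_space UNIV)) (count_space (UNIV :: bool set))"
      using assms(2) by (intro measurable_component_singleton) auto
    from measurable_sets[OF this, of "{e \<in> B}"]
    show "{\<omega> \<in> space (PiM (edges UNIV) (\<lambda>_. count_space UNIV)). \<omega> e = (e \<in> B)} \<in>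
        sets (PiM (edges UNIV) (\<lambda>_. count_space UNIV))"
      by (simp add: vimage_def Int_def conj_commute)
  qed
  moreover have "{\<omega> \<in> space config_space. open_edges F \<omega> \<in> X} =
      (\<Union>B\<in>Pow F \<inter> X. {\<omega> \<in> space config_space. \<forall>e\<in>F. \<omega> e = (e \<in> B)})"
  proof (intro set_eqI iffI)
    fix \<omega> assume "\<omega> \<in> {\<omega> \<in> space config_space. open_edges F \<omega> \<in> X}"
    then show "\<omega> \<in> (\<Union>B\<in>Pow F \<inter> X. {\<omega> \<in> space config_space. \<forall>e\<in>F. \<omega> e = (e \<in> B)})"
      by (intro UN_I[of "open_edges F \<omega>"]) (auto simp: open_edges_def)
  next
    fix \<omega> assume "\<omega> \<in> (\<Union>B\<in>Pow F \<inter> X. {\<omega> \<in> space config_space. \<forall>e\<in>F. \<omega> e = (e \<in> B)})"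
    then obtain B where B: "B \<subseteq> F" "B \<in> X" "\<omega> \<in> space config_space" "\<forall>e\<in>F. \<omega> e = (e \<in> B)" by blast
    then have "open_edges F \<omega> = B" by (auto simp: open_edges_def)
    then show "\<omega> \<in> {\<omega> \<in> space config_space. open_edges F \<omega> \<in> X}" using B by simp
  qed
  ultimately show ?thesis using assms(1) by (simp add: sets.finite_UN)
qed

lemma borel_measurable_local:
  fixes g :: "(int ^ 'd) set set \<Rightarrow> real"
  assumes "finite F" "F \<subseteq> edges UNIV"
  shows "(\<lambda>\<omega>. g (open_edges F \<omega>)) \<in> borel_measurable config_space"
proof (rule measurableI)
  fix A :: "real set"
  show "(\<lambda>\<omega>. g (open_edges F \<omega>)) -` A \<inter> space config_space \<in> sets config_space"
    using measurable_open_edges[OF assms, of "g -` A"] by (simp add: vimage_def Int_def conj_commute)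
qed simp

text \<open>A continuous function is a pointwise limit of functions of finitely many edges.\<close>

lemma borel_measurable_continuous_config:
  fixes f :: "((int ^ 'd) set \<Rightarrow> bool) \<Rightarrow> real"
  assumes f: "continuous_map config_topology euclideanreal f"
  shows "f \<in> borel_measurable config_space"
proof -
  have "\<exists>F. finite F \<and> F \<subseteq> edges UNIV \<and> (\<forall>\<omega>\<in>edges UNIV \<rightarrow>\<^sub>E UNIV. \<bar>f (configuration (open_edges F \<omega>)) - f \<omega>\<bar> < 1 / Suc n)" for n
  proof -
    have pos: "0 < 1 / real (Suc n)" by simp
    obtain F where F: "finite F" "F \<subseteq> edges UNIV"
      "\<forall>\<omega>\<in>edges UNIV \<rightarrow>\<^sub>E UNIV. \<forall>\<omega>'\<in>edges UNIV \<rightarrow>\<^sub>E UNIV. open_edges F \<omega> = open_edges F \<omega>' \<longrightarrow>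
        \<bar>f \<omega> - f \<omega>'\<bar> < 1 / Suc n"
      using continuous_uniformly_local[OF f pos] by (elim exE conjE)
    have "open_edges F (configuration (open_edges F \<omega>)) = open_edges F \<omega>" for \<omega>
      using open_edges_configuration[OF F(2)] by (auto simp: open_edges_def)
    from F(3)[rule_format, OF configuration_in_space _ this] show ?thesis
      using F(1,2) by (intro exI[of _ F] conjI ballI)
  qed
  then obtain F where F: "\<And>n. finite (F n)" "\<And>n. F n \<subseteq> edges UNIV"
    "\<And>n \<omega>. \<omega> \<in> edges UNIV \<rightarrow>\<^sub>E UNIV \<Longrightarrow> \<bar>f (configuration (open_edges (F n) \<omega>)) - f \<omega>\<bar> < 1 / Suc n" by metis
  show ?thesis
  proof (rule borel_measurable_LIMSEQ_real)
    show "(\<lambda>\<omega>. f (configuration (open_edges (F n) \<omega>))) \<in> borel_measurable config_space" for n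
      by (rule borel_measurable_local[OF F(1,2), of "\<lambda>B. f (configuration B)"])
    fix \<omega> assume "\<omega> \<in> space (config_space :: ((int ^ 'd) set \<Rightarrow> bool) measure)"
    then have "norm (f (configuration (open_edges (F n) \<omega>)) - f \<omega>) \<le> 1 / Suc n" for n
      using F(3)[of \<omega> n] by (simp add: space_config)
    then have "\<forall>\<^sub>F n in sequentially. norm (f (configuration (open_edges (F n) \<omega>)) - f \<omega>) \<le> 1 / real (Suc n)"
      by (intro always_eventually allI)
    then have "(\<lambda>n. f (configuration (open_edges (F n) \<omega>)) - f \<omega>) \<longlonglongrightarrow> 0"
      by (rule Lim_null_comparison) (rule LIMSEQ_Suc[OF lim_1_over_n])
    then show "(\<lambda>n. f (configuration (open_edges (F n) \<omega>))) \<longlonglongrightarrow> f \<omega>"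
      by (rule LIM_zero_cancel)
  qed
qed

section \<open>The infinite-volume measure\<close>

locale fk_model = ferromagnet J for J :: "int ^ 'd \<Rightarrow> real" +
  fixes \<beta> :: real
  assumes \<beta>_nonneg: "0 \<le> \<beta>"
begin

definition vol_mean :: "nat \<Rightarrow> ((int ^ 'd) set set \<Rightarrow> real) \<Rightarrow> real" where
  "vol_mean N = fk_mean (cube N) (edge_weight J \<beta>) (edges (cube N))"

lemma weight_nonneg: "e \<in> edges V \<Longrightarrow> 0 \<le> edge_weight J \<beta> e"
  by (rule edge_weight_nonneg[OF \<beta>_nonneg])

lemma vol_mean_add: "vol_mean N (\<lambda>A. f A + g A) = vol_mean N f + vol_mean N g"
  by (simp add: vol_mean_def fk_mean_add)

lemma vol_mean_diff: "vol_mean N (\<lambda>A. f A - g A) = vol_mean N f - vol_mean N g"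
  by (simp add: vol_mean_def fk_mean_diff)

lemma vol_mean_cmult: "vol_mean N (\<lambda>A. c * f A) = c * vol_mean N f"
  by (simp add: vol_mean_def fk_mean_cmult)

lemma vol_mean_const: "vol_mean N (\<lambda>_. c) = c"
  unfolding vol_mean_def by (rule fk_mean_const) (auto intro: weight_nonneg)

lemma vol_mean_sum: "finite I \<Longrightarrow> vol_mean N (\<lambda>A. \<Sum>i\<in>I. f i A) = (\<Sum>i\<in>I. vol_mean N (f i))"
  by (induction I rule: finite_induct) (simp_all add: vol_mean_add vol_mean_const)

lemma vol_mean_le: "(\<And>A. f A \<le> g A) \<Longrightarrow> vol_mean N f \<le> vol_mean N g"
  unfolding vol_mean_def by (rule fk_mean_mono) (auto intro: weight_nonneg)

lemma vol_mean_mono_volume: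
  assumes "N \<le> M" "\<And>A B. A \<subseteq> B \<Longrightarrow> f A \<le> f B"
  shows "vol_mean N f \<le> vol_mean M f"
proof -
  have "vol_mean N f = fk_mean (cube M) (edge_weight J \<beta>) (edges (cube N)) f"
    unfolding vol_mean_def using cube_mono[OF assms(1)] by (intro fk_mean_enlarge_vertices[symmetric]) auto
  also have "\<dots> \<le> vol_mean M f"
    unfolding vol_mean_def using cube_mono[OF assms(1)] assms(2)
    by (intro fk_mean_mono_edges edges_mono mono_on_PowI) (auto intro: weight_nonneg)
  finally show ?thesis .
qed

text \<open>Means of bounded increasing local functions converge because they increase with the volume. Every
  local function is a difference of two increasing ones: adding a large multiple of the number of
  open edges makes it increasing.\<close>

lemma vol_mean_local_convergent:
  fixes g :: "(int ^ 'd) set set \<Rightarrow> real"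
  assumes "finite F"
  shows "convergent (\<lambda>N. vol_mean N (\<lambda>A. g (A \<inter> F)))"
proof -
  have incr: "convergent (\<lambda>N. vol_mean N (\<lambda>A. h (A \<inter> F)))"
    if "\<And>A B. A \<subseteq> B \<Longrightarrow> h (A \<inter> F) \<le> h (B \<inter> F)" for h :: "(int ^ 'd) set set \<Rightarrow> real"
  proof -
    have "vol_mean N (\<lambda>A. h (A \<inter> F)) \<le> h F" for N
      using vol_mean_le[of "\<lambda>A. h (A \<inter> F)" "\<lambda>_. h F" N] that[of _ UNIV] by (simp add: vol_mean_const)
    moreover have "incseq (\<lambda>N. vol_mean N (\<lambda>A. h (A \<inter> F)))"
      using vol_mean_mono_volume[of _ _ "\<lambda>A. h (A \<inter> F)"] that by (simp add: incseq_def)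
    ultimately show ?thesis using incseq_convergent convergentI by metis
  qed
  \<comment> \<open>One more open edge changes \<open>g\<close> by at most \<open>2 max \<bar>g\<bar> \<le> K\<close>.\<close>
  define K where "K = 2 * (\<Sum>B\<in>Pow F. \<bar>g B\<bar>)"
  have bound: "\<bar>g B\<bar> \<le> K / 2" if "B \<subseteq> F" for B
    unfolding K_def using that assms member_le_sum[of B "Pow F" "\<lambda>B. \<bar>g B\<bar>"] by simp
  have K0: "0 \<le> K" unfolding K_def by (simp add: sum_nonneg)
  define h1 where "h1 B = g B + K * card B" for B
  define h2 where "h2 B = K * card B" for B :: "(int ^ 'd) set set"
  have card: "card (A \<inter> F) \<le> card (B \<inter> F)" if "A \<subseteq> B" for A B
    using that assms by (intro card_mono) auto
  have h2: "h2 (A \<inter> F) \<le> h2 (B \<inter> F)" if "A \<subseteq> B" for A B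
    unfolding h2_def using card[OF that] K0 by (intro mult_left_mono) auto
  have h1: "h1 (A \<inter> F) \<le> h1 (B \<inter> F)" if "A \<subseteq> B" for A B
  proof (cases "A \<inter> F = B \<inter> F")
    case False
    then have "card (A \<inter> F) < card (B \<inter> F)" using that assms by (intro psubset_card_mono) auto
    then have "real (card (A \<inter> F)) + 1 \<le> real (card (B \<inter> F))" by linarith
    then have "K * (real (card (A \<inter> F)) + 1) \<le> K * real (card (B \<inter> F))" using K0 by (rule mult_left_mono)
    moreover have "g (A \<inter> F) \<le> K / 2" "- (K / 2) \<le> g (B \<inter> F)"
      using bound[of "A \<inter> F"] bound[of "B \<inter> F"] by (simp_all add: abs_le_iff)
    ultimately show ?thesis unfolding h1_def by (simp add: algebra_simps)
  qed simp
  have "convergent (\<lambda>N. vol_mean N (\<lambda>A. h1 (A \<inter> F)) - vol_mean N (\<lambda>A. h2 (A \<inter> F)))"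
    using incr[of h1, OF h1] incr[of h2, OF h2] by (rule convergent_diff)
  then show ?thesis unfolding vol_mean_diff[symmetric] by (simp add: h1_def h2_def)
qed

definition limit_mean :: "((int ^ 'd) set set \<Rightarrow> real) \<Rightarrow> real" where
  "limit_mean f = lim (\<lambda>N. vol_mean N f)"

lemma limit_mean_local:
  fixes g :: "(int ^ 'd) set set \<Rightarrow> real"
  assumes "finite F"
  shows "(\<lambda>N. vol_mean N (\<lambda>A. g (A \<inter> F))) \<longlonglongrightarrow> limit_mean (\<lambda>A. g (A \<inter> F))"
  unfolding limit_mean_def using vol_mean_local_convergent[OF assms] by (simp add: convergent_LIMSEQ_iff)

lemma limit_mean_local_nonneg:
  fixes g :: "(int ^ 'd) set set \<Rightarrow> real"
  assumes "finite F" "\<And>B. 0 \<le> g B"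
  shows "0 \<le> limit_mean (\<lambda>A. g (A \<inter> F))"
  by (rule LIMSEQ_le_const[OF limit_mean_local[OF assms(1)]])
    (use vol_mean_le[of "\<lambda>_. 0" "\<lambda>A. g (A \<inter> F)"] assms(2) in \<open>auto simp: vol_mean_const\<close>)

lemma limit_mean_partition:
  fixes g :: "(int ^ 'd) set set \<Rightarrow> real"
  assumes "finite F"
  shows "limit_mean (\<lambda>A. g (A \<inter> F)) = (\<Sum>B\<in>Pow F. g B * limit_mean (\<lambda>A. of_bool (A \<inter> F = B)))"
proof (rule LIMSEQ_unique[OF limit_mean_local[OF assms]])
  have "g (A \<inter> F) = (\<Sum>B\<in>Pow F. g B * of_bool (A \<inter> F = B))" for A
  proof -
    have "(\<Sum>B\<in>Pow F. g B * of_bool (A \<inter> F = B)) = (\<Sum>B\<in>Pow F. if B = A \<inter> F then g B else 0)"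
      by (intro sum.cong refl) auto
    also have "\<dots> = g (A \<inter> F)" using assms by simp
    finally show ?thesis ..
  qed
  then have expand: "(\<lambda>A. g (A \<inter> F)) = (\<lambda>A. \<Sum>B\<in>Pow F. g B * of_bool (A \<inter> F = B))"
    by (rule ext)
  have eq: "vol_mean N (\<lambda>A. g (A \<inter> F)) = (\<Sum>B\<in>Pow F. g B * vol_mean N (\<lambda>A. of_bool (A \<inter> F = B)))" for N
    using assms by (subst expand, subst vol_mean_sum) (simp_all add: vol_mean_cmult)
  show "(\<lambda>N. vol_mean N (\<lambda>A. g (A \<inter> F))) \<longlonglongrightarrow> (\<Sum>B\<in>Pow F. g B * limit_mean (\<lambda>A. of_bool (A \<inter> F = B)))"
    unfolding eq
    by (intro tendsto_sum tendsto_mult_left limit_mean_local[OF assms, of "\<lambda>C. of_bool (C = B)" for B])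
qed

text \<open>Truth values are read as the reals \<open>0\<close> and \<open>1\<close>, so that the marginals live on a Polish space and
  Kolmogorov's extension theorem applies.\<close>

definition real_pattern :: "(int ^ 'd) set set \<Rightarrow> (int ^ 'd) set set \<Rightarrow> (int ^ 'd) set \<Rightarrow> real" where
  "real_pattern F B = (\<lambda>e\<in>F. of_bool (e \<in> B))"

definition marginal :: "(int ^ 'd) set set \<Rightarrow> ((int ^ 'd) set \<Rightarrow> real) measure" where
  "marginal F = distr (point_measure (Pow F) (\<lambda>B. ennreal (limit_mean (\<lambda>A. of_bool (A \<inter> F = B)))))
    (PiM F (\<lambda>_. borel)) (real_pattern F)"

lemma real_pattern_in_space: "real_pattern F B \<in> space (PiM F (\<lambda>_. borel))"
  by (simp add: real_pattern_def space_PiM)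

lemma emeasure_marginal:
  assumes "finite F" "X \<in> sets (PiM F (\<lambda>_. borel))"
  shows "emeasure (marginal F) X = ennreal (limit_mean (\<lambda>A. of_bool (real_pattern F (A \<inter> F) \<in> X)))"
proof -
  let ?p = "\<lambda>B. limit_mean (\<lambda>A. of_bool (A \<inter> F = B))"
  have p0: "0 \<le> ?p B" for B
    using limit_mean_local_nonneg[OF assms(1), of "\<lambda>C. of_bool (C = B)"] by simp
  have "real_pattern F \<in> measurable (point_measure (Pow F) (\<lambda>B. ennreal (?p B))) (PiM F (\<lambda>_. borel))"
    using real_pattern_in_space by (intro measurableI) (auto simp: sets_point_measure space_point_measure)
  then have "emeasure (marginal F) X =
      emeasure (point_measure (Pow F) (\<lambda>B. ennreal (?p B))) (real_pattern F -` X \<inter> Pow F)"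
    unfolding marginal_def using assms(2) by (subst emeasure_distr) (simp_all add: space_point_measure)
  also have "\<dots> = (\<Sum>B\<in>real_pattern F -` X \<inter> Pow F. ennreal (?p B))"
    using assms(1) by (intro emeasure_point_measure_finite) auto
  also have "\<dots> = ennreal (\<Sum>B\<in>real_pattern F -` X \<inter> Pow F. ?p B)"
    using p0 by (intro sum_ennreal) auto
  also have "(\<Sum>B\<in>real_pattern F -` X \<inter> Pow F. ?p B) = (\<Sum>B\<in>Pow F. of_bool (real_pattern F B \<in> X) * ?p B)"
    using assms(1) by (intro sum.mono_neutral_cong_left) auto
  also have "\<dots> = limit_mean (\<lambda>A. of_bool (real_pattern F (A \<inter> F) \<in> X))"
    using limit_mean_partition[OF assms(1), of "\<lambda>B. of_bool (real_pattern F B \<in> X)"] by simp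
  finally show ?thesis .
qed

lemma limit_mean_const: "limit_mean (\<lambda>_. c) = c"
  by (simp add: limit_mean_def vol_mean_const)

lemma sets_marginal [simp]: "sets (marginal F) = sets (PiM F (\<lambda>_. borel))"
  by (simp add: marginal_def)

text \<open>Consistency of the marginals is inherited from the limits of means: a function of the edges in \<open>F\<close> is also
  a function of the edges in \<open>H\<close>.\<close>

lemma polish_projective_marginal: "polish_projective (edges UNIV) marginal"
proof (intro polish_projective.intro projective_family.intro)
  fix F H :: "(int ^ 'd) set set" assume FH: "F \<subseteq> H" "finite H" "H \<subseteq> edges UNIV"
  then have F: "finite F" using finite_subset by blast
  have meas: "(\<lambda>f. restrict f F) \<in> measurable (PiM H (\<lambda>_. borel :: real measure)) (PiM F (\<lambda>_. borel))"
    using FH(1) by (rule measurable_restrict_subset)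
  then have meas': "(\<lambda>f. restrict f F) \<in> measurable (marginal H) (PiM F (\<lambda>_. borel))"
    by (simp cong: measurable_cong_sets)
  show "marginal F = distr (marginal H) (PiM F (\<lambda>_. borel)) (\<lambda>f. restrict f F)"
  proof (rule measure_eqI)
    fix X assume "X \<in> sets (marginal F)"
    then have X: "X \<in> sets (PiM F (\<lambda>_. borel))" by simp
    have sp: "space (marginal H) = space (PiM H (\<lambda>_. borel))" by (simp add: marginal_def)
    have pat: "restrict (real_pattern H (A \<inter> H)) F = real_pattern F (A \<inter> F)" for A
      using FH(1) by (auto simp: real_pattern_def restrict_def fun_eq_iff)
    have "emeasure (distr (marginal H) (PiM F (\<lambda>_. borel)) (\<lambda>f. restrict f F)) X =
        emeasure (marginal H) ((\<lambda>f. restrict f F) -` X \<inter> space (PiM H (\<lambda>_. borel)))"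
      using X meas' by (simp add: emeasure_distr sp)
    also have "\<dots> = ennreal (limit_mean (\<lambda>A. of_bool
        (real_pattern H (A \<inter> H) \<in> (\<lambda>f. restrict f F) -` X \<inter> space (PiM H (\<lambda>_. borel)))))"
      by (rule emeasure_marginal[OF FH(2) measurable_sets[OF meas X]])
    also have "\<dots> = emeasure (marginal F) X"
      using real_pattern_in_space by (simp add: emeasure_marginal[OF F X] pat)
    finally show "emeasure (marginal F) X =
        emeasure (distr (marginal H) (PiM F (\<lambda>_. borel)) (\<lambda>f. restrict f F)) X" ..
  qed simp
next
  fix F :: "(int ^ 'd) set set" assume F: "finite F" "F \<subseteq> edges UNIV"
  show "prob_space (marginal F)"
  proof
    have "emeasure (marginal F) (space (PiM F (\<lambda>_. borel))) = ennreal (limit_mean (\<lambda>A. 1))"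
      using emeasure_marginal[OF F(1) sets.top] real_pattern_in_space by simp
    then show "emeasure (marginal F) (space (marginal F)) = 1"
      by (simp add: limit_mean_const marginal_def)
  qed
qed

lemma limit_measure_exists:
  "\<exists>M. prob_space M \<and> sets M = sets config_space \<and>
    (\<forall>F X. finite F \<longrightarrow> F \<subseteq> edges UNIV \<longrightarrow>
      measure M {\<omega> \<in> space config_space. open_edges F \<omega> \<in> X} = limit_mean (\<lambda>A. of_bool (A \<inter> F \<in> X)))"
proof -
  interpret polish_projective "edges (UNIV :: (int ^ 'd) set)" marginal
    by (rule polish_projective_marginal)
  \<comment> \<open>Reads a real sequence back as a configuration; any threshold strictly between 0 and 1 would do.\<close>
  define \<pi> :: "((int ^ 'd) set \<Rightarrow> real) \<Rightarrow> (int ^ 'd) set \<Rightarrow> bool"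
    where "\<pi> = (\<lambda>x. \<lambda>e\<in>edges UNIV. 1 / 2 < x e)"
  have \<pi>: "\<pi> \<in> measurable lim config_space"
  proof -
    have "\<pi> \<in> measurable (PiM (edges UNIV) (\<lambda>_. borel)) config_space"
      unfolding \<pi>_def config_space_def
      by (intro measurable_restrict) measurable
    then show ?thesis by (simp cong: measurable_cong_sets)
  qed
  define M where "M = distr lim config_space \<pi>"
  show ?thesis
  proof (intro exI[of _ M] conjI allI impI)
    show "prob_space M" unfolding M_def by (rule P.prob_space_distr[OF \<pi>])
    show "sets M = sets config_space" by (simp add: M_def)
    fix F :: "(int ^ 'd) set set" and X assume F: "finite F" "F \<subseteq> edges UNIV"
    define Y where "Y = {y \<in> space (PiM F (\<lambda>_. borel :: real measure)). {e \<in> F. 1 / 2 < y e} \<in> X}"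
    have Y: "Y \<in> sets (PiM F (\<lambda>_. borel))"
    proof -
      have "{y \<in> space (PiM F (\<lambda>_. borel :: real measure)). \<forall>e\<in>F. (1 / 2 < y e) = (e \<in> B)} \<in>
          sets (PiM F (\<lambda>_. borel))" for B
        using F(1) by measurable
      moreover have "Y = (\<Union>B\<in>Pow F \<inter> X.
          {y \<in> space (PiM F (\<lambda>_. borel :: real measure)). \<forall>e\<in>F. (1 / 2 < y e) = (e \<in> B)})"
      proof (intro set_eqI iffI)
        fix y assume "y \<in> Y"
        then show "y \<in> (\<Union>B\<in>Pow F \<inter> X.
          {y \<in> space (PiM F (\<lambda>_. borel :: real measure)). \<forall>e\<in>F. (1 / 2 < y e) = (e \<in> B)})"
          by (intro UN_I[of "{e \<in> F. 1 / 2 < y e}"]) (auto simp: Y_def)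
      next
        fix y assume "y \<in> (\<Union>B\<in>Pow F \<inter> X.
          {y \<in> space (PiM F (\<lambda>_. borel :: real measure)). \<forall>e\<in>F. (1 / 2 < y e) = (e \<in> B)})"
        then obtain B where B: "B \<subseteq> F" "B \<in> X" "y \<in> space (PiM F (\<lambda>_. borel))"
          "\<forall>e\<in>F. (1 / 2 < y e) = (e \<in> B)" by blast
        then have "{e \<in> F. 1 / 2 < y e} = B" by auto
        then show "y \<in> Y" using B by (simp add: Y_def)
      qed
      ultimately show ?thesis using F(1) by (simp add: sets.finite_UN)
    qed
    have "emeasure M {\<omega> \<in> space config_space. open_edges F \<omega> \<in> X} =
        emeasure lim (\<pi> -` {\<omega> \<in> space config_space. open_edges F \<omega> \<in> X} \<inter> space lim)"
      unfolding M_def using \<pi> measurable_open_edges[OF F] by (rule emeasure_distr)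
    also have "\<pi> -` {\<omega> \<in> space config_space. open_edges F \<omega> \<in> X} \<inter> space lim = emb (edges UNIV) F Y"
    proof -
      have "open_edges F (\<pi> x) = {e \<in> F. 1 / 2 < restrict x F e}" for x
        using F(2) by (auto simp: open_edges_def \<pi>_def)
      moreover have "\<pi> x \<in> space config_space" for x
        by (simp add: \<pi>_def space_config)
      ultimately show ?thesis
        unfolding prod_emb_def by (auto simp: Y_def space_PiM)
    qed
    also have "emeasure lim (emb (edges UNIV) F Y) = emeasure (marginal F) Y"
      by (rule emeasure_lim_emb[OF F(2,1) Y])
    also have "\<dots> = ennreal (limit_mean (\<lambda>A. of_bool (real_pattern F (A \<inter> F) \<in> Y)))"
      by (rule emeasure_marginal[OF F(1) Y])
    also have "(\<lambda>A. of_bool (real_pattern F (A \<inter> F) \<in> Y) :: real) = (\<lambda>A. of_bool (A \<inter> F \<in> X))"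
    proof
      fix A
      have "{e \<in> F. 1 / 2 < real_pattern F (A \<inter> F) e} = A \<inter> F" by (auto simp: real_pattern_def)
      then show "of_bool (real_pattern F (A \<inter> F) \<in> Y) = (of_bool (A \<inter> F \<in> X) :: real)"
        using real_pattern_in_space by (simp add: Y_def)
    qed
    finally show "measure M {\<omega> \<in> space config_space. open_edges F \<omega> \<in> X} = limit_mean (\<lambda>A. of_bool (A \<inter> F \<in> X))"
      using limit_mean_local_nonneg[OF F(1), of "\<lambda>B. of_bool (B \<in> X)"] by (simp add: measure_def)
  qed
qed

end

lemma local_as_indicators:
  fixes g :: "(int ^ 'd) set set \<Rightarrow> real"
  assumes "finite F" "\<omega> \<in> space config_space"
  shows "g (open_edges F \<omega>) =
    (\<Sum>B\<in>Pow F. g B * indicator {\<omega> \<in> space config_space. open_edges F \<omega> \<in> {B}} \<omega>)"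
proof -
  have "(\<Sum>B\<in>Pow F. g B * indicator {\<omega> \<in> space config_space. open_edges F \<omega> \<in> {B}} \<omega>) =
      (\<Sum>B\<in>Pow F. if B = open_edges F \<omega> then g B else 0)"
    using assms(2) by (intro sum.cong refl) (auto simp: indicator_def)
  also have "\<dots> = g (open_edges F \<omega>)" using assms(1) by (auto simp: open_edges_def)
  finally show ?thesis ..
qed

lemma integral_local:
  fixes g :: "(int ^ 'd) set set \<Rightarrow> real"
  assumes M: "prob_space M" "sets M = sets config_space" and F: "finite F" "F \<subseteq> edges UNIV"
  shows "integrable M (\<lambda>\<omega>. g (open_edges F \<omega>))"
    and "(\<integral>\<omega>. g (open_edges F \<omega>) \<partial>M) =
      (\<Sum>B\<in>Pow F. g B * measure M {\<omega> \<in> space config_space. open_edges F \<omega> \<in> {B}})"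
proof -
  interpret prob_space M by (rule M)
  have sp: "space M = space config_space" using M(2) by (rule sets_eq_imp_space_eq)
  let ?S = "\<lambda>B. {\<omega> \<in> space config_space. open_edges F \<omega> \<in> {B}}"
  have S: "?S B \<in> sets M" for B unfolding M(2) by (rule measurable_open_edges[OF F])
  then have int: "integrable M (\<lambda>\<omega>. \<Sum>B\<in>Pow F. g B * indicator (?S B) \<omega>)"
    by (intro Bochner_Integration.integrable_sum integrable_mult_right) (auto simp: integrable_indicator_iff emeasure_eq_measure)
  show "integrable M (\<lambda>\<omega>. g (open_edges F \<omega>))"
    using local_as_indicators[OF F(1), of _ g]
    by (subst Bochner_Integration.integrable_cong[OF refl, of M _ "\<lambda>\<omega>. \<Sum>B\<in>Pow F. g B * indicator (?S B) \<omega>"])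
      (simp_all only: sp int)
  have "(\<integral>\<omega>. g (open_edges F \<omega>) \<partial>M) = (\<integral>\<omega>. (\<Sum>B\<in>Pow F. g B * indicator (?S B) \<omega>) \<partial>M)"
    using local_as_indicators[OF F(1), of _ g] by (intro Bochner_Integration.integral_cong) (simp_all only: sp)
  also have "\<dots> = (\<Sum>B\<in>Pow F. \<integral>\<omega>. g B * indicator (?S B) \<omega> \<partial>M)"
    using S by (intro Bochner_Integration.integral_sum integrable_mult_right)
      (auto simp: integrable_indicator_iff emeasure_eq_measure)
  also have "\<dots> = (\<Sum>B\<in>Pow F. g B * measure M (?S B))"
    using sets.sets_into_space[OF S] by (intro sum.cong refl) (simp add: Int_absorb2)
  finally show "(\<integral>\<omega>. g (open_edges F \<omega>) \<partial>M) = (\<Sum>B\<in>Pow F. g B * measure M (?S B))" .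
qed

context fk_model
begin

lemma integral_fk_extended:
  assumes f: "f \<in> borel_measurable config_space"
  shows "(\<integral>\<omega>. f \<omega> \<partial>fk_extended J \<beta> (cube N)) = vol_mean N (\<lambda>A. f (configuration A))"
proof -
  let ?S = "cube N :: (int ^ 'd) set"
  let ?E = "edges ?S"
  let ?\<Omega> = "?E \<rightarrow>\<^sub>E (UNIV :: bool set)"
  define fill where "fill A = (\<lambda>e\<in>?E. e \<in> A)" for A
  define ext where "ext \<omega> = (\<lambda>e\<in>edges UNIV. e \<in> ?E \<and> \<omega> e)" for \<omega>
  define Z where "Z = (\<Sum>\<eta>\<in>?\<Omega>. fk_weight J \<beta> ?S \<eta>)"
  have finE: "finite ?E" by simp
  have fin: "finite ?\<Omega>" by (intro finite_PiE) auto
  have bij: "bij_betw fill (Pow ?E) ?\<Omega>"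
    by (rule bij_betwI[where g = "\<lambda>\<omega>. {e \<in> ?E. \<omega> e}"]) (auto simp: fill_def fun_eq_iff PiE_def extensional_def)
  have ext: "ext (fill A) = configuration A" if "A \<subseteq> ?E" for A
    using that edges_mono[of ?S UNIV] by (auto simp: ext_def fill_def configuration_def fun_eq_iff)
  have wt: "fk_weight J \<beta> ?S (fill A) = 2 ^ clusters ?S (A \<union> {}) * (\<Prod>e\<in>A. edge_weight J \<beta> e)"
    if "A \<subseteq> ?E" for A
  proof -
    have "num_clusters ?S (fill A) = clusters ?S A"
      unfolding clusters_def by (rule num_clusters_cong) (simp add: fill_def)
    moreover have "{e \<in> ?E. fill A e} = A" using that by (auto simp: fill_def)
    ultimately show ?thesis by (simp add: fk_weight_def edge_weight_def)
  qed
  have reindex: "(\<Sum>\<omega>\<in>?\<Omega>. fk_weight J \<beta> ?S \<omega> * h (ext \<omega>)) =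
      fk_sum ?S (edge_weight J \<beta>) {} ?E (\<lambda>A. h (configuration A))" for h
    unfolding fk_sum_def sum.reindex_bij_betw[OF bij, symmetric]
    by (intro sum.cong refl) (simp add: wt ext)
  have Z: "Z = fk_sum ?S (edge_weight J \<beta>) {} ?E (\<lambda>_. 1)"
    using reindex[of "\<lambda>_. 1"] by (simp add: Z_def)
  have Zpos: "0 < Z" unfolding Z by (rule fk_sum_pos) (auto intro: weight_nonneg)
  have w0: "0 \<le> fk_weight J \<beta> ?S \<omega>" for \<omega>
    unfolding fk_weight_def
    by (intro mult_nonneg_nonneg prod_nonneg) (auto dest: weight_nonneg simp: edge_weight_def)
  have "ext \<in> measurable (fk_finite J \<beta> ?S) config_space"
    by (rule measurableI) (auto simp: fk_finite_def space_point_measure sets_point_measure space_config ext_def)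
  then have "(\<integral>\<omega>. f \<omega> \<partial>fk_extended J \<beta> ?S) = (\<integral>\<omega>. f (ext \<omega>) \<partial>fk_finite J \<beta> ?S)"
    unfolding fk_extended_def ext_def[abs_def] using f by (rule integral_distr)
  also have "\<dots> = (\<Sum>\<omega>\<in>?\<Omega>. fk_weight J \<beta> ?S \<omega> / Z * f (ext \<omega>))"
    unfolding fk_finite_def Z_def[symmetric]
    using Zpos w0 by (subst lebesgue_integral_point_measure_finite[OF fin]) auto
  also have "\<dots> = (\<Sum>\<omega>\<in>?\<Omega>. fk_weight J \<beta> ?S \<omega> * f (ext \<omega>)) / Z"
    by (simp add: sum_divide_distrib)
  also have "\<dots> = vol_mean N (\<lambda>A. f (configuration A))"
    unfolding reindex Z vol_mean_def fk_mean_def ..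
  finally show ?thesis .
qed

lemma weak_limit_local:
  fixes g :: "(int ^ 'd) set set \<Rightarrow> real"
  assumes M: "weakly_converges config_topology (\<lambda>N. fk_extended J \<beta> (cube N)) M"
    and F: "finite F" "F \<subseteq> edges UNIV"
  shows "(\<integral>\<omega>. g (open_edges F \<omega>) \<partial>M) = limit_mean (\<lambda>A. g (A \<inter> F))"
proof (rule LIMSEQ_unique[OF _ limit_mean_local[OF F(1)]])
  have "(\<lambda>\<omega>. g (open_edges F \<omega>)) ` topspace config_topology \<subseteq> g ` Pow F"
    by (auto simp: open_edges_def)
  then have "bounded ((\<lambda>\<omega>. g (open_edges F \<omega>)) ` topspace config_topology)"
    using F(1) by (meson bounded_subset finite_Pow_iff finite_imageI finite_imp_bounded)
  then have "(\<lambda>N. \<integral>\<omega>. g (open_edges F \<omega>) \<partial>fk_extended J \<beta> (cube N)) \<longlonglongrightarrow> (\<integral>\<omega>. g (open_edges F \<omega>) \<partial>M)"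
    using M continuous_map_local[OF F, of g] unfolding weakly_converges_def by blast
  then show "(\<lambda>N. vol_mean N (\<lambda>A. g (A \<inter> F))) \<longlonglongrightarrow> (\<integral>\<omega>. g (open_edges F \<omega>) \<partial>M)"
    unfolding integral_fk_extended[OF borel_measurable_local[OF F]] open_edges_configuration[OF F(2)] .
qed

lemma weak_limit_measure_local:
  assumes M: "prob_space M" "sets M = sets config_space"
      "weakly_converges config_topology (\<lambda>N. fk_extended J \<beta> (cube N)) M"
    and F: "finite F" "F \<subseteq> edges UNIV"
  shows "measure M {\<omega> \<in> space config_space. open_edges F \<omega> \<in> X} = limit_mean (\<lambda>A. of_bool (A \<inter> F \<in> X))"
proof -
  interpret prob_space M by (rule M)
  have sp: "space M = space config_space" using M(2) by (rule sets_eq_imp_space_eq)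
  let ?S = "{\<omega> \<in> space config_space. open_edges F \<omega> \<in> X}"
  have "measure M ?S = (\<integral>\<omega>. indicator ?S \<omega> \<partial>M)" by (simp add: sp Int_absorb2 subset_eq)
  also have "\<dots> = (\<integral>\<omega>. of_bool (open_edges F \<omega> \<in> X) \<partial>M)"
    by (intro Bochner_Integration.integral_cong) (auto simp: sp indicator_def)
  also have "\<dots> = limit_mean (\<lambda>A. of_bool (A \<inter> F \<in> X))"
    by (rule weak_limit_local[OF M(3) F, of "\<lambda>B. of_bool (B \<in> X)"])
  finally show ?thesis .
qed

text \<open>Indicators of cylinder events are continuous, so weak convergence determines their probabilities, and
  these events generate the \<open>\<sigma>\<close>-algebra.\<close>

lemma weak_limit_unique:
  assumes M: "prob_space M" "sets M = sets config_space"
      "weakly_converges config_topology (\<lambda>N. fk_extended J \<beta> (cube N)) M"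
    and M': "prob_space M'" "sets M' = sets config_space"
      "weakly_converges config_topology (\<lambda>N. fk_extended J \<beta> (cube N)) M'"
  shows "M = M'"
proof -
  interpret M: prob_space M by (rule M)
  interpret M': prob_space M' by (rule M')
  show ?thesis
  proof (rule measure_eqI_PiM_infinite)
    show "sets M = sets (PiM (edges UNIV) (\<lambda>_. count_space UNIV))"
      "sets M' = sets (PiM (edges UNIV) (\<lambda>_. count_space UNIV))"
      using M(2) M'(2) by (simp_all add: config_space_def)
    show "finite_measure M" by unfold_locales
    fix A :: "(int ^ 'd) set \<Rightarrow> bool set" and F :: "(int ^ 'd) set set"
    assume F: "finite F" "F \<subseteq> edges UNIV"
    have emb: "prod_emb (edges UNIV) (\<lambda>_. count_space UNIV) F (Pi\<^sub>E F A) =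
        {\<omega> \<in> space config_space. open_edges F \<omega> \<in> {B. \<forall>e\<in>F. (e \<in> B) \<in> A e}}"
      using F(2) by (auto simp: prod_emb_def space_config open_edges_def PiE_iff extensional_def)
    show "emeasure M (prod_emb (edges UNIV) (\<lambda>_. count_space UNIV) F (Pi\<^sub>E F A)) =
        emeasure M' (prod_emb (edges UNIV) (\<lambda>_. count_space UNIV) F (Pi\<^sub>E F A))"
      unfolding emb M.emeasure_eq_measure M'.emeasure_eq_measure
        weak_limit_measure_local[OF M F] weak_limit_measure_local[OF M' F] ..
  qed
qed

text \<open>Local functions have convergent means by construction of the limit, and continuous functions are
  uniform limits of local ones.\<close>

lemma weak_limit_exists:
  "\<exists>M. prob_space M \<and> sets M = sets config_space \<and>
    weakly_converges config_topology (\<lambda>N. fk_extended J \<beta> (cube N)) M"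
proof -
  obtain M where M: "prob_space M" "sets M = sets config_space"
    "\<forall>F X. finite F \<longrightarrow> F \<subseteq> edges UNIV \<longrightarrow>
      measure M {\<omega> \<in> space config_space. open_edges F \<omega> \<in> X} = limit_mean (\<lambda>A. of_bool (A \<inter> F \<in> X))"
    using limit_measure_exists by (elim exE conjE)
  interpret prob_space M by (rule M)
  have sp: "space M = space config_space" using M(2) by (rule sets_eq_imp_space_eq)
  have loc: "(\<integral>\<omega>. g (open_edges F \<omega>) \<partial>M) = limit_mean (\<lambda>A. g (A \<inter> F))"
    if F: "finite F" "F \<subseteq> edges UNIV" for F and g :: "(int ^ 'd) set set \<Rightarrow> real"
    unfolding integral_local(2)[OF M(1,2) F] limit_mean_partition[OF F(1)] M(3)[rule_format, OF F] by simp
  have "(\<lambda>N. \<integral>\<omega>. f \<omega> \<partial>fk_extended J \<beta> (cube N)) \<longlonglongrightarrow> (\<integral>\<omega>. f \<omega> \<partial>M)"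
    if f: "continuous_map config_topology euclideanreal f" and bdd: "bounded (f ` topspace config_topology)" for f
    unfolding integral_fk_extended[OF borel_measurable_continuous_config[OF f]]
  proof (rule LIMSEQ_I)
    fix r :: real assume "0 < r"
    then have "0 < r / 3" by simp
    from continuous_uniformly_local[OF f this] obtain F where F: "finite F" "F \<subseteq> edges UNIV"
      "\<forall>\<omega>\<in>edges UNIV \<rightarrow>\<^sub>E UNIV. \<forall>\<omega>'\<in>edges UNIV \<rightarrow>\<^sub>E UNIV. open_edges F \<omega> = open_edges F \<omega>' \<longrightarrow> \<bar>f \<omega> - f \<omega>'\<bar> < r / 3"
      by (elim exE conjE)
    define g where "g B = f (configuration B)" for B
    have self: "open_edges F (configuration (open_edges F \<omega>)) = open_edges F \<omega>" for \<omega>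
      using open_edges_configuration[OF F(2)] by (auto simp: open_edges_def)
    have close: "\<bar>f \<omega> - g (open_edges F \<omega>)\<bar> \<le> r / 3" if "\<omega> \<in> edges UNIV \<rightarrow>\<^sub>E UNIV" for \<omega>
      using F(3)[rule_format, OF that configuration_in_space self[symmetric]] by (simp add: g_def)
    have finite_close: "\<bar>vol_mean N (\<lambda>A. f (configuration A)) - vol_mean N (\<lambda>A. g (A \<inter> F))\<bar> \<le> r / 3" for N
    proof -
      have "\<bar>f (configuration A) - g (A \<inter> F)\<bar> \<le> r / 3" for A
        using close[OF configuration_in_space, of A] by (simp add: open_edges_configuration[OF F(2)])
      then have "f (configuration A) - g (A \<inter> F) \<le> r / 3" "- (r / 3) \<le> f (configuration A) - g (A \<inter> F)" for A
        unfolding abs_le_iff by (smt (verit))+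
      from vol_mean_le[of "\<lambda>A. f (configuration A) - g (A \<inter> F)" "\<lambda>_. r / 3" N, OF this(1)]
        vol_mean_le[of "\<lambda>_. - (r / 3)" "\<lambda>A. f (configuration A) - g (A \<inter> F)" N, OF this(2)]
      show ?thesis unfolding vol_mean_const vol_mean_diff abs_le_iff by linarith
    qed
    obtain B where B: "\<And>x. x \<in> f ` topspace config_topology \<Longrightarrow> norm x \<le> B"
      using bdd unfolding bounded_iff by blast
    have intf: "integrable M f"
      using B borel_measurable_continuous_config[OF f]
      by (intro integrable_const_bound[where B = B])
        (auto simp: sp space_config topspace_config measurable_cong_sets[OF M(2) refl] intro!: AE_I2)
    note intg = integral_local(1)[OF M(1,2) F(1,2), of g]
    have limit_close: "\<bar>(\<integral>\<omega>. f \<omega> \<partial>M) - (\<integral>\<omega>. g (open_edges F \<omega>) \<partial>M)\<bar> \<le> r / 3"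
    proof -
      have "\<bar>(\<integral>\<omega>. f \<omega> \<partial>M) - (\<integral>\<omega>. g (open_edges F \<omega>) \<partial>M)\<bar> = \<bar>\<integral>\<omega>. f \<omega> - g (open_edges F \<omega>) \<partial>M\<bar>"
        using intf intg by simp
      also have "\<dots> \<le> (\<integral>\<omega>. \<bar>f \<omega> - g (open_edges F \<omega>)\<bar> \<partial>M)" by (rule integral_abs_bound)
      also have "\<dots> \<le> r / 3"
        using close intf intg by (intro integral_le_const AE_I2) (auto simp: sp space_config)
      finally show ?thesis .
    qed
    obtain n0 where n0: "\<And>N. n0 \<le> N \<Longrightarrow> norm (vol_mean N (\<lambda>A. g (A \<inter> F)) - limit_mean (\<lambda>A. g (A \<inter> F))) < r / 3"
      using LIMSEQ_D[OF limit_mean_local[OF F(1), of g] \<open>0 < r / 3\<close>] by blast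
    show "\<exists>no. \<forall>n\<ge>no. norm (vol_mean n (\<lambda>A. f (configuration A)) - (\<integral>\<omega>. f \<omega> \<partial>M)) < r"
    proof (intro exI[of _ n0] allI impI)
      fix N assume "n0 \<le> N"
      then have "\<bar>vol_mean N (\<lambda>A. g (A \<inter> F)) - (\<integral>\<omega>. g (open_edges F \<omega>) \<partial>M)\<bar> < r / 3"
        using n0 loc[OF F(1,2), of g] by simp
      then show "norm (vol_mean N (\<lambda>A. f (configuration A)) - (\<integral>\<omega>. f \<omega> \<partial>M)) < r"
        using finite_close[of N] limit_close unfolding real_norm_def by linarith
    qed
  qed
  then show ?thesis using M(1,2) unfolding weakly_converges_def by blast
qed

theorem fk_is_weak_limit:
  shows "prob_space (fk J \<beta>)" "sets (fk J \<beta>) = sets config_space"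
    "weakly_converges config_topology (\<lambda>N. fk_extended J \<beta> (cube N)) (fk J \<beta>)"
proof -
  have "\<exists>!M. prob_space M \<and> sets M = sets config_space \<and>
    weakly_converges config_topology (\<lambda>N. fk_extended J \<beta> (cube N)) M"
    by (rule ex_ex1I[OF weak_limit_exists], rule weak_limit_unique) simp_all
  from theI'[OF this, folded fk_def] show "prob_space (fk J \<beta>)" "sets (fk J \<beta>) = sets config_space"
    "weakly_converges config_topology (\<lambda>N. fk_extended J \<beta> (cube N)) (fk J \<beta>)" by simp_all
qed

end

section \<open>Connection probabilities in infinite volume\<close>

text \<open>A path is finite.\<close>

lemma linked_in_some_cube:
  assumes "linked UNIV \<omega> x y"
  shows "\<exists>n. linked (cube n) \<omega> x y"
  using assms unfolding linked_def[of UNIV]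
proof (induction rule: rtranclp_induct)
  case base
  show ?case by (rule exI[of _ 0]) simp
next
  case (step y z)
  then obtain n where n: "linked (cube n) \<omega> x y" by blast
  obtain m where m: "{y, z} \<subseteq> cube m" using finite_subset_cube[of "{y, z}"] by auto
  define k where "k = max n m"
  have l1: "linked (cube k) \<omega> x y"
    using n by (rule linked_mono) (simp_all add: k_def cube_mono)
  have l2: "linked (cube k) \<omega> y z"
    using step.hyps(2) m cube_mono[of m k] unfolding linked_def by (intro r_into_rtranclp) (auto simp: k_def)
  show ?case using linked_trans[OF l1 l2] by (rule exI)
qed

lemma connection_local:
  "connection S x y = {\<omega> \<in> space config_space. open_edges (edges S) \<omega> \<in> {B. joined S B x y}}"
proof -
  have "linked S \<omega> x y \<longleftrightarrow> joined S (open_edges (edges S) \<omega>) x y" for \<omega>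
    unfolding joined_def by (rule linked_cong) (simp add: open_edges_def)
  then show ?thesis by (simp add: connection_def)
qed

lemma joined_restrict: "joined S (A \<inter> edges S) x y \<longleftrightarrow> joined S A x y"
  unfolding joined_def by (rule linked_cong) simp

context fk_model
begin

sublocale fk: prob_space "fk J \<beta>"
  by (rule fk_is_weak_limit)

abbreviation conn_prob :: "(int ^ 'd) set \<Rightarrow> int ^ 'd \<Rightarrow> real" where
  "conn_prob S x \<equiv> measure (fk J \<beta>) (connection S 0 x)"

lemma sets_connection:
  assumes "finite S"
  shows "connection S x y \<in> sets (fk J \<beta>)"
  unfolding connection_local fk_is_weak_limit(2)
  by (rule measurable_open_edges) (use assms edges_mono[of S UNIV] in auto)

lemma conn_prob_limit:
  assumes "finite S"
  shows "(\<lambda>N. vol_mean N (\<lambda>A. of_bool (joined S A 0 x))) \<longlonglongrightarrow> conn_prob S x"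
proof -
  have fin: "finite (edges S)" using assms by simp
  have "conn_prob S x = limit_mean (\<lambda>A. of_bool (A \<inter> edges S \<in> {B. joined S B 0 x}))"
    unfolding connection_local
    by (rule weak_limit_measure_local[OF fk_is_weak_limit fin]) (simp add: edges_mono)
  then show ?thesis
    using limit_mean_local[OF fin, of "\<lambda>B. of_bool (joined S B 0 x)"] by (simp add: joined_restrict)
qed

lemma two_point_as_vol_mean: "two_point J \<beta> (cube N) x y = vol_mean N (\<lambda>A. of_bool (joined (cube N) A x y))"
  by (simp add: two_point_def fk_two_def vol_mean_def)

text \<open>Connection inside the cube is an increasing event, so its probability grows with the volume in which the
  measure lives.\<close>

lemma two_point_le_conn_prob: "two_point J \<beta> (cube n) 0 x \<le> conn_prob (cube n) x"
proof (rule LIMSEQ_le_const[OF conn_prob_limit])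
  show "\<exists>N. \<forall>k\<ge>N. two_point J \<beta> (cube n) 0 x \<le> vol_mean k (\<lambda>A. of_bool (joined (cube n) A 0 x))"
    unfolding two_point_as_vol_mean
    by (intro exI[of _ n] allI impI vol_mean_mono_volume) (auto intro: joined_mono)
qed simp

lemma conn_prob_mono: "S \<subseteq> T \<Longrightarrow> finite T \<Longrightarrow> conn_prob S x \<le> conn_prob T x"
  by (intro fk.finite_measure_mono sets_connection) (auto simp: connection_def intro: linked_mono)

lemma connection_UNIV: "connection UNIV 0 x = (\<Union>n. connection (cube n) 0 x)"
  using linked_in_some_cube[of _ 0 x] linked_mono[of "cube _" _ 0 x UNIV] by (auto simp: connection_def)

lemma sets_connection_UNIV: "connection UNIV 0 x \<in> sets (fk J \<beta>)"
  unfolding connection_UNIV by (intro sets.countable_UN) (auto intro: sets_connection)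

lemma conn_prob_UNIV_limit: "(\<lambda>n. conn_prob (cube n) x) \<longlonglongrightarrow> conn_prob UNIV x"
  unfolding connection_UNIV
proof (rule fk.finite_Lim_measure_incseq)
  show "range (\<lambda>n. connection (cube n) 0 x) \<subseteq> sets (fk J \<beta>)" by (auto intro: sets_connection)
  show "incseq (\<lambda>n. connection (cube n) 0 x)"
    by (auto simp: incseq_def connection_def intro: linked_mono[OF _ cube_mono])
qed

lemma conn_prob_le_UNIV: "conn_prob (cube n) x \<le> conn_prob UNIV x"
  by (intro fk.finite_measure_mono sets_connection_UNIV) (auto simp: connection_UNIV)

text \<open>Finite-volume bounds pass to the infinite volume: a path from the origin to \<open>x\<close> lies in some cube, and the
  connection inside that cube is implied, in all larger volumes, to be no more likely than the full connection there.\<close>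

lemma weighted_conn_prob_le:
  assumes X: "finite X" and c: "\<And>x. 0 \<le> c x"
    and K: "\<And>N. X \<subseteq> cube N \<Longrightarrow> (\<Sum>x\<in>X. c x * two_point J \<beta> (cube N) 0 x) \<le> K"
  shows "(\<Sum>x\<in>X. c x * conn_prob UNIV x) \<le> K"
proof (rule LIMSEQ_le_const2)
  show "(\<lambda>n. \<Sum>x\<in>X. c x * conn_prob (cube n) x) \<longlonglongrightarrow> (\<Sum>x\<in>X. c x * conn_prob UNIV x)"
    by (intro tendsto_sum tendsto_mult_left conn_prob_UNIV_limit)
  have "(\<Sum>x\<in>X. c x * conn_prob (cube n) x) \<le> K" for n
  proof (rule LIMSEQ_le_const2)
    show "(\<lambda>N. \<Sum>x\<in>X. c x * vol_mean N (\<lambda>A. of_bool (joined (cube n) A 0 x))) \<longlonglongrightarrow>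
        (\<Sum>x\<in>X. c x * conn_prob (cube n) x)"
      by (intro tendsto_sum tendsto_mult_left conn_prob_limit) simp
    obtain m where m: "X \<subseteq> cube m" using finite_subset_cube[OF X] by blast
    have "(\<Sum>x\<in>X. c x * vol_mean N (\<lambda>A. of_bool (joined (cube n) A 0 x))) \<le> K" if "max n m \<le> N" for N
    proof -
      have "n \<le> N" "X \<subseteq> cube N" using that m cube_mono[of m N] by auto
      have "(\<Sum>x\<in>X. c x * vol_mean N (\<lambda>A. of_bool (joined (cube n) A 0 x))) \<le>
          (\<Sum>x\<in>X. c x * two_point J \<beta> (cube N) 0 x)"
        unfolding two_point_as_vol_mean
        using cube_mono[OF \<open>n \<le> N\<close>] c
        by (intro sum_mono mult_left_mono vol_mean_le) (auto intro: joined_mono)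
      also have "\<dots> \<le> K" by (rule K) fact
      finally show ?thesis .
    qed
    then show "\<exists>N. \<forall>k\<ge>N. (\<Sum>x\<in>X. c x * vol_mean k (\<lambda>A. of_bool (joined (cube n) A 0 x))) \<le> K" by blast
  qed
  then show "\<exists>N. \<forall>n\<ge>N. (\<Sum>x\<in>X. c x * conn_prob (cube n) x) \<le> K" by blast
qed

lemma G_fun_eq_SUP:
  "G_fun J \<beta> t = (SUP X\<in>{X. finite X \<and> X \<subseteq> UNIV}. ennreal (\<Sum>x\<in>X. tilt t x * conn_prob UNIV x))"
proof -
  have "G_fun J \<beta> t = (SUP X\<in>{X. finite X \<and> X \<subseteq> UNIV}. \<Sum>x\<in>X. ennreal (tilt t x * conn_prob UNIV x))"
    unfolding G_fun_def tilt_def by (rule nonneg_infsum_complete) simp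
  then show ?thesis by (simp add: sum_ennreal)
qed

lemma sum_le_G_fun:
  assumes "finite X"
  shows "ennreal (\<Sum>x\<in>X. tilt t x * conn_prob UNIV x) \<le> G_fun J \<beta> t"
  unfolding G_fun_eq_SUP by (rule SUP_upper) (use assms in simp)

lemma G_fun_finite_if_boundary_sum_less_1:
  assumes "(\<lambda>z. tilt t z * J z) summable_on UNIV" "finite S" "0 \<in> S" "boundary_sum J t \<beta> S < 1"
  shows "G_fun J \<beta> t < \<infinity>"
proof -
  define K where "K = (\<Sum>x\<in>S. tilt t x) / (1 - boundary_sum J t \<beta> S)"
  have "(\<Sum>x\<in>X. tilt t x * conn_prob UNIV x) \<le> K" if "finite X" for X
  proof (rule weighted_conn_prob_le[OF that tilt_nonneg])
    fix N assume "X \<subseteq> cube N"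
    then have "(\<Sum>x\<in>X. tilt t x * two_point J \<beta> (cube N) 0 x) \<le> (\<Sum>x\<in>cube N. tilt t x * two_point J \<beta> (cube N) 0 x)"
      using two_point_nonneg \<beta>_nonneg by (intro sum_mono2) auto
    also have "\<dots> \<le> K"
      unfolding K_def by (rule susceptibility_le) (use assms \<beta>_nonneg in auto)
    finally show "(\<Sum>x\<in>X. tilt t x * two_point J \<beta> (cube N) 0 x) \<le> K" .
  qed
  then have "G_fun J \<beta> t \<le> ennreal K"
    unfolding G_fun_eq_SUP by (intro SUP_least ennreal_leI) auto
  also have "\<dots> < \<infinity>" by simp
  finally show ?thesis .
qed

text \<open>This is \<open>tanh (\<beta> J x / 2)\<close>, the connection probability of two points joined by a single available edge.\<close>

definition bond :: "int ^ 'd \<Rightarrow> real" where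
  "bond x = (exp (\<beta> * J x) - 1) / (exp (\<beta> * J x) + 1)"

lemma bond_nonneg: "0 \<le> bond x"
  using \<beta>_nonneg J_nonneg[of x] by (simp add: bond_def)

lemma bond_even: "bond (- x) = bond x"
  by (simp add: bond_def J_even)

lemma bond_le_conn_prob:
  assumes "x \<noteq> 0"
  shows "bond x \<le> conn_prob UNIV x"
proof -
  obtain n where n: "{0, x} \<subseteq> cube n" using finite_subset_cube[of "{0, x}"] by auto
  let ?V = "cube n" and ?w = "edge_weight J \<beta>"
  have not_joined: "\<not> joined ?V {} 0 x"
    using assms unfolding joined_def linked_def by (auto elim: converse_rtranclpE)
  have "fk_two ?V ?w {} 0 x = fk_mean ?V ?w {} (\<lambda>_. 0)"
    unfolding fk_two_def using not_joined by (intro fk_mean_cong) auto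
  then have zero: "fk_two ?V ?w {} 0 x = 0" using fk_mean_const[of "{}" ?w ?V 0] by simp
  have one: "fk_two ?V ?w {} x x = 1" by (rule fk_two_self) auto
  have wt: "?w {0, x} = exp (\<beta> * J x) - 1" by (simp add: edge_weight_pair)
  have "fk_two ?V ?w {{0, x}} 0 x * (1 + ?w {0, x} / (2 + ?w {0, x}) * fk_two ?V ?w {} 0 x) =
      fk_two ?V ?w {} 0 x + ?w {0, x} / (2 + ?w {0, x}) * fk_two ?V ?w {} x x"
    by (rule fk_two_insert) (use n assms \<beta>_nonneg J_nonneg wt in auto)
  then have "fk_two ?V ?w {{0, x}} 0 x = bond x" by (simp add: zero one wt bond_def add.commute)
  moreover have "fk_two ?V ?w {{0, x}} 0 x \<le> two_point J \<beta> ?V 0 x"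
    unfolding two_point_def using n assms by (intro fk_two_mono_edges) (auto intro: weight_nonneg)
  ultimately show ?thesis
    using two_point_le_conn_prob[of n x] conn_prob_le_UNIV[of n x] by linarith
qed

lemma bond_lower_bound:
  assumes "bond x < 1 / 2"
  shows "\<beta> * J x \<le> 4 * bond x"
proof -
  define s where "s = \<beta> * J x"
  have s: "0 \<le> s" using \<beta>_nonneg J_nonneg by (simp add: s_def)
  have "exp s < 3" using assms by (simp add: bond_def s_def[symmetric] divide_less_eq add_pos_pos)
  have "s \<le> exp s - 1" using exp_ge_add_one_self[of s] by linarith
  also have "\<dots> = (exp s + 1) * bond x"
    using add_pos_pos[OF exp_gt_zero[of s] zero_less_one] by (simp add: bond_def s_def[symmetric])
  also have "\<dots> \<le> 4 * bond x" using \<open>exp s < 3\<close> bond_nonneg by (intro mult_right_mono) auto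
  finally show ?thesis by (simp add: s_def)
qed

text \<open>A finite \<open>G\<close>-function forces the tilted couplings to be summable, because \<open>0\<close> and \<open>z\<close> are connected
  with probability at least \<open>tanh (\<beta> J z / 2)\<close>. This is comparable with \<open>J z\<close> where \<open>J z\<close> is bounded;
  the evenness of \<open>J\<close> gives \<open>(\<Sum>z\<in>X. tanh (\<beta> J z / 2)) \<le> G\<close> for all finite \<open>X\<close> even where the tilt is small, so \<open>J z\<close> is large for
  only finitely many \<open>z\<close>.\<close>

lemma tilted_coupling_summable:
  assumes "J 0 = 0" "0 < \<beta>" "G_fun J \<beta> t < \<infinity>"
  shows "(\<lambda>z. tilt t z * J z) summable_on UNIV"
proof -
  obtain K where K: "G_fun J \<beta> t = ennreal K" "0 \<le> K"
    using assms(3) by (cases "G_fun J \<beta> t") auto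
  have tilted: "(\<Sum>x\<in>X. tilt t x * bond x) \<le> K" if "finite X" for X
  proof -
    have "(\<Sum>x\<in>X. tilt t x * bond x) \<le> (\<Sum>x\<in>X. tilt t x * conn_prob UNIV x)"
    proof (intro sum_mono mult_left_mono)
      fix x show "bond x \<le> conn_prob UNIV x"
        using bond_le_conn_prob[of x] assms(1) by (cases "x = 0") (simp_all add: bond_def)
    qed simp
    also have "\<dots> \<le> K" using sum_le_G_fun[OF that, of t] K by simp
    finally show ?thesis .
  qed
  have plain: "(\<Sum>x\<in>X. bond x) \<le> K" if "finite X" for X
  proof -
    \<comment> \<open>Pairing \<open>x\<close> with \<open>- x\<close> removes the tilt, since \<open>a + 1 / a \<ge> 2\<close>.\<close>
    have two: "2 \<le> tilt t x + tilt t (- x)" for x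
    proof -
      have "0 \<le> (tilt t x - 1)\<^sup>2 / tilt t x" by simp
      also have "\<dots> = tilt t x + tilt t (- x) - 2"
        by (simp add: tilt_minus power2_eq_square field_simps less_imp_neq[OF tilt_pos, symmetric])
      finally show ?thesis by simp
    qed
    have "2 * (\<Sum>x\<in>X. bond x) \<le> (\<Sum>x\<in>X. (tilt t x + tilt t (- x)) * bond x)"
      unfolding sum_distrib_left using two bond_nonneg by (intro sum_mono mult_right_mono)
    also have "\<dots> = (\<Sum>x\<in>X. tilt t x * bond x) + (\<Sum>x\<in>X. tilt t (- x) * bond (- x))"
      by (simp add: sum.distrib distrib_right bond_even)
    also have "(\<Sum>x\<in>X. tilt t (- x) * bond (- x)) = (\<Sum>x\<in>uminus ` X. tilt t x * bond x)"
      by (subst sum.reindex) (auto simp: inj_on_def)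
    also have "(\<Sum>x\<in>X. tilt t x * bond x) + \<dots> \<le> K + K"
      using that by (intro add_mono tilted) auto
    finally show ?thesis by simp
  qed
  define B where "B = {x. 1 / 2 \<le> bond x}"
  have finB: "finite B"
  proof (rule ccontr)
    assume "infinite B"
    then obtain X where X: "X \<subseteq> B" "finite X" "card X = Suc (nat \<lceil>2 * K\<rceil>)"
      using infinite_arbitrarily_large by blast
    have "real (card X) * (1 / 2) \<le> (\<Sum>x\<in>X. bond x)"
      using X(1) sum_mono[of X "\<lambda>_. 1 / 2" bond] by (auto simp: B_def)
    also have "\<dots> \<le> K" using plain X(2) by blast
    finally show False using X(3) by linarith
  qed
  show ?thesis
  proof (rule nonneg_bdd_above_summable_on)
    show "bdd_above (sum (\<lambda>z. tilt t z * J z) ` {X. X \<subseteq> UNIV \<and> finite X})"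
    proof (rule bdd_aboveI2)
      fix X assume X: "X \<in> {X. X \<subseteq> (UNIV :: (int ^ 'd) set) \<and> finite X}"
      have "(\<Sum>z\<in>X. tilt t z * J z) \<le> (\<Sum>z\<in>B \<union> X. tilt t z * J z)"
        using X finB J_nonneg by (intro sum_mono2) auto
      also have "\<dots> = (\<Sum>z\<in>B. tilt t z * J z) + (\<Sum>z\<in>X - B. tilt t z * J z)"
        using X finB sum.subset_diff[of B "B \<union> X" "\<lambda>z. tilt t z * J z"]
        by (simp add: Un_Diff add.commute)
      also have "(\<Sum>z\<in>X - B. tilt t z * J z) \<le> (\<Sum>z\<in>X - B. 4 / \<beta> * (tilt t z * bond z))"
      proof (rule sum_mono)
        fix z assume "z \<in> X - B"
        then have "\<beta> * J z \<le> 4 * bond z" by (intro bond_lower_bound) (simp add: B_def)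
        then have "J z \<le> 4 / \<beta> * bond z" using assms(2) by (simp add: field_simps)
        then have "tilt t z * J z \<le> tilt t z * (4 / \<beta> * bond z)" by (intro mult_left_mono) auto
        then show "tilt t z * J z \<le> 4 / \<beta> * (tilt t z * bond z)" by (simp add: mult_ac)
      qed
      also have "\<dots> = 4 / \<beta> * (\<Sum>z\<in>X - B. tilt t z * bond z)" by (rule sum_distrib_left[symmetric])
      also have "\<dots> \<le> 4 / \<beta> * K" using X assms(2) by (intro mult_left_mono tilted) auto
      finally show "(\<Sum>z\<in>X. tilt t z * J z) \<le> (\<Sum>z\<in>B. tilt t z * J z) + 4 / \<beta> * K" by simp
    qed
  qed (use J_nonneg in auto)
qed

end

section \<open>Divergence at the saturation point\<close>

text \<open>The maximum norm on the lattice, described through its balls, which are the cubes.\<close>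

definition sup_norm :: "int ^ 'd \<Rightarrow> nat" where
  "sup_norm x = (LEAST n. x \<in> cube n)"

lemma in_cube_iff: "x \<in> cube n \<longleftrightarrow> sup_norm x \<le> n"
proof
  show "x \<in> cube n \<Longrightarrow> sup_norm x \<le> n" unfolding sup_norm_def by (rule Least_le)
  have "x \<in> cube (sup_norm x)" unfolding sup_norm_def using in_some_cube by (rule LeastI_ex)
  then show "sup_norm x \<le> n \<Longrightarrow> x \<in> cube n" using cube_mono by blast
qed

lemma sup_norm_triangle: "sup_norm (x + z) \<le> sup_norm x + sup_norm z"
proof -
  have "x \<in> cube (sup_norm x)" "z \<in> cube (sup_norm z)" by (simp_all add: in_cube_iff)
  then have "- int (sup_norm x) \<le> x $ k \<and> x $ k \<le> int (sup_norm x)"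
    "- int (sup_norm z) \<le> z $ k \<and> z $ k \<le> int (sup_norm z)" for k
    by (simp_all add: cube_def)
  then have "- int (sup_norm x + sup_norm z) \<le> (x + z) $ k \<and> (x + z) $ k \<le> int (sup_norm x + sup_norm z)" for k
    by (smt (verit) of_nat_add vector_add_component)
  then have "x + z \<in> cube (sup_norm x + sup_norm z)" by (simp add: cube_def)
  then show ?thesis by (simp add: in_cube_iff)
qed

lemma has_sum_finite_sum:
  fixes f :: "'a \<Rightarrow> 'b \<Rightarrow> real"
  assumes "finite I" "\<And>i. i \<in> I \<Longrightarrow> f i summable_on A"
  shows "((\<lambda>x. \<Sum>i\<in>I. f i x) has_sum (\<Sum>i\<in>I. infsum (f i) A)) A"
  using assms
proof (induction I rule: finite_induct)
  case (insert i I)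
  then have "((\<lambda>x. f i x + (\<Sum>i\<in>I. f i x)) has_sum (infsum (f i) A + (\<Sum>i\<in>I. infsum (f i) A))) A"
    by (intro has_sum_add has_sum_infsum) auto
  then show ?case using insert.hyps by simp
qed simp

context ferromagnet
begin

lemma isCont_two_point:
  assumes "finite S" "0 \<le> b"
  shows "isCont (\<lambda>\<beta>. two_point J \<beta> S x y) b"
proof -
  have cont: "isCont (\<lambda>\<beta>. fk_sum S (edge_weight J \<beta>) {} (edges S) f) b" for f
    unfolding fk_sum_def edge_weight_def by (intro continuous_intros)
  have "0 < fk_sum S (edge_weight J b) {} (edges S) (\<lambda>_. 1)"
    by (rule fk_sum_pos) (use assms edge_weight_nonneg in auto)
  then show ?thesis
    unfolding two_point_def fk_two_def fk_mean_def using cont by (intro isCont_divide) auto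
qed

lemma isCont_boundary_sum:
  assumes "finite S" "0 \<le> b"
  shows "isCont (\<lambda>\<beta>. boundary_sum J t \<beta> S) b"
  unfolding boundary_sum_def by (intro continuous_intros isCont_two_point assms)

text \<open>For finite \<open>S\<close> the boundary sum is a continuous function of the inverse temperature. If it were below one at
  the saturation point, it would still be below one slightly above it, and the generating function
  would be finite there.\<close>

lemma boundary_sum_ge_1_at_saturation:
  assumes "J 0 = 0" and b: "beta_sat J t = ereal b" "0 < b" and S: "finite S" "0 \<in> S"
  shows "(\<lambda>z. tilt t z * J z) summable_on UNIV" "1 \<le> boundary_sum J t b S"
proof -
  have "ereal 0 < beta_sat J t" using b by simp
  then obtain \<beta>0 where \<beta>0: "0 \<le> \<beta>0" "G_fun J \<beta>0 t < \<infinity>" "0 < \<beta>0"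
    unfolding beta_sat_def less_SUP_iff by auto
  interpret m0: fk_model J \<beta>0 by unfold_locales (rule \<beta>0)
  show summ: "(\<lambda>z. tilt t z * J z) summable_on UNIV"
    by (rule m0.tilted_coupling_summable) fact+
  show "1 \<le> boundary_sum J t b S"
  proof (rule ccontr)
    assume "\<not> 1 \<le> boundary_sum J t b S"
    then have "boundary_sum J t b S < 1" by simp
    then have "\<forall>\<^sub>F \<beta> in at b. boundary_sum J t \<beta> S < 1"
      using isCont_boundary_sum[OF S(1), of b t] b(2) by (intro order_tendstoD(2)[of _ "boundary_sum J t b S"]) (auto simp: isCont_def)
    then obtain d where d: "0 < d" "\<And>\<beta>. \<beta> \<noteq> b \<Longrightarrow> dist \<beta> b < d \<Longrightarrow> boundary_sum J t \<beta> S < 1"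
      unfolding eventually_at by auto
    define \<beta>1 where "\<beta>1 = b + d / 2"
    have \<beta>1: "b < \<beta>1" "0 \<le> \<beta>1" "boundary_sum J t \<beta>1 S < 1"
      using d(1) b(2) by (auto simp: \<beta>1_def dist_real_def intro!: d(2))
    interpret m1: fk_model J \<beta>1 by unfold_locales (rule \<beta>1)
    have "G_fun J \<beta>1 t < \<infinity>"
      by (rule m1.G_fun_finite_if_boundary_sum_less_1[OF summ S \<beta>1(3)])
    then have "ereal \<beta>1 \<le> beta_sat J t"
      unfolding beta_sat_def using \<beta>1(2) by (intro SUP_upper) simp
    then show False using b(1) \<beta>1(1) by simp
  qed
qed

end

context fk_model
begin

text \<open>The sum that the final theorem bounds from below, with the connection restricted to the box but the
  measure taken in infinite volume.\<close>

definition box_susceptibility :: "real ^ 'd \<Rightarrow> nat \<Rightarrow> real" where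
  "box_susceptibility t N = (\<Sum>x\<in>cube N. tilt t x * conn_prob (cube N) x)"

lemma box_susceptibility_nonneg: "0 \<le> box_susceptibility t N"
  unfolding box_susceptibility_def by (intro sum_nonneg) auto

lemma box_susceptibility_le_G_fun: "ennreal (box_susceptibility t N) \<le> G_fun J \<beta> t"
proof -
  have "box_susceptibility t N \<le> (\<Sum>x\<in>cube N. tilt t x * conn_prob UNIV x)"
    unfolding box_susceptibility_def by (intro sum_mono mult_left_mono conn_prob_le_UNIV) auto
  then show ?thesis using sum_le_G_fun[OF finite_cube, of t N] ennreal_leI order_trans by blast
qed

lemma box_susceptibility_mono:
  assumes "N \<le> M"
  shows "box_susceptibility t N \<le> box_susceptibility t M"
proof -
  have "box_susceptibility t N \<le> (\<Sum>x\<in>cube N. tilt t x * conn_prob (cube M) x)"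
    unfolding box_susceptibility_def using cube_mono[OF assms]
    by (intro sum_mono mult_left_mono conn_prob_mono) auto
  also have "\<dots> \<le> box_susceptibility t M"
    unfolding box_susceptibility_def using cube_mono[OF assms] by (intro sum_mono2) auto
  finally show ?thesis .
qed

lemma truncated_moment_summable:
  assumes "(\<lambda>z. tilt t z * J z) summable_on UNIV"
  shows "(\<lambda>z. tilt t z * J z * real (min (sup_norm z) N)) summable_on UNIV"
proof (rule summable_on_comparison_test)
  show "(\<lambda>z. tilt t z * J z * real N) summable_on UNIV" using assms by (rule summable_on_cmult_left)
qed (use J_nonneg in \<open>auto intro!: mult_left_mono\<close>)

text \<open>The inequalities \<open>1 \<le> boundary_sum J t \<beta> (cube n)\<close> are added over \<open>n = 1, \<dots>, N\<close>. A jump from \<open>x\<close> by \<open>z\<close> leaves \<open>cube n\<close> only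
  if \<open>sup_norm x \<le> n < sup_norm (x + z)\<close>, hence for at most \<open>min (sup_norm z) N\<close> of these \<open>n\<close>, whatever \<open>x\<close> is.\<close>

lemma averaged_boundary_sum:
  assumes summ: "(\<lambda>z. tilt t z * J z) summable_on UNIV"
    and ge: "\<And>n. 1 \<le> boundary_sum J t \<beta> (cube n)"
  shows "real N \<le> \<beta> * box_susceptibility t N * (\<Sum>\<^sub>\<infinity>z. tilt t z * J z * real (min (sup_norm z) N))"
proof -
  let ?k = "\<lambda>z. tilt t z * J z"
  let ?\<kappa> = "\<Sum>\<^sub>\<infinity>z. ?k z * real (min (sup_norm z) N)"
  define f where "f x = tilt t x * conn_prob (cube N) x" for x
  have f0: "0 \<le> f x" for x by (simp add: f_def)
  have k0: "0 \<le> ?k z" for z using J_nonneg by simp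
  define cross where "cross n x z = (of_bool (x \<in> cube n \<and> x + z \<notin> cube n) :: real)" for n x and z :: "int ^ 'd"
  have cross_summ: "(\<lambda>z. ?k z * cross n x z) summable_on UNIV" for n x
    by (rule summable_on_comparison_test[OF summ]) (use J_nonneg in \<open>auto simp: cross_def\<close>)
  have escape_cross: "of_bool (x \<in> cube n) * escape J t (cube n) x = (\<Sum>\<^sub>\<infinity>z. ?k z * cross n x z)" for n x
  proof (cases "x \<in> cube n")
    case True
    then have "(\<Sum>\<^sub>\<infinity>z. ?k z * cross n x z) = escape J t (cube n) x"
      unfolding escape_def by (intro infsum_cong_neutral) (auto simp: cross_def)
    then show ?thesis using True by simp
  qed (simp add: cross_def)
  have count: "(\<Sum>n\<in>{1..N}. cross n x z) \<le> real (min (sup_norm z) N)" for x z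
  proof -
    have "(\<Sum>n\<in>{1..N}. cross n x z) = real (card {n \<in> {1..N}. x \<in> cube n \<and> x + z \<notin> cube n})"
      by (simp add: cross_def sum.inter_filter[symmetric] of_bool_def if_distrib)
    also have "card {n \<in> {1..N}. x \<in> cube n \<and> x + z \<notin> cube n} \<le> min (sup_norm z) N"
    proof (rule min.boundedI)
      have "{n \<in> {1..N}. x \<in> cube n \<and> x + z \<notin> cube n} \<subseteq> {sup_norm x..<sup_norm (x + z)}"
        by (auto simp: in_cube_iff)
      from card_mono[OF _ this] show "card {n \<in> {1..N}. x \<in> cube n \<and> x + z \<notin> cube n} \<le> sup_norm z"
        using sup_norm_triangle[of x z] by simp
      show "card {n \<in> {1..N}. x \<in> cube n \<and> x + z \<notin> cube n} \<le> N"
        using card_mono[of "{1..N}" "{n \<in> {1..N}. x \<in> cube n \<and> x + z \<notin> cube n}"] by (simp add: subset_eq)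
    qed
    finally show ?thesis by simp
  qed
  have total: "(\<Sum>n\<in>{1..N}. of_bool (x \<in> cube n) * escape J t (cube n) x) \<le> ?\<kappa>" for x
  proof -
    have swap: "((\<lambda>z. \<Sum>n\<in>{1..N}. ?k z * cross n x z) has_sum (\<Sum>n\<in>{1..N}. \<Sum>\<^sub>\<infinity>z. ?k z * cross n x z)) UNIV"
      by (rule has_sum_finite_sum[OF _ cross_summ]) simp
    then have "(\<Sum>n\<in>{1..N}. of_bool (x \<in> cube n) * escape J t (cube n) x) = (\<Sum>\<^sub>\<infinity>z. \<Sum>n\<in>{1..N}. ?k z * cross n x z)"
      unfolding escape_cross by (rule infsumI[symmetric])
    also have "\<dots> \<le> ?\<kappa>"
    proof (rule infsum_mono)
      show "(\<lambda>z. \<Sum>n\<in>{1..N}. ?k z * cross n x z) summable_on UNIV"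
        using swap by (rule has_sum_imp_summable)
      show "(\<lambda>z. ?k z * real (min (sup_norm z) N)) summable_on UNIV"
        by (rule truncated_moment_summable[OF summ])
      show "(\<Sum>n\<in>{1..N}. ?k z * cross n x z) \<le> ?k z * real (min (sup_norm z) N)" for z
        unfolding sum_distrib_left[symmetric] by (rule mult_left_mono[OF count k0])
    qed
    finally show ?thesis .
  qed
  have one: "1 \<le> \<beta> * (\<Sum>x\<in>cube N. f x * (of_bool (x \<in> cube n) * escape J t (cube n) x))" if "n \<in> {1..N}" for n
  proof -
    have sub: "cube n \<subseteq> cube N" using that by (intro cube_mono) auto
    have "1 \<le> boundary_sum J t \<beta> (cube n)" by (rule ge)
    also have "\<dots> \<le> \<beta> * (\<Sum>x\<in>cube n. f x * escape J t (cube n) x)"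
      unfolding boundary_sum_def f_def
      using two_point_le_conn_prob[of n] conn_prob_mono[OF sub] \<beta>_nonneg
      by (intro mult_left_mono sum_mono mult_right_mono escape_nonneg) (auto intro: order_trans)
    also have "(\<Sum>x\<in>cube n. f x * escape J t (cube n) x) =
        (\<Sum>x\<in>cube N. f x * (of_bool (x \<in> cube n) * escape J t (cube n) x))"
      using sub by (intro sum.mono_neutral_cong_left) auto
    finally show ?thesis .
  qed
  have "real N = (\<Sum>n\<in>{1..N}. 1)" by simp
  also have "\<dots> \<le> (\<Sum>n\<in>{1..N}. \<beta> * (\<Sum>x\<in>cube N. f x * (of_bool (x \<in> cube n) * escape J t (cube n) x)))"
    by (rule sum_mono) (rule one)
  also have "\<dots> = \<beta> * (\<Sum>x\<in>cube N. f x * (\<Sum>n\<in>{1..N}. of_bool (x \<in> cube n) * escape J t (cube n) x))"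
    unfolding sum_distrib_left by (rule sum.swap)
  also have "\<dots> \<le> \<beta> * (\<Sum>x\<in>cube N. f x * ?\<kappa>)"
    by (intro mult_left_mono sum_mono total f0 \<beta>_nonneg)
  also have "\<dots> = \<beta> * box_susceptibility t N * ?\<kappa>"
    by (simp add: box_susceptibility_def f_def sum_distrib_right mult.assoc)
  finally show ?thesis .
qed

text \<open>Up to a mass \<open>\<epsilon>\<close>, the summable couplings live on a finite set, on which \<open>sup_norm\<close> is bounded.\<close>

lemma truncated_moment_sublinear:
  assumes summ: "(\<lambda>z. tilt t z * J z) summable_on UNIV" and "0 < \<epsilon>"
  shows "\<exists>A. \<forall>N. (\<Sum>\<^sub>\<infinity>z. tilt t z * J z * real (min (sup_norm z) N)) \<le> A + \<epsilon> * real N"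
proof -
  let ?k = "\<lambda>z. tilt t z * J z"
  have k0: "0 \<le> ?k z" for z using J_nonneg by simp
  obtain Z where Z: "finite Z" "dist (sum ?k Z) (infsum ?k UNIV) \<le> \<epsilon>"
    using infsum_finite_approximation[OF summ \<open>0 < \<epsilon>\<close>] by blast
  define A where "A = (\<Sum>z\<in>Z. ?k z * real (sup_norm z))"
  have "(\<Sum>\<^sub>\<infinity>z. ?k z * real (min (sup_norm z) N)) \<le> A + \<epsilon> * real N" for N
  proof (rule infsum_le_finite_sums[OF truncated_moment_summable[OF summ]])
    fix X :: "(int ^ 'd) set" assume X: "finite X"
    have "(\<Sum>z\<in>X. ?k z * real (min (sup_norm z) N)) \<le> (\<Sum>z\<in>Z \<union> X. ?k z * real (min (sup_norm z) N))"
      using X Z k0 by (intro sum_mono2) auto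
    also have "\<dots> = (\<Sum>z\<in>Z. ?k z * real (min (sup_norm z) N)) + (\<Sum>z\<in>X - Z. ?k z * real (min (sup_norm z) N))"
      using X Z(1) sum.subset_diff[of Z "Z \<union> X" "\<lambda>z. ?k z * real (min (sup_norm z) N)"]
      by (simp add: Un_Diff add.commute)
    also have "\<dots> \<le> A + (\<Sum>z\<in>X - Z. ?k z * real N)"
      unfolding A_def by (intro add_mono sum_mono mult_left_mono k0) auto
    also have "(\<Sum>z\<in>X - Z. ?k z * real N) = (\<Sum>z\<in>X - Z. ?k z) * real N" by (simp add: sum_distrib_right)
    also have "(\<Sum>z\<in>X - Z. ?k z) = sum ?k (Z \<union> X) - sum ?k Z"
      using X Z(1) sum.subset_diff[of Z "Z \<union> X" ?k] by (simp add: Un_Diff)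
    also have "\<dots> * real N \<le> \<epsilon> * real N"
    proof (rule mult_right_mono)
      have "sum ?k (Z \<union> X) \<le> infsum ?k UNIV"
        using X Z(1) k0 by (intro finite_sum_le_infsum summ) auto
      then show "sum ?k (Z \<union> X) - sum ?k Z \<le> \<epsilon>" using Z(2) by (simp add: dist_real_def)
    qed simp
    finally show "(\<Sum>z\<in>X. ?k z * real (min (sup_norm z) N)) \<le> A + \<epsilon> * real N" by simp
  qed
  then show ?thesis by blast
qed

text \<open>If the box susceptibilities were bounded, the averaged inequality would bound \<open>N\<close> by a sublinear
  function of \<open>N\<close>.\<close>

lemma box_susceptibility_unbounded:
  assumes "0 < \<beta>" and summ: "(\<lambda>z. tilt t z * J z) summable_on UNIV"
    and ge: "\<And>n. 1 \<le> boundary_sum J t \<beta> (cube n)"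
  shows "\<exists>N. B < box_susceptibility t N"
proof (rule ccontr)
  assume "\<not> (\<exists>N. B < box_susceptibility t N)"
  then have le: "box_susceptibility t N \<le> B" for N by (simp add: not_less)
  then have B: "0 \<le> B" using box_susceptibility_nonneg[of t 0] order_trans by blast
  \<comment> \<open>Chosen so that the linear term \<open>\<beta> B \<epsilon> N\<close> is at most half of \<open>N\<close>.\<close>
  define \<epsilon> where "\<epsilon> = 1 / (2 * (\<beta> * B + 1))"
  have d: "0 < \<beta> * B + 1" using assms(1) B by (simp add: add_nonneg_pos)
  then have "0 < \<epsilon>" by (simp add: \<epsilon>_def)
  from truncated_moment_sublinear[OF summ this] obtain A where
    A: "\<And>N. (\<Sum>\<^sub>\<infinity>z. tilt t z * J z * real (min (sup_norm z) N)) \<le> A + \<epsilon> * real N" by blast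
  have A0: "0 \<le> A"
  proof -
    have "0 \<le> (\<Sum>\<^sub>\<infinity>z. tilt t z * J z * real (min (sup_norm z) 0))" by simp
    then show ?thesis using A[of 0] by simp
  qed
  have small: "\<beta> * B * \<epsilon> \<le> 1 / 2" using d assms(1) B by (simp add: \<epsilon>_def divide_le_eq)
  have "real N \<le> 2 * (\<beta> * B * A)" for N
  proof -
    let ?\<kappa> = "\<Sum>\<^sub>\<infinity>z. tilt t z * J z * real (min (sup_norm z) N)"
    have "0 \<le> ?\<kappa>" using J_nonneg by (intro infsum_nonneg) auto
    have "real N \<le> \<beta> * box_susceptibility t N * ?\<kappa>" by (rule averaged_boundary_sum[OF summ ge])
    also have "\<dots> \<le> \<beta> * B * ?\<kappa>"
      using le assms(1) \<open>0 \<le> ?\<kappa>\<close> by (intro mult_right_mono mult_left_mono) auto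
    also have "\<dots> \<le> \<beta> * B * (A + \<epsilon> * real N)"
      using A assms(1) B by (intro mult_left_mono) auto
    also have "\<dots> = \<beta> * B * A + (\<beta> * B * \<epsilon>) * real N" by (simp add: algebra_simps)
    also have "\<dots> \<le> \<beta> * B * A + 1 / 2 * real N"
      using small by (intro add_left_mono mult_right_mono) auto
    finally show ?thesis by simp
  qed
  then show False using reals_Archimedean2[of "2 * (\<beta> * B * A)"] by (meson not_less)
qed

end

section \<open>Moments of the couplings and linear growth\<close>

text \<open>Norms on a finite-dimensional space are equivalent: a norm is convex, hence continuous, and it has a
  positive minimum on the unit sphere.\<close>

lemma is_norm_ge_norm:
  fixes \<rho> :: "real ^ 'd \<Rightarrow> real"
  assumes "is_norm \<rho>"
  shows "\<exists>c>0. \<forall>x. c * norm x \<le> \<rho> x"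
proof -
  have \<rho>: "\<And>x. 0 \<le> \<rho> x" "\<And>x. \<rho> x = 0 \<longleftrightarrow> x = 0" "\<And>c x. \<rho> (c *\<^sub>R x) = \<bar>c\<bar> * \<rho> x"
    "\<And>x y. \<rho> (x + y) \<le> \<rho> x + \<rho> y"
    using assms by (auto simp: is_norm_def)
  have "convex_on UNIV \<rho>"
  proof (rule convex_onI)
    fix u :: real and x y assume "0 < u" "u < 1"
    then show "\<rho> ((1 - u) *\<^sub>R x + u *\<^sub>R y) \<le> (1 - u) * \<rho> x + u * \<rho> y"
      using \<rho>(4)[of "(1 - u) *\<^sub>R x" "u *\<^sub>R y"] by (simp add: \<rho>(3))
  qed simp
  then have "continuous_on (sphere 0 1) \<rho>"
    using convex_on_continuous[OF open_UNIV] continuous_on_subset by blast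
  moreover have "sphere 0 1 \<noteq> ({} :: (real ^ 'd) set)" by simp
  ultimately obtain x0 where x0: "x0 \<in> sphere 0 1" "\<And>x. x \<in> sphere 0 1 \<Longrightarrow> \<rho> x0 \<le> \<rho> x"
    using continuous_attains_inf[OF compact_sphere] by blast
  have "x0 \<noteq> 0" using x0(1) by auto
  then have pos: "0 < \<rho> x0" using \<rho>(1,2)[of x0] by simp
  have "\<rho> x0 * norm x \<le> \<rho> x" for x
  proof (cases "x = 0")
    case False
    have "\<rho> x0 \<le> \<rho> ((1 / norm x) *\<^sub>R x)" using False by (intro x0(2)) simp
    also have "\<dots> = \<rho> x / norm x" by (simp add: \<rho>(3))
    finally show ?thesis using False by (simp add: field_simps)
  qed (simp add: \<rho>(1))
  then show ?thesis using pos by blast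
qed

lemma inverse_power_sum_bounded:
  fixes s :: real
  assumes "1 < s"
  shows "\<exists>B. \<forall>N. (\<Sum>k\<in>{- int N..int N}. max 1 \<bar>real_of_int k\<bar> powr - s) \<le> B"
proof -
  let ?g = "\<lambda>k. max 1 \<bar>real_of_int k\<bar> powr - s"
  define h where "h n = max 1 (real n) powr - s" for n
  have "summable (\<lambda>n. real n powr - s)" using assms by (simp add: summable_real_powr_iff)
  then have "summable (\<lambda>n. h (Suc n))"
    by (subst (asm) summable_Suc_iff[symmetric]) (simp add: h_def)
  then have h: "summable h" by (simp add: summable_Suc_iff)
  have "(\<Sum>k\<in>{- int N..int N}. ?g k) \<le> 2 * suminf h" for N
  proof -
    have "(\<Sum>k\<in>{- int N..int N}. ?g k) \<le> (\<Sum>k\<in>int ` {..N} \<union> (\<lambda>n. - int n) ` {..N}. ?g k)"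
    proof (rule sum_mono2)
      show "{- int N..int N} \<subseteq> int ` {..N} \<union> (\<lambda>n. - int n) ` {..N}"
      proof
        fix k assume "k \<in> {- int N..int N}"
        then show "k \<in> int ` {..N} \<union> (\<lambda>n. - int n) ` {..N}"
          by (cases "0 \<le> k") (auto intro!: image_eqI[of _ int "nat k"] image_eqI[of _ "\<lambda>n. - int n" "nat (- k)"])
      qed
    qed auto
    also have "\<dots> \<le> (\<Sum>k\<in>int ` {..N}. ?g k) + (\<Sum>k\<in>(\<lambda>n. - int n) ` {..N}. ?g k)"
      by (subst sum_Un) (auto intro: sum_nonneg)
    also have "\<dots> = (\<Sum>n\<le>N. h n) + (\<Sum>n\<le>N. h n)"
      by (subst (1 2) sum.reindex) (auto simp: h_def inj_on_def)
    also have "(\<Sum>n\<le>N. h n) \<le> suminf h"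
      by (intro sum_le_suminf h) (auto simp: h_def)
    finally show ?thesis by simp
  qed
  then show ?thesis by blast
qed

text \<open>Over a cube the sum of the product factorises into one-dimensional sums.\<close>

lemma lattice_product_summable:
  fixes s :: real
  assumes "1 < s"
  shows "(\<lambda>z :: int ^ 'd. \<Prod>k\<in>UNIV. max 1 \<bar>real_of_int (z $ k)\<bar> powr - s) summable_on UNIV"
proof (rule nonneg_bdd_above_summable_on)
  let ?g = "\<lambda>k. max 1 \<bar>real_of_int k\<bar> powr - s"
  let ?G = "\<lambda>z :: int ^ 'd. \<Prod>k\<in>UNIV. ?g (z $ k)"
  show "0 \<le> ?G z" for z by (intro prod_nonneg) auto
  obtain B where B: "\<And>N. (\<Sum>k\<in>{- int N..int N}. ?g k) \<le> B"
    using inverse_power_sum_bounded[OF assms] by blast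
  show "bdd_above (sum ?G ` {X. X \<subseteq> UNIV \<and> finite X})"
  proof (rule bdd_aboveI2)

    fix X assume "X \<in> {X. X \<subseteq> (UNIV :: (int ^ 'd) set) \<and> finite X}"
    then obtain N where N: "X \<subseteq> cube N" using finite_subset_cube by blast
    have bij: "bij_betw vec_lambda (UNIV \<rightarrow>\<^sub>E {- int N..int N}) (cube N :: (int ^ 'd) set)"
      by (rule bij_betwI[where g = vec_nth]) (auto simp: cube_def)
    have "sum ?G X \<le> sum ?G (cube N)" using N by (intro sum_mono2) (auto intro!: prod_nonneg)
    also have "\<dots> = (\<Sum>z\<in>UNIV \<rightarrow>\<^sub>E {- int N..int N}. \<Prod>k\<in>(UNIV :: 'd set). ?g (z k))"
      unfolding sum.reindex_bij_betw[OF bij, symmetric] by simp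
    also have "\<dots> = (\<Prod>k\<in>(UNIV :: 'd set). \<Sum>j\<in>{- int N..int N}. ?g j)"
      by (rule prod_sum_PiE[symmetric]) auto
    also have "\<dots> \<le> B ^ CARD('d)"
      using B[of N] by (simp add: power_mono sum_nonneg)
    finally show "sum ?G X \<le> B ^ CARD('d)" .
  qed
qed

lemma component_le_norm_rvec: "\<bar>real_of_int (z $ k)\<bar> \<le> norm (rvec z)"
  using component_le_norm_cart[of "rvec z" k] by (simp add: rvec_def)

lemma sup_norm_le_norm: "real (sup_norm z) \<le> norm (rvec z)"
proof -
  have "z \<in> cube (nat \<lfloor>norm (rvec z)\<rfloor>)"
    unfolding cube_def
  proof (rule CollectI, rule allI)
    fix k
    have "\<bar>real_of_int (z $ k)\<bar> \<le> norm (rvec z)" by (rule component_le_norm_rvec)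
    then have "\<bar>z $ k\<bar> \<le> \<lfloor>norm (rvec z)\<rfloor>" by (simp add: le_floor_iff)
    then show "- int (nat \<lfloor>norm (rvec z)\<rfloor>) \<le> z $ k \<and> z $ k \<le> int (nat \<lfloor>norm (rvec z)\<rfloor>)" by linarith
  qed
  then have "sup_norm z \<le> nat \<lfloor>norm (rvec z)\<rfloor>" by (simp add: in_cube_iff)
  then show ?thesis by (simp add: le_nat_iff le_floor_iff)
qed

text \<open>Every factor on the right is at least the \<open>CARD('d)\<close>-th root of the left-hand side, because
  \<open>max 1 \<bar>z $ k\<bar> \<le> norm (rvec z)\<close> for nonzero integer vectors. The product form makes the lattice sum
  elementary.\<close>

lemma norm_power_le_product:
  fixes z :: "int ^ 'd"
  assumes "z \<noteq> 0" "0 < \<epsilon>"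
  shows "norm (rvec z) powr - (real CARD('d) + \<epsilon>) \<le>
    (\<Prod>k\<in>UNIV. max 1 \<bar>real_of_int (z $ k)\<bar> powr - (1 + \<epsilon> / real CARD('d)))"
proof -
  let ?s = "1 + \<epsilon> / real CARD('d)"
  have d: "0 < real CARD('d)" by simp
  obtain j where "z $ j \<noteq> 0" using assms(1) by (auto simp: vec_eq_iff)
  then have "1 \<le> \<bar>real_of_int (z $ j)\<bar>" by linarith
  then have one: "1 \<le> norm (rvec z)" using component_le_norm_rvec[of z j] by linarith
  have s: "- (real CARD('d) + \<epsilon>) = - ?s * real CARD('d)" using d by (simp add: field_simps)
  have "norm (rvec z) powr - (real CARD('d) + \<epsilon>) = (norm (rvec z) powr - ?s) ^ CARD('d)"
    unfolding s powr_powr[symmetric] using one by (subst powr_realpow) auto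
  also have "\<dots> = (\<Prod>k\<in>(UNIV :: 'd set). norm (rvec z) powr - ?s)" by simp
  also have "\<dots> \<le> (\<Prod>k\<in>UNIV. max 1 \<bar>real_of_int (z $ k)\<bar> powr - ?s)"
  proof (rule prod_mono, rule conjI)
    fix k
    have "0 \<le> ?s" using assms(2) by simp
    then show "norm (rvec z) powr - ?s \<le> max 1 \<bar>real_of_int (z $ k)\<bar> powr - ?s"
      using one component_le_norm_rvec[of z k] by (intro powr_mono2') auto
  qed simp
  finally show ?thesis .
qed

text \<open>Where \<open>\<psi>\<close> obeys the decay bound, the summand is at most a constant times
  \<open>norm (rvec z) powr - (real CARD('d) + \<epsilon>)\<close>; only finitely many \<open>z\<close> are excluded.\<close>

lemma moment_summable:
  fixes \<rho> :: "real ^ 'd \<Rightarrow> real"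
  assumes \<rho>: "is_norm \<rho>" and J: "couplings \<rho> \<psi> J" and "0 < \<epsilon>"
    and O: "\<psi> \<in> O[lattice_at_infinity](\<lambda>x. \<rho> (rvec x) powr (- real CARD('d) - 1 - \<epsilon>))"
  shows "(\<lambda>z. real (sup_norm z) * (J z * exp (\<rho> (rvec z)))) summable_on UNIV"
proof -
  let ?a = "- real CARD('d) - 1 - \<epsilon>"
  let ?G = "\<lambda>z :: int ^ 'd. \<Prod>k\<in>UNIV. max 1 \<bar>real_of_int (z $ k)\<bar> powr - (1 + \<epsilon> / real CARD('d))"
  have J': "J z = \<psi> z * exp (- \<rho> (rvec z))" if "z \<noteq> 0" for z using J that by (simp add: couplings_def)
  have J0: "0 \<le> J z" for z using J by (simp add: couplings_def)
  obtain c0 where c0: "0 < c0" "\<And>x. c0 * norm x \<le> \<rho> x" using is_norm_ge_norm[OF \<rho>] by blast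
  from O obtain c where c: "0 < c"
    "\<forall>\<^sub>F z in lattice_at_infinity. norm (\<psi> z) \<le> c * norm (\<rho> (rvec z) powr ?a)"
    by (rule landau_o.bigE)
  then obtain R where R: "\<And>z. R \<le> norm (rvec z) \<Longrightarrow> norm (\<psi> z) \<le> c * norm (\<rho> (rvec z) powr ?a)"
    unfolding lattice_at_infinity_def eventually_filtercomap eventually_at_top_linorder by blast
  define B where "B = insert 0 {z :: int ^ 'd. norm (rvec z) < R}"
  have "{z :: int ^ 'd. norm (rvec z) < R} \<subseteq> cube (nat \<lceil>R\<rceil>)"
  proof
    fix z :: "int ^ 'd" assume "z \<in> {z. norm (rvec z) < R}"
    then have "real (sup_norm z) < R" using sup_norm_le_norm[of z] by simp
    then have "sup_norm z \<le> nat \<lceil>R\<rceil>" by linarith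
    then show "z \<in> cube (nat \<lceil>R\<rceil>)" by (simp add: in_cube_iff)
  qed
  then have finB: "finite B" unfolding B_def using finite_cube finite_subset by blast
  have bound: "real (sup_norm z) * (J z * exp (\<rho> (rvec z))) \<le> c * c0 powr ?a * ?G z" if "z \<notin> B" for z
  proof -
    have z: "z \<noteq> 0" "R \<le> norm (rvec z)" using that by (auto simp: B_def)
    have n: "0 < norm (rvec z)"
      using z(1) by (auto simp: rvec_def vec_eq_iff)
    have "J z * exp (\<rho> (rvec z)) = \<psi> z" by (simp add: J'[OF z(1)] exp_minus)
    also have "\<dots> \<le> c * \<rho> (rvec z) powr ?a" using R[OF z(2)] by simp
    also have "\<dots> \<le> c * (c0 * norm (rvec z)) powr ?a"
      using c c0 n \<open>0 < \<epsilon>\<close> by (intro mult_left_mono powr_mono2') auto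
    also have "\<dots> = c * c0 powr ?a * norm (rvec z) powr ?a"
      using c0 n by (simp add: powr_mult)
    finally have \<psi>_le: "J z * exp (\<rho> (rvec z)) \<le> c * c0 powr ?a * norm (rvec z) powr ?a" .
    have "real (sup_norm z) * (J z * exp (\<rho> (rvec z))) \<le> norm (rvec z) * (c * c0 powr ?a * norm (rvec z) powr ?a)"
      by (rule mult_mono[OF sup_norm_le_norm \<psi>_le]) (simp_all add: J0)
    also have "\<dots> = c * c0 powr ?a * (norm (rvec z) powr 1 * norm (rvec z) powr ?a)"
      using n by simp
    also have "norm (rvec z) powr 1 * norm (rvec z) powr ?a = norm (rvec z) powr - (real CARD('d) + \<epsilon>)"
      unfolding powr_add[symmetric] by simp
    also have "c * c0 powr ?a * \<dots> \<le> c * c0 powr ?a * ?G z"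
      using c by (intro mult_left_mono norm_power_le_product z \<open>0 < \<epsilon>\<close>) auto
    finally show ?thesis .
  qed
  have "?G summable_on UNIV" using \<open>0 < \<epsilon>\<close> by (intro lattice_product_summable) simp
  then have "(\<lambda>z. c * c0 powr ?a * ?G z) summable_on UNIV - B"
    by (intro summable_on_cmult_right) (rule summable_on_subset_banach, auto)
  then have "(\<lambda>z. real (sup_norm z) * (J z * exp (\<rho> (rvec z)))) summable_on UNIV - B"
    by (rule summable_on_comparison_test) (use bound J0 in auto)
  then have "(\<lambda>z. real (sup_norm z) * (J z * exp (\<rho> (rvec z)))) summable_on (UNIV - B) \<union> B"
    using summable_on_finite[OF finB] by (rule summable_on_Un_disjoint) auto
  then show ?thesis by simp
qed

theorem theorem3p1:
  fixes \<rho> :: "real ^ 'd \<Rightarrow> real" and \<psi> J :: "int ^ 'd \<Rightarrow> real"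
  assumes "is_norm \<rho>" and "couplings \<rho> \<psi> J"
  shows "\<exists>C :: real \<Rightarrow> real. (\<forall>b>0. C b > 0) \<and>
    (\<forall>t \<in> wulff \<rho>. \<forall>b. beta_sat J t = ereal b \<and> b > 0 \<longrightarrow>
      (\<exists>n :: nat \<Rightarrow> nat. strict_mono_on {1..} n \<and> (\<forall>k\<ge>1. n k > 0) \<and>
        (\<forall>k\<ge>1. (\<Sum>x\<in>cube (n k). exp (t \<bullet> rvec x) * measure (fk J b) (connection (cube (n k)) 0 x))
                  \<ge> C b * real k)) \<and>
      G_fun J b t = \<infinity> \<and>
      ((\<exists>\<epsilon>>0. \<psi> \<in> O[lattice_at_infinity](\<lambda>x. \<rho> (rvec x) powr (- real CARD('d) - 1 - \<epsilon>))) \<longrightarrow>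
        (\<forall>k\<ge>1. (\<Sum>x\<in>cube k. exp (t \<bullet> rvec x) * measure (fk J b) (connection (cube k) 0 x))
                  \<ge> C b * real k)))"
proof -
  interpret ferromagnet J
    using assms(2) by unfold_locales (auto simp: couplings_def)
  have J0: "J 0 = 0" using assms(2) by (simp add: couplings_def)
  \<comment> \<open>A bound for \<open>\<parallel>z\<parallel>\<^sub>\<infinity> e\<^bsup>t\<cdot>z\<^esup> J\<^sub>z\<close> that is uniform in \<open>t \<in> wulff \<rho>\<close>.\<close>
  define q where "q z = real (sup_norm z) * (J z * exp (\<rho> (rvec z)))" for z
  have q0: "0 \<le> q z" for z using J_nonneg by (simp add: q_def)
  define K where "K = (\<Sum>\<^sub>\<infinity>z. q z)"
  have K0: "0 \<le> K" unfolding K_def using q0 by (intro infsum_nonneg)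
  \<comment> \<open>An infinite sum that diverges is \<open>0\<close> by convention; adding 1 keeps \<open>C b\<close> positive in that case and when all moments vanish.\<close>
  define C where "C b = 1 / (b * (K + 1))" for b :: real
  have C_pos: "0 < C b" if "0 < b" for b using that K0 by (simp add: C_def)
  show ?thesis
  proof (intro exI[of _ C] conjI allI impI ballI C_pos)
    fix t b assume t: "t \<in> wulff \<rho>" and "beta_sat J t = ereal b \<and> b > 0"
    then have b: "beta_sat J t = ereal b" "0 < b" by simp_all
    interpret fk_model J b using b by unfold_locales simp
    have summ: "(\<lambda>z. tilt t z * J z) summable_on UNIV"
      by (rule boundary_sum_ge_1_at_saturation(1)[OF J0 b finite_cube[of 0] zero_in_cube])
    have ge: "1 \<le> boundary_sum J t b (cube n)" for n
      by (rule boundary_sum_ge_1_at_saturation(2)[OF J0 b finite_cube zero_in_cube])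
    have box: "(\<Sum>x\<in>cube n. exp (t \<bullet> rvec x) * conn_prob (cube n) x) = box_susceptibility t n" for n
      by (simp add: box_susceptibility_def tilt_def)
    note unbounded = box_susceptibility_unbounded[OF b(2) summ ge]
    have "\<exists>n. \<forall>k. (0 < n k \<and> C b * real k \<le> box_susceptibility t (n k)) \<and> n k < n (Suc k)"
    proof (rule dependent_nat_choice)
      show "\<exists>m. 0 < m \<and> C b * real 0 \<le> box_susceptibility t m"
        using box_susceptibility_nonneg by (intro exI[of _ 1]) simp
      fix m k
      obtain N where N: "C b * real (Suc k) < box_susceptibility t N" using unbounded by blast
      have "box_susceptibility t N \<le> box_susceptibility t (max N (Suc m))"
        by (rule box_susceptibility_mono) simp
      then show "\<exists>m'. (0 < m' \<and> C b * real (Suc k) \<le> box_susceptibility t m') \<and> m < m'"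
        using N by (intro exI[of _ "max N (Suc m)"]) auto
    qed
    then obtain n where n: "\<And>k. 0 < n k" "\<And>k. C b * real k \<le> box_susceptibility t (n k)" "\<And>k. n k < n (Suc k)"
      by blast
    have "strict_mono n" using n(3) by (simp add: strict_mono_Suc_iff)
    then have "strict_mono_on {1..} n" by (simp add: strict_mono_on_def strict_mono_def)
    then show "\<exists>n. strict_mono_on {1..} n \<and> (\<forall>k\<ge>1. n k > 0) \<and>
        (\<forall>k\<ge>1. (\<Sum>x\<in>cube (n k). exp (t \<bullet> rvec x) * conn_prob (cube (n k)) x) \<ge> C b * real k)"
      using n unfolding box by blast
    show "G_fun J b t = \<infinity>"
    proof (rule ccontr)
      assume "G_fun J b t \<noteq> \<infinity>"
      then obtain B where B: "G_fun J b t = ennreal B" "0 \<le> B" by (cases "G_fun J b t") auto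
      obtain N where "B < box_susceptibility t N" using unbounded by blast
      moreover have "box_susceptibility t N \<le> B"
        using box_susceptibility_le_G_fun[of t N] B by simp
      ultimately show False by simp
    qed
    fix k :: nat
    assume "\<exists>\<epsilon>>0. \<psi> \<in> O[lattice_at_infinity](\<lambda>x. \<rho> (rvec x) powr (- real CARD('d) - 1 - \<epsilon>))"
    then have q: "q summable_on UNIV"
      unfolding q_def using moment_summable[OF assms] by blast
    have "(\<Sum>\<^sub>\<infinity>z. tilt t z * J z * real (min (sup_norm z) k)) \<le> K"
      unfolding K_def
    proof (rule infsum_mono[OF truncated_moment_summable[OF summ] q])
      fix z
      have "tilt t z \<le> exp (\<rho> (rvec z))" using t by (simp add: tilt_def wulff_def)
      then have "tilt t z * J z * real (min (sup_norm z) k) \<le> exp (\<rho> (rvec z)) * J z * real (sup_norm z)"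
        using J_nonneg[of z] by (intro mult_mono) auto
      then show "tilt t z * J z * real (min (sup_norm z) k) \<le> q z" by (simp add: q_def mult_ac)
    qed
    then have "b * box_susceptibility t k * (\<Sum>\<^sub>\<infinity>z. tilt t z * J z * real (min (sup_norm z) k)) \<le>
        b * box_susceptibility t k * (K + 1)"
      using b(2) box_susceptibility_nonneg[of t k] by (intro mult_left_mono) auto
    then have "real k \<le> b * (K + 1) * box_susceptibility t k"
      using averaged_boundary_sum[OF summ ge, of k] by (simp add: mult_ac)
    then show "C b * real k \<le> (\<Sum>x\<in>cube k. exp (t \<bullet> rvec x) * conn_prob (cube k) x)"
      unfolding box C_def using b(2) K0 by (simp add: divide_le_eq mult_ac)
  qed
qed

end
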